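(* Let $2\le n<\infty$. (1) Let $\mathcal{A}$ be a unital $C^*$-algebra and let $(a_1,\dots,a_n)$ be an $n$-tuple in $\mathcal{A}$ which is a strict dual row contraction. Then there exist $a,b\in\mathcal{A}^+_{-1}$ with $a+b=1$ such that \[\begin{bmatrix} a & a_1 & \cdots & a_n\\ a_1^* & b & & \\ \vdots & & \ddots & \\ a_n^* & & & b\end{bmatrix}\in M_{n+1}(\mathcal{A})^+_{-1}.\] (2) Let $\mathcal{M}$ be a von Neumann algebra and let $(a_1,\dots,a_n)$ be an $n$-tuple in $\mathcal{M}$ which is a dual row contraction. Then there exist $a,b\in\mathcal{M}^+$ with $a+b=1$ such that \[\begin{bmatrix} a & a_1 & \cdots & a_n\\ a_1^* & b & & \\ \vdots & & \ddots & \\ a_n^* & & & b\end{bmatrix}\in M_{n+1}(\mathcal{M})^+.\] (Blank entries are $0$.)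
   Context: $\mathcal{O}_n$ is the Cuntz algebra, generated by isometries $S_1,\dots,S_n$ with $\sum_{i=1}^n S_iS_i^*=I$. For an operator system (in particular a unital $C^*$-algebra) $\mathcal{S}$, write $p>>0$ if there is $\epsilon>0$ with $p-\epsilon 1\in\mathcal{S}^+$, and $\mathcal{S}^+_{-1}=\{p\in\mathcal{S}:p>>0\}$. An $n$-tuple $(a_1,\dots,a_n)$ in a unital $C^*$-algebra $\mathcal{A}$ is a dual row contraction if \[I\otimes 1+\sum_{j=1}^nS_j\otimes a_j^*+\sum_{j=1}^nS_j^*\otimes a_j\ge 0\] in the minimal tensor product $\mathcal{O}_n\otimes_{\min}\mathcal{A}$, and a strict dual row contraction if this element is $>>0$ there. *)

theory Defs
  imports "HOL-Analysis.Analysis" "Jordan_Normal_Form.Matrix"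
begin

section \<open>Complex Hilbert spaces and unital C*-algebras\<close>

class complex_vector = real_vector +
  fixes scaleC :: "complex \<Rightarrow> 'a \<Rightarrow> 'a" (infixr \<open>*\<^sub>C\<close> 75)
  assumes scaleC_add_right: "c *\<^sub>C (x + y) = c *\<^sub>C x + c *\<^sub>C y"
    and scaleC_add_left: "(c + d) *\<^sub>C x = c *\<^sub>C x + d *\<^sub>C x"
    and scaleC_scaleC: "c *\<^sub>C d *\<^sub>C x = (c * d) *\<^sub>C x"
    and scaleC_of_real: "complex_of_real r *\<^sub>C x = r *\<^sub>R x"

global_interpretation complex_vector: vector_space "scaleC :: complex \<Rightarrow> 'a \<Rightarrow> 'a::complex_vector"
proof
  show "1 *\<^sub>C x = x" for x :: 'a
    using scaleC_of_real[of 1 x] by simp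
qed (simp_all add: scaleC_add_right scaleC_add_left scaleC_scaleC)

class complex_normed_vector = complex_vector + real_normed_vector +
  assumes norm_scaleC: "norm (c *\<^sub>C x) = cmod c * norm x"

text \<open>
  The inner product is linear in the second argument. The zero space is excluded, so that the
  bounded operators on a Hilbert space form a normed algebra with \<open>norm 1 = 1\<close>; the zero algebra is
  likewise not a unital C*-algebra here.
\<close>

class chilbert_space = complex_normed_vector + complete_space +
  fixes cinner :: "'a \<Rightarrow> 'a \<Rightarrow> complex"
  assumes cinner_commute: "cinner x y = cnj (cinner y x)"
    and cinner_add_right: "cinner x (y + z) = cinner x y + cinner x z"
    and cinner_scaleC_right: "cinner x (c *\<^sub>C y) = c * cinner x y"
    and cinner_self: "cinner x x = complex_of_real ((norm x)\<^sup>2)"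
    and chilbert_nontrivial: "\<exists>x::'a. x \<noteq> 0"

class cstar_algebra = complex_normed_vector + real_normed_algebra_1 + complete_space +
  fixes star :: "'a \<Rightarrow> 'a"
  assumes mult_scaleC_left: "(c *\<^sub>C x) * y = c *\<^sub>C (x * y)"
    and mult_scaleC_right: "x * (c *\<^sub>C y) = c *\<^sub>C (x * y)"
    and star_star: "star (star x) = x"
    and star_add: "star (x + y) = star x + star y"
    and star_scaleC: "star (c *\<^sub>C x) = cnj c *\<^sub>C star x"
    and star_mult: "star (x * y) = star y * star x"
    and cstar_identity: "norm (star x * x) = (norm x)\<^sup>2"

instance chilbert_space \<subseteq> banach ..
instance cstar_algebra \<subseteq> banach ..

lemma cinner_add_left: "cinner (x + y) z = cinner x z + cinner (y::'a::chilbert_space) z"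
  by (metis cinner_add_right cinner_commute complex_cnj_add)

lemma cinner_scaleC_left: "cinner (c *\<^sub>C x) y = cnj c * cinner (x::'a::chilbert_space) y"
  by (metis cinner_commute cinner_scaleC_right complex_cnj_mult)

lemma scaleC_minus_one: "(-1) *\<^sub>C x = - (x::'a::complex_vector)"
  by (metis complex_vector.scale_minus_left complex_vector.scale_one)

lemma cinner_minus_right: "cinner x (- y) = - cinner (x::'a::chilbert_space) y"
  by (metis cinner_scaleC_right mult_minus1 scaleC_minus_one)

lemma cinner_minus_left: "cinner (- x) y = - cinner (x::'a::chilbert_space) y"
  by (metis cinner_minus_right cinner_commute complex_cnj_minus)

lemma cinner_diff_right: "cinner x (y - z) = cinner x y - cinner (x::'a::chilbert_space) z"
  by (metis cinner_add_right cinner_minus_right diff_conv_add_uminus)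

lemma cinner_diff_left: "cinner (x - y) z = cinner x z - cinner (y::'a::chilbert_space) z"
  by (metis cinner_add_left cinner_minus_left diff_conv_add_uminus)

lemma cinner_zero_right [simp]: "cinner (x::'a::chilbert_space) 0 = 0"
  using cinner_add_right[of x 0 0] by simp

lemma cinner_zero_left [simp]: "cinner 0 (x::'a::chilbert_space) = 0"
  using cinner_add_left[of 0 0 x] by simp

lemma cinner_eqI: "(\<And>z. cinner z x = cinner z y) \<Longrightarrow> x = (y::'a::chilbert_space)"
  using cinner_self[of "x - y"] by (simp add: cinner_diff_right)

lemma norm_add_square:
  "(norm (x + y))\<^sup>2 = (norm x)\<^sup>2 + (norm y)\<^sup>2 + 2 * Re (cinner x (y::'a::chilbert_space))"
proof -
  have "complex_of_real ((norm (x + y))\<^sup>2) =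
      of_real ((norm x)\<^sup>2) + of_real ((norm y)\<^sup>2) + (cinner x y + cnj (cinner x y))"
    unfolding cinner_self[symmetric] by (simp add: cinner_add_left cinner_add_right flip: cinner_commute)
  also have "cinner x y + cnj (cinner x y) = of_real (2 * Re (cinner x y))"
    by (simp add: complex_add_cnj)
  finally show ?thesis
    by (metis of_real_add of_real_eq_iff)
qed

lemma cinner_zero_if_minimal:
  fixes x z :: "'a::chilbert_space"
  assumes min: "\<And>c. norm x \<le> norm (x + c *\<^sub>C z)"
  shows "cinner x z = 0"
proof (rule ccontr)
  assume nz: "cinner x z \<noteq> 0"
  then have z: "norm z > 0" by auto
  define c where "c = - cnj (cinner x z) / of_real ((norm z)\<^sup>2)"
  have cm: "cmod c = cmod (cinner x z) / (norm z)\<^sup>2"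
    by (simp add: c_def norm_divide norm_power)
  have "c * cinner x z = of_real (- ((cmod (cinner x z))\<^sup>2 / (norm z)\<^sup>2))"
    using complex_norm_square[of "cinner x z"] by (simp add: c_def mult.commute)
  then have re: "Re (cinner x (c *\<^sub>C z)) = - ((cmod (cinner x z))\<^sup>2 / (norm z)\<^sup>2)"
    by (simp add: cinner_scaleC_right)
  have "(norm x)\<^sup>2 \<le> (norm (x + c *\<^sub>C z))\<^sup>2"
    using min[of c] by (simp add: power_mono)
  also have "\<dots> = (norm x)\<^sup>2 - (cmod (cinner x z))\<^sup>2 / (norm z)\<^sup>2"
    unfolding norm_add_square re norm_scaleC cm using z
    by (simp add: power_mult_distrib power_divide field_simps power2_eq_square)
  finally have "(cmod (cinner x z))\<^sup>2 / (norm z)\<^sup>2 \<le> 0" by simp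
  moreover have "(cmod (cinner x z))\<^sup>2 / (norm z)\<^sup>2 > 0"
    using nz z by simp
  ultimately show False by simp
qed

lemma Cauchy_Schwarz: "cmod (cinner x y) \<le> norm x * norm (y::'a::chilbert_space)"
proof (cases "y = 0")
  case False
  then have y: "norm y > 0" by simp
  define c where "c = - cnj (cinner x y) / of_real ((norm y)\<^sup>2)"
  have cm: "cmod c = cmod (cinner x y) / (norm y)\<^sup>2"
    by (simp add: c_def norm_divide norm_power)
  have "c * cinner x y = of_real (- ((cmod (cinner x y))\<^sup>2 / (norm y)\<^sup>2))"
    using complex_norm_square[of "cinner x y"] by (simp add: c_def mult.commute)
  then have re: "Re (cinner x (c *\<^sub>C y)) = - ((cmod (cinner x y))\<^sup>2 / (norm y)\<^sup>2)"
    by (simp add: cinner_scaleC_right)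
  have "0 \<le> (norm (x + c *\<^sub>C y))\<^sup>2" by simp
  also have "\<dots> = (norm x)\<^sup>2 - (cmod (cinner x y))\<^sup>2 / (norm y)\<^sup>2"
    unfolding norm_add_square re norm_scaleC cm using y
    by (simp add: power_mult_distrib power_divide field_simps power2_eq_square)
  finally have "(cmod (cinner x y))\<^sup>2 \<le> (norm x * norm y)\<^sup>2"
    using y by (simp add: field_simps)
  then show ?thesis
    by (rule power2_le_imp_le) simp
qed simp

lemma Riesz_representation:
  fixes f :: "'a::chilbert_space \<Rightarrow> complex"
  assumes bl: "bounded_linear f" and lin: "\<And>c x. f (c *\<^sub>C x) = c * f x"
  shows "\<exists>y. \<forall>x. f x = cinner y x"
proof (cases "\<forall>x. f x = 0")
  case True
  then show ?thesis by (intro exI[of _ 0]) simp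
next
  case False
  then obtain w where w: "f w \<noteq> 0" by blast
  interpret f: bounded_linear f by (rule bl)
  define C where "C = {x. f x = 1}"
  have "inverse (f w) *\<^sub>C w \<in> C" using w by (simp add: C_def lin)
  then have Cne: "norm ` C \<noteq> {}" by blast
  have bdd: "bdd_below (norm ` C)" by (rule bdd_belowI[of _ 0]) auto
  define d where "d = Inf (norm ` C)"
  have dle: "d \<le> norm x" if "x \<in> C" for x
    unfolding d_def by (rule cInf_lower[OF _ bdd]) (use that in simp)
  have d0: "d \<ge> 0" unfolding d_def by (rule cInf_greatest[OF Cne]) auto
  have "\<exists>x\<in>C. norm x < d + 1 / real (Suc n)" for n
    using cInf_lessD[OF Cne, of "d + 1 / real (Suc n)"] unfolding d_def by auto
  then obtain X where XC: "\<And>n. X n \<in> C" and Xn: "\<And>n. norm (X n) < d + 1 / real (Suc n)"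
    by metis
  have par: "(norm (x - y))\<^sup>2 \<le> 2 * (norm x)\<^sup>2 + 2 * (norm y)\<^sup>2 - 4 * d\<^sup>2" if "x \<in> C" "y \<in> C" for x y
  proof -
    have "(1/2) *\<^sub>R (x + y) \<in> C"
      using that by (simp add: C_def f.scaleR f.add scaleR_conv_of_real)
    from dle[OF this] have "2 * d \<le> norm (x + y)" by simp
    then have "(2 * d)\<^sup>2 \<le> (norm (x + y))\<^sup>2" using d0 by (intro power_mono) auto
    moreover have "(norm (x + y))\<^sup>2 + (norm (x - y))\<^sup>2 = 2 * (norm x)\<^sup>2 + 2 * (norm y)\<^sup>2"
      using norm_add_square[of x y] norm_add_square[of x "- y"] by (simp add: cinner_minus_right)
    ultimately show ?thesis by (simp add: power_mult_distrib)
  qed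
  have "Cauchy X"
  proof (rule CauchyI)
    fix e :: real assume e: "0 < e"
    have "(\<lambda>n. 4 * (d + 1 / real (Suc n))\<^sup>2 - 4 * d\<^sup>2) \<longlonglongrightarrow> 4 * (d + 0)\<^sup>2 - 4 * d\<^sup>2"
      by (intro tendsto_intros LIMSEQ_Suc[OF lim_1_over_n, unfolded o_def])
    then have "eventually (\<lambda>n. 4 * (d + 1 / real (Suc n))\<^sup>2 - 4 * d\<^sup>2 < e\<^sup>2) sequentially"
      using e by (intro order_tendstoD(2)[where y = 0 and f = "\<lambda>n. 4 * (d + 1 / real (Suc n))\<^sup>2 - 4 * d\<^sup>2"]) auto
    then obtain N where N: "4 * (d + 1 / real (Suc N))\<^sup>2 - 4 * d\<^sup>2 < e\<^sup>2"
      by (auto simp: eventually_sequentially)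
    have *: "(norm (X m))\<^sup>2 \<le> (d + 1 / real (Suc N))\<^sup>2" if "m \<ge> N" for m
    proof -
      have "1 / real (Suc m) \<le> 1 / real (Suc N)" using that by (simp add: field_simps)
      then have "norm (X m) \<le> d + 1 / real (Suc N)" using Xn[of m] by linarith
      then show ?thesis by (intro power_mono) auto
    qed
    have "norm (X m - X n) < e" if "m \<ge> N" "n \<ge> N" for m n
    proof -
      have "(norm (X m - X n))\<^sup>2 < e\<^sup>2"
        using par[OF XC XC, of m n] *[OF that(1)] *[OF that(2)] N by linarith
      then show ?thesis using e by (meson less_imp_le power2_less_imp_less)
    qed
    then show "\<exists>M. \<forall>m\<ge>M. \<forall>n\<ge>M. norm (X m - X n) < e" by blast
  qed
  then obtain x where x: "X \<longlonglongrightarrow> x"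
    using Cauchy_convergent convergent_def by blast
  have "(\<lambda>n. f (X n)) \<longlonglongrightarrow> f x" by (rule f.tendsto[OF x])
  moreover have "(\<lambda>n. f (X n)) = (\<lambda>n. 1)" using XC by (auto simp: C_def)
  ultimately have fx: "f x = 1" by (metis LIMSEQ_const_iff)
  have "(\<lambda>n. norm (X n)) \<longlonglongrightarrow> norm x" by (rule tendsto_norm[OF x])
  moreover have "(\<lambda>n. d + 1 / real (Suc n)) \<longlonglongrightarrow> d + 0"
    by (intro tendsto_intros LIMSEQ_Suc[OF lim_1_over_n, unfolded o_def])
  ultimately have nx: "norm x \<le> d"
    using Xn by (metis (no_types, lifting) LIMSEQ_le add.right_neutral less_imp_le)
  have orth: "cinner x z = 0" if z: "f z = 0" for z
  proof (rule cinner_zero_if_minimal)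
    fix c
    have "x + c *\<^sub>C z \<in> C" using z fx by (simp add: C_def f.add lin)
    from dle[OF this] nx show "norm x \<le> norm (x + c *\<^sub>C z)" by linarith
  qed
  have xn0: "norm x \<noteq> 0" using fx f.zero by auto
  have key: "cinner x v = f v * of_real ((norm x)\<^sup>2)" for v
  proof -
    have "f (v - f v *\<^sub>C x) = 0" by (simp add: f.diff lin fx)
    from orth[OF this] show ?thesis
      by (simp add: cinner_diff_right cinner_scaleC_right cinner_self)
  qed
  show ?thesis
  proof (intro exI allI)
    fix v
    show "f v = cinner (of_real (1 / (norm x)\<^sup>2) *\<^sub>C x) v"
      using xn0 by (simp add: cinner_scaleC_left key)
  qed
qed


section \<open>The Hilbert space of square-summable families\<close>

lemma ell2_boundI:
  fixes f :: "'i \<Rightarrow> complex"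
  assumes "\<And>F. finite F \<Longrightarrow> L2_set (\<lambda>i. cmod (f i)) F \<le> b"
  shows "(\<lambda>i. (cmod (f i))\<^sup>2) summable_on UNIV" and "sqrt (\<Sum>\<^sub>\<infinity>i. (cmod (f i))\<^sup>2) \<le> b"
proof -
  have b: "0 \<le> b" using assms[of "{}"] by simp
  have le: "(\<Sum>i\<in>F. (cmod (f i))\<^sup>2) \<le> b\<^sup>2" if "finite F" for F
    using assms[OF that] unfolding L2_set_def by (rule sqrt_le_D)
  show s: "(\<lambda>i. (cmod (f i))\<^sup>2) summable_on UNIV"
    by (rule nonneg_bdd_above_summable_on) (auto intro!: bdd_aboveI[of _ "b\<^sup>2"] le)
  have "(\<Sum>\<^sub>\<infinity>i. (cmod (f i))\<^sup>2) \<le> b\<^sup>2"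
    by (rule infsum_le_finite_sums[OF s le])
  then show "sqrt (\<Sum>\<^sub>\<infinity>i. (cmod (f i))\<^sup>2) \<le> b"
    using b by (rule real_le_lsqrt[rotated])
qed

lemma ell2_boundD:
  fixes f :: "'i \<Rightarrow> complex"
  assumes "(\<lambda>i. (cmod (f i))\<^sup>2) summable_on UNIV" "finite F"
  shows "L2_set (\<lambda>i. cmod (f i)) F \<le> sqrt (\<Sum>\<^sub>\<infinity>i. (cmod (f i))\<^sup>2)"
  unfolding L2_set_def using assms by (auto intro!: finite_sum_le_infsum)

typedef 'i ell2 = "{f :: 'i \<Rightarrow> complex. (\<lambda>i. (cmod (f i))\<^sup>2) summable_on UNIV}"
  morphisms ell2_nth Abs_ell2
  by (rule exI[of _ "\<lambda>_. 0"]) simp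

setup_lifting type_definition_ell2

lemma L2_set_cmod_add:
  "L2_set (\<lambda>i. cmod (f i + g i)) F \<le> L2_set (\<lambda>i. cmod (f i)) F + L2_set (\<lambda>i. cmod (g i)) F"
proof -
  have "L2_set (\<lambda>i. cmod (f i + g i)) F \<le> L2_set (\<lambda>i. cmod (f i) + cmod (g i)) F"
    by (rule L2_set_mono) (auto intro: norm_triangle_ineq)
  also have "\<dots> \<le> L2_set (\<lambda>i. cmod (f i)) F + L2_set (\<lambda>i. cmod (g i)) F"
    by (rule L2_set_triangle_ineq)
  finally show ?thesis .
qed

lemma ell2_add_closed:
  fixes f g :: "'i \<Rightarrow> complex"
  assumes f: "(\<lambda>i. (cmod (f i))\<^sup>2) summable_on UNIV" and g: "(\<lambda>i. (cmod (g i))\<^sup>2) summable_on UNIV"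
  shows "(\<lambda>i. (cmod (f i + g i))\<^sup>2) summable_on UNIV"
    and "sqrt (\<Sum>\<^sub>\<infinity>i. (cmod (f i + g i))\<^sup>2) \<le>
      sqrt (\<Sum>\<^sub>\<infinity>i. (cmod (f i))\<^sup>2) + sqrt (\<Sum>\<^sub>\<infinity>i. (cmod (g i))\<^sup>2)"
proof -
  have "L2_set (\<lambda>i. cmod (f i + g i)) F \<le>
      sqrt (\<Sum>\<^sub>\<infinity>i. (cmod (f i))\<^sup>2) + sqrt (\<Sum>\<^sub>\<infinity>i. (cmod (g i))\<^sup>2)" if "finite F" for F
    using L2_set_cmod_add[of f g F] ell2_boundD[OF f that] ell2_boundD[OF g that] by linarith
  note le = this
  show "(\<lambda>i. (cmod (f i + g i))\<^sup>2) summable_on UNIV"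
    by (rule ell2_boundI(1)[OF le])
  show "sqrt (\<Sum>\<^sub>\<infinity>i. (cmod (f i + g i))\<^sup>2) \<le>
      sqrt (\<Sum>\<^sub>\<infinity>i. (cmod (f i))\<^sup>2) + sqrt (\<Sum>\<^sub>\<infinity>i. (cmod (g i))\<^sup>2)"
    by (rule ell2_boundI(2)[OF le])
qed

lemma ell2_scale_closed:
  fixes f :: "'i \<Rightarrow> complex"
  assumes f: "(\<lambda>i. (cmod (f i))\<^sup>2) summable_on UNIV"
  shows "(\<lambda>i. (cmod (c * f i))\<^sup>2) summable_on UNIV"
  using summable_on_cmult_right[OF f, of "(cmod c)\<^sup>2"] by (simp add: norm_mult power_mult_distrib)

lemma ell2_cinner_summable:
  fixes f g :: "'i \<Rightarrow> complex"
  assumes f: "(\<lambda>i. (cmod (f i))\<^sup>2) summable_on UNIV" and g: "(\<lambda>i. (cmod (g i))\<^sup>2) summable_on UNIV"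
  shows "(\<lambda>i. cnj (f i) * g i) summable_on UNIV"
proof -
  have s: "(\<lambda>i. (cmod (f i))\<^sup>2 + (cmod (g i))\<^sup>2) summable_on UNIV"
    by (rule summable_on_add[OF f g])
  have "(\<lambda>i. norm (cnj (f i) * g i)) summable_on UNIV"
  proof (rule Infinite_Sum.abs_summable_on_comparison_test')
    show "(\<lambda>i. (cmod (f i))\<^sup>2 + (cmod (g i))\<^sup>2) summable_on UNIV" by (rule s)
    fix i
    have "2 * (cmod (f i) * cmod (g i)) \<le> (cmod (f i))\<^sup>2 + (cmod (g i))\<^sup>2"
      using sum_squares_bound[of "cmod (f i)" "cmod (g i)"] by (simp add: mult.assoc)
    moreover have "0 \<le> cmod (f i) * cmod (g i)" by simp
    ultimately show "norm (cnj (f i) * g i) \<le> (cmod (f i))\<^sup>2 + (cmod (g i))\<^sup>2"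
      unfolding norm_mult complex_mod_cnj by linarith
  qed
  then show ?thesis by (rule Infinite_Sum.abs_summable_summable)
qed

instantiation ell2 :: (type) complex_normed_vector
begin

lift_definition zero_ell2 :: "'a ell2" is "\<lambda>_. 0" by simp
lift_definition plus_ell2 :: "'a ell2 \<Rightarrow> 'a ell2 \<Rightarrow> 'a ell2" is "\<lambda>f g i. f i + g i"
  by (rule ell2_add_closed)
lift_definition uminus_ell2 :: "'a ell2 \<Rightarrow> 'a ell2" is "\<lambda>f i. - f i" by simp
lift_definition scaleC_ell2 :: "complex \<Rightarrow> 'a ell2 \<Rightarrow> 'a ell2" is "\<lambda>c f i. c * f i"
  by (rule ell2_scale_closed)
lift_definition norm_ell2 :: "'a ell2 \<Rightarrow> real" is "\<lambda>f. sqrt (\<Sum>\<^sub>\<infinity>i. (cmod (f i))\<^sup>2)" .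

definition minus_ell2 :: "'a ell2 \<Rightarrow> 'a ell2 \<Rightarrow> 'a ell2" where "minus_ell2 x y = x + - y"
definition scaleR_ell2 :: "real \<Rightarrow> 'a ell2 \<Rightarrow> 'a ell2" where "scaleR_ell2 r x = complex_of_real r *\<^sub>C x"
definition dist_ell2 :: "'a ell2 \<Rightarrow> 'a ell2 \<Rightarrow> real" where "dist_ell2 x y = norm (x - y)"
definition sgn_ell2 :: "'a ell2 \<Rightarrow> 'a ell2" where "sgn_ell2 x = inverse (norm x) *\<^sub>R x"
definition uniformity_ell2 :: "('a ell2 \<times> 'a ell2) filter"
  where "uniformity_ell2 = (INF e\<in>{0<..}. principal {(x, y). dist x y < e})"
definition open_ell2 :: "'a ell2 set \<Rightarrow> bool"
  where "open_ell2 U \<longleftrightarrow> (\<forall>x\<in>U. \<forall>\<^sub>F (x', y) in uniformity. x' = x \<longrightarrow> y \<in> U)"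

lemma ell2_norm_le: "(\<And>F. finite F \<Longrightarrow> L2_set (\<lambda>i. cmod (ell2_nth x i)) F \<le> b) \<Longrightarrow> norm x \<le> b"
  for x :: "'a ell2"
  unfolding norm_ell2.rep_eq by (rule ell2_boundI)

lemma ell2_L2_set_le_norm: "finite F \<Longrightarrow> L2_set (\<lambda>i. cmod (ell2_nth x i)) F \<le> norm x"
  for x :: "'a ell2"
  unfolding norm_ell2.rep_eq using ell2_nth[of x] by (intro ell2_boundD) auto

lemma ell2_nth_le_norm: "cmod (ell2_nth x i) \<le> norm x" for x :: "'a ell2"
  using ell2_L2_set_le_norm[of "{i}" x] by simp

instance
proof
  fix x y z :: "'a ell2" and r s :: real and c d :: complex
  show "x + y + z = x + (y + z)" by transfer (simp add: add.assoc)
  show "x + y = y + x" by transfer (simp add: add.commute)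
  show "0 + x = x" by transfer simp
  show "- x + x = 0" by transfer simp
  show "x - y = x + - y" by (simp add: minus_ell2_def)
  show c1: "c *\<^sub>C (x + y) = c *\<^sub>C x + c *\<^sub>C y" for c and x y :: "'a ell2"
    by transfer (simp add: distrib_left)
  show c2: "(c + d) *\<^sub>C x = c *\<^sub>C x + d *\<^sub>C x" for c d and x :: "'a ell2"
    by transfer (simp add: distrib_right)
  show c3: "c *\<^sub>C d *\<^sub>C x = (c * d) *\<^sub>C x" for c d and x :: "'a ell2"
    by transfer (simp add: mult.assoc)
  show "r *\<^sub>R (x + y) = r *\<^sub>R x + r *\<^sub>R y" by (simp add: scaleR_ell2_def c1)
  show "(r + s) *\<^sub>R x = r *\<^sub>R x + s *\<^sub>R x" by (simp add: scaleR_ell2_def c2)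
  show "r *\<^sub>R s *\<^sub>R x = (r * s) *\<^sub>R x" by (simp add: scaleR_ell2_def c3)
  have one: "1 *\<^sub>C x = x" for x :: "'a ell2" by transfer simp
  show "1 *\<^sub>R x = x" by (simp add: scaleR_ell2_def one)
  show "complex_of_real r *\<^sub>C x = r *\<^sub>R x" by (simp add: scaleR_ell2_def)
  show "dist x y = norm (x - y)" by (rule dist_ell2_def)
  show "sgn x = inverse (norm x) *\<^sub>R x" by (rule sgn_ell2_def)
  show "uniformity = (INF e\<in>{0<..}. principal {(x::'a ell2, y). dist x y < e})"
    by (rule uniformity_ell2_def)
  show "open U \<longleftrightarrow> (\<forall>x\<in>U. \<forall>\<^sub>F (x', y) in uniformity. x' = x \<longrightarrow> y \<in> U)" for U :: "'a ell2 set"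
    by (rule open_ell2_def)
  show "norm x = 0 \<longleftrightarrow> x = 0"
  proof
    assume "norm x = 0"
    then have "ell2_nth x i = 0" for i using ell2_nth_le_norm[of x i] by simp
    then show "x = 0" by transfer auto
  next
    show "x = 0 \<Longrightarrow> norm x = 0" by transfer simp
  qed
  show "norm (x + y) \<le> norm x + norm y" by transfer (rule ell2_add_closed)
  show nC: "norm (c *\<^sub>C x) = cmod c * norm x" for c and x :: "'a ell2"
    by transfer (simp add: norm_mult power_mult_distrib infsum_cmult_right' real_sqrt_mult)
  show "norm (r *\<^sub>R x) = \<bar>r\<bar> * norm x" by (simp add: scaleR_ell2_def nC)
qed

end

lemma ell2_complete:
  fixes X :: "nat \<Rightarrow> 'a ell2"
  assumes C: "\<And>e. e > 0 \<Longrightarrow> \<exists>N. \<forall>m\<ge>N. \<forall>n\<ge>N. norm (X m - X n) < e"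
  shows "\<exists>L. \<forall>e>0. \<exists>N. \<forall>n\<ge>N. norm (X n - L) \<le> e"
proof -
  have nth_diff: "ell2_nth (x - y) i = ell2_nth x i - ell2_nth y i" for x y :: "'a ell2" and i
    unfolding minus_ell2_def plus_ell2.rep_eq uminus_ell2.rep_eq by simp
  have "convergent (\<lambda>n. ell2_nth (X n) i)" for i
  proof -
    have "Cauchy (\<lambda>n. ell2_nth (X n) i)"
    proof (rule CauchyI)
      fix e :: real assume "0 < e"
      from C[OF this] obtain N where N: "\<forall>m\<ge>N. \<forall>n\<ge>N. norm (X m - X n) < e" by blast
      have "norm (ell2_nth (X m) i - ell2_nth (X n) i) < e" if "m \<ge> N" "n \<ge> N" for m n
        unfolding nth_diff[symmetric]
        by (rule order_le_less_trans[OF ell2_nth_le_norm]) (use N that in blast)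
      then show "\<exists>M. \<forall>m\<ge>M. \<forall>n\<ge>M. norm (ell2_nth (X m) i - ell2_nth (X n) i) < e" by blast
    qed
    then show ?thesis by (rule Cauchy_convergent)
  qed
  then obtain l where l: "\<And>i. (\<lambda>n. ell2_nth (X n) i) \<longlonglongrightarrow> l i"
    unfolding convergent_def by metis
  have bound: "L2_set (\<lambda>i. cmod (ell2_nth (X n) i - l i)) F \<le> e"
    if N: "\<forall>m\<ge>N. \<forall>n\<ge>N. norm (X m - X n) < e" and n: "n \<ge> N" and F: "finite F" for n N e F
  proof (rule LIMSEQ_le_const2)
    show "(\<lambda>m. L2_set (\<lambda>i. cmod (ell2_nth (X n) i - ell2_nth (X m) i)) F)
        \<longlonglongrightarrow> L2_set (\<lambda>i. cmod (ell2_nth (X n) i - l i)) F"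
      unfolding L2_set_def by (intro tendsto_intros l)
    have "L2_set (\<lambda>i. cmod (ell2_nth (X n) i - ell2_nth (X m) i)) F \<le> e" if "m \<ge> N" for m
    proof -
      have "norm (X n - X m) < e" using N n that by blast
      then show ?thesis
        using ell2_L2_set_le_norm[OF F, of "X n - X m"] by (simp add: nth_diff)
    qed
    then show "\<exists>N. \<forall>m\<ge>N. L2_set (\<lambda>i. cmod (ell2_nth (X n) i - ell2_nth (X m) i)) F \<le> e" by blast
  qed
  obtain N1 where N1: "\<forall>m\<ge>N1. \<forall>n\<ge>N1. norm (X m - X n) < 1" using C[of 1] by auto
  have "(\<lambda>i. (cmod (ell2_nth (X N1) i - l i))\<^sup>2) summable_on UNIV"
    by (rule ell2_boundI(1)[of _ 1]) (rule bound[OF N1 order_refl])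
  then obtain D where D: "ell2_nth D = (\<lambda>i. ell2_nth (X N1) i - l i)"
    by (intro that[OF Abs_ell2_inverse]) simp
  have L: "ell2_nth (X N1 - D) i = l i" for i by (simp add: nth_diff D)
  show ?thesis
  proof (intro exI[of _ "X N1 - D"] allI impI)
    fix e :: real assume "e > 0"
    from C[OF this] obtain N where N: "\<forall>m\<ge>N. \<forall>n\<ge>N. norm (X m - X n) < e" by blast
    have "norm (X n - (X N1 - D)) \<le> e" if "n \<ge> N" for n
      by (rule ell2_norm_le) (simp only: nth_diff[of "X n"] L bound[OF N that])
    then show "\<exists>N. \<forall>n\<ge>N. norm (X n - (X N1 - D)) \<le> e" by blast
  qed
qed

instantiation ell2 :: (type) chilbert_space
begin

lift_definition cinner_ell2 :: "'a ell2 \<Rightarrow> 'a ell2 \<Rightarrow> complex" is "\<lambda>f g. \<Sum>\<^sub>\<infinity>i. cnj (f i) * g i" .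

instance
proof
  fix x y z :: "'a ell2" and c :: complex
  show "cinner x y = cnj (cinner y x)"
    by transfer (subst infsum_cnj[symmetric], simp only: complex_cnj_mult complex_cnj_cnj mult.commute)
  show "cinner x (y + z) = cinner x y + cinner x z"
    by transfer (simp add: distrib_left infsum_add ell2_cinner_summable)
  show "cinner x (c *\<^sub>C y) = c * cinner x y"
    by transfer (subst infsum_cmult_right'[symmetric], simp only: mult.left_commute)
  show "cinner x x = complex_of_real ((norm x)\<^sup>2)"
  proof transfer
    fix f :: "'a \<Rightarrow> complex"
    assume f: "(\<lambda>i. (cmod (f i))\<^sup>2) summable_on UNIV"
    have "(\<Sum>\<^sub>\<infinity>i. cnj (f i) * f i) = (\<Sum>\<^sub>\<infinity>i. complex_of_real ((cmod (f i))\<^sup>2))"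
      by (intro infsum_cong) (simp only: complex_norm_square mult.commute)
    also have "\<dots> = complex_of_real (\<Sum>\<^sub>\<infinity>i. (cmod (f i))\<^sup>2)"
      by (rule infsumI[OF has_sum_bounded_linear[OF bounded_linear_of_real has_sum_infsum[OF f]]])
    also have "(\<Sum>\<^sub>\<infinity>i. (cmod (f i))\<^sup>2) = (sqrt (\<Sum>\<^sub>\<infinity>i. (cmod (f i))\<^sup>2))\<^sup>2"
      by (simp add: infsum_nonneg)
    finally show "(\<Sum>\<^sub>\<infinity>i. cnj (f i) * f i) = complex_of_real ((sqrt (\<Sum>\<^sub>\<infinity>i. (cmod (f i))\<^sup>2))\<^sup>2)" .
  qed
  have "(\<lambda>i. (cmod (of_bool (i = undefined)))\<^sup>2) summable_on (UNIV :: 'a set)"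
    by (rule summable_on_cong_neutral[THEN iffD1, OF _ _ _ summable_on_finite[of "{undefined}"]]) auto
  then obtain e :: "'a ell2" where "ell2_nth e = (\<lambda>i. of_bool (i = undefined))"
    by (intro that[OF Abs_ell2_inverse]) simp
  then have "ell2_nth e undefined \<noteq> ell2_nth 0 undefined"
    by (simp add: zero_ell2.rep_eq)
  then show "\<exists>x::'a ell2. x \<noteq> 0" by metis
next
  fix X :: "nat \<Rightarrow> 'a ell2"
  assume X: "Cauchy X"
  have "\<exists>L. \<forall>e>0. \<exists>N. \<forall>n\<ge>N. norm (X n - L) \<le> e"
    by (rule ell2_complete) (rule CauchyD[OF X])
  then obtain L where L: "\<And>e. e > 0 \<Longrightarrow> \<exists>N. \<forall>n\<ge>N. norm (X n - L) \<le> e" by blast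
  have "\<exists>N. \<forall>n\<ge>N. dist (X n) L < e" if "e > 0" for e
    proof -
    obtain N where "\<forall>n\<ge>N. norm (X n - L) \<le> e / 2" using L[of "e / 2"] \<open>e > 0\<close> by auto
    then have "dist (X n) L < e" if "n \<ge> N" for n
      using that \<open>e > 0\<close> unfolding dist_norm by (auto intro: order_le_less_trans[of _ "e / 2"])
    then show ?thesis by blast
  qed
  then show "convergent X"
    unfolding convergent_def lim_sequentially by blast
qed

end


section \<open>The C*-algebra of bounded operators on a Hilbert space\<close>

typedef (overloaded) 'h bop =
    "{T :: 'h::chilbert_space \<Rightarrow>\<^sub>L 'h. \<forall>c x. blinfun_apply T (c *\<^sub>C x) = c *\<^sub>C blinfun_apply T x}"
  morphisms blinfun_of_bop Abs_bop
  by (rule exI[of _ 0]) simp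

setup_lifting type_definition_bop

lift_definition bop_apply :: "'h::chilbert_space bop \<Rightarrow> 'h \<Rightarrow> 'h" is blinfun_apply .

lemma bop_eqI: "(\<And>x. bop_apply S x = bop_apply T x) \<Longrightarrow> S = T"
  by transfer (rule blinfun_eqI)

lemma bounded_linear_bop_apply: "bounded_linear (bop_apply T)"
  by transfer (rule blinfun.bounded_linear_right)

lemmas bop_apply_add = linear_add[OF bounded_linear.linear[OF bounded_linear_bop_apply]]
lemmas bop_apply_diff = linear_diff[OF bounded_linear.linear[OF bounded_linear_bop_apply]]
lemmas bop_apply_0 [simp] = linear_0[OF bounded_linear.linear[OF bounded_linear_bop_apply]]

lemma bop_apply_scaleC: "bop_apply T (c *\<^sub>C x) = c *\<^sub>C bop_apply T x"
  by transfer simp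

lemma bop_exists:
  assumes "bounded_linear f" "\<And>c x. f (c *\<^sub>C x) = c *\<^sub>C f x"
  shows "\<exists>T. \<forall>x. bop_apply T x = f x"
proof -
  have "blinfun_apply (Blinfun f) = f" using assms(1) by (rule bounded_linear_Blinfun_apply)
  then have "bop_apply (Abs_bop (Blinfun f)) = f"
    unfolding bop_apply.rep_eq using assms(2) by (subst Abs_bop_inverse) auto
  then show ?thesis by (intro exI[of _ "Abs_bop (Blinfun f)"]) simp
qed

lemma bounded_linear_scaleC: "bounded_linear (\<lambda>x::'a::complex_normed_vector. c *\<^sub>C x)"
proof (rule bounded_linear_intro[where K = "cmod c"])
  fix r and x :: 'a
  show "c *\<^sub>C r *\<^sub>R x = r *\<^sub>R c *\<^sub>C x"
    unfolding scaleC_of_real[symmetric] scaleC_scaleC by (simp add: mult.commute)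
qed (simp_all add: scaleC_add_right norm_scaleC mult.commute)

instantiation bop :: (chilbert_space) complex_normed_vector
begin

lift_definition zero_bop :: "'a bop" is 0 by simp
lift_definition plus_bop :: "'a bop \<Rightarrow> 'a bop \<Rightarrow> 'a bop" is "(+)"
  by (simp add: blinfun.add_left scaleC_add_right)
lift_definition uminus_bop :: "'a bop \<Rightarrow> 'a bop" is uminus
  by (simp add: blinfun.minus_left complex_vector.scale_minus_right)
lift_definition minus_bop :: "'a bop \<Rightarrow> 'a bop \<Rightarrow> 'a bop" is "(-)"
  by (simp add: blinfun.diff_left complex_vector.scale_right_diff_distrib)
lift_definition scaleC_bop :: "complex \<Rightarrow> 'a bop \<Rightarrow> 'a bop"
  is "\<lambda>c T. Blinfun (\<lambda>x. c *\<^sub>C blinfun_apply T x)"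
  by (subst (1 2) bounded_linear_Blinfun_apply)
    (auto intro!: bounded_linear_compose[OF bounded_linear_scaleC] blinfun.bounded_linear_right
      simp: mult.commute complex_vector.scale_scale)
lift_definition scaleR_bop :: "real \<Rightarrow> 'a bop \<Rightarrow> 'a bop" is "(*\<^sub>R)"
  by (simp add: blinfun.scaleR_left complex_vector.scale_scale mult.commute flip: scaleC_of_real)
lift_definition norm_bop :: "'a bop \<Rightarrow> real" is norm .
lift_definition dist_bop :: "'a bop \<Rightarrow> 'a bop \<Rightarrow> real" is dist .
lift_definition sgn_bop :: "'a bop \<Rightarrow> 'a bop" is sgn
  by (simp add: sgn_div_norm blinfun.scaleR_left complex_vector.scale_scale mult.commute flip: scaleC_of_real)

definition uniformity_bop :: "('a bop \<times> 'a bop) filter"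
  where "uniformity_bop = (INF e\<in>{0<..}. principal {(x, y). dist x y < e})"
definition open_bop :: "'a bop set \<Rightarrow> bool"
  where "open_bop U \<longleftrightarrow> (\<forall>x\<in>U. \<forall>\<^sub>F (x', y) in uniformity. x' = x \<longrightarrow> y \<in> U)"

lemma blinfun_scaleC_apply:
  "blinfun_apply (Blinfun (\<lambda>x. c *\<^sub>C blinfun_apply T x)) x = c *\<^sub>C blinfun_apply (T :: 'a \<Rightarrow>\<^sub>L 'a) x"
  by (subst bounded_linear_Blinfun_apply)
    (auto intro!: bounded_linear_compose[OF bounded_linear_scaleC] blinfun.bounded_linear_right)

instance
proof
  fix x y z :: "'a bop" and r s :: real and c d :: complex
  show "x + y + z = x + (y + z)" by transfer (simp add: add.assoc)
  show "x + y = y + x" by transfer (simp add: add.commute)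
  show "0 + x = x" by transfer simp
  show "- x + x = 0" by transfer simp
  show "x - y = x + - y" by transfer simp
  show "c *\<^sub>C (x + y) = c *\<^sub>C x + c *\<^sub>C y"
    by transfer (rule blinfun_eqI, subst blinfun_scaleC_apply,
      simp add: blinfun_scaleC_apply blinfun.add_left scaleC_add_right)
  show "(c + d) *\<^sub>C x = c *\<^sub>C x + d *\<^sub>C x"
    by transfer (rule blinfun_eqI, subst blinfun_scaleC_apply,
      simp add: blinfun_scaleC_apply blinfun.add_left scaleC_add_left)
  show "c *\<^sub>C d *\<^sub>C x = (c * d) *\<^sub>C x"
    by transfer (rule blinfun_eqI, simp add: blinfun_scaleC_apply)
  show "r *\<^sub>R (x + y) = r *\<^sub>R x + r *\<^sub>R y" by transfer (simp add: scaleR_add_right)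
  show "(r + s) *\<^sub>R x = r *\<^sub>R x + s *\<^sub>R x" by transfer (simp add: scaleR_add_left)
  show "r *\<^sub>R s *\<^sub>R x = (r * s) *\<^sub>R x" by transfer simp
  show "1 *\<^sub>R x = x" by transfer simp
  show "complex_of_real r *\<^sub>C x = r *\<^sub>R x"
    by transfer (rule blinfun_eqI, subst blinfun_scaleC_apply,
      simp add: scaleC_of_real blinfun.scaleR_left)
  show "dist x y = norm (x - y)" by transfer (rule dist_norm)
  show "sgn x = inverse (norm x) *\<^sub>R x" by transfer (rule sgn_div_norm)
  show "uniformity = (INF e\<in>{0<..}. principal {(x::'a bop, y). dist x y < e})"
    by (rule uniformity_bop_def)
  show "open U \<longleftrightarrow> (\<forall>x\<in>U. \<forall>\<^sub>F (x', y) in uniformity. x' = x \<longrightarrow> y \<in> U)" for U :: "'a bop set"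
    by (rule open_bop_def)
  show "norm x = 0 \<longleftrightarrow> x = 0" by transfer simp
  show "norm (x + y) \<le> norm x + norm y" by transfer (rule norm_triangle_ineq)
  show "norm (r *\<^sub>R x) = \<bar>r\<bar> * norm x" by transfer simp
  show "norm (c *\<^sub>C x) = cmod c * norm x"
  proof transfer
    fix c and T :: "'a \<Rightarrow>\<^sub>L 'a"
    define S where "S = Blinfun (\<lambda>x. c *\<^sub>C blinfun_apply T x)"
    have S: "norm (blinfun_apply S x) = cmod c * norm (blinfun_apply T x)" for x
      by (simp add: S_def blinfun_scaleC_apply norm_scaleC)
    have "norm S \<le> cmod c * norm T"
    proof (rule norm_blinfun_bound)
      fix x
      show "norm (blinfun_apply S x) \<le> cmod c * norm T * norm x"
        unfolding S mult.assoc by (intro mult_left_mono norm_blinfun) simp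
    qed simp
    moreover have "cmod c * norm T \<le> norm S"
    proof (cases "c = 0")
      case False
      have "norm T \<le> norm S / cmod c"
      proof (rule norm_blinfun_bound)
        fix x
        have "cmod c * norm (blinfun_apply T x) \<le> norm S * norm x"
          unfolding S[symmetric] by (rule norm_blinfun)
        then show "norm (blinfun_apply T x) \<le> norm S / cmod c * norm x"
          using False by (simp add: field_simps)
      qed simp
      then show ?thesis using False by (simp add: field_simps)
    qed simp
    ultimately show "norm (Blinfun (\<lambda>x. c *\<^sub>C blinfun_apply T x)) = cmod c * norm T"
      unfolding S_def by linarith
  qed
qed

end

lemma bop_apply_add_left: "bop_apply (S + T) x = bop_apply S x + bop_apply T x"
  by transfer (rule blinfun.add_left)

lemma bop_apply_diff_left: "bop_apply (S - T) x = bop_apply S x - bop_apply T x"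
  by transfer (rule blinfun.diff_left)

lemma bop_apply_scaleC_left: "bop_apply (c *\<^sub>C T) x = c *\<^sub>C bop_apply T x"
  by transfer (rule blinfun_scaleC_apply)

lemma norm_bop_apply: "norm (bop_apply T x) \<le> norm T * norm x"
  by transfer (rule norm_blinfun)

lemma norm_bop_bound: "0 \<le> b \<Longrightarrow> (\<And>x. norm (bop_apply T x) \<le> b * norm x) \<Longrightarrow> norm T \<le> b"
  by transfer (rule norm_blinfun_bound)

lemma bop_adjoint_exists:
  fixes T :: "'h::chilbert_space bop"
  shows "\<exists>S. \<forall>x y. cinner (bop_apply S x) y = cinner x (bop_apply T y)"
proof -
  have "\<exists>z. \<forall>y. cinner x (bop_apply T y) = cinner z y" for x
  proof (rule Riesz_representation)
    have "bounded_linear (cinner x)"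
    proof (rule bounded_linear_intro[where K = "norm x"])
      show "norm (cinner x y) \<le> norm y * norm x" for y
        using Cauchy_Schwarz[of x y] by (simp add: mult.commute)
      show "cinner x (r *\<^sub>R y) = r *\<^sub>R cinner x y" for r y
        by (simp add: cinner_scaleC_right scaleR_conv_of_real flip: scaleC_of_real)
    qed (rule cinner_add_right)
    then show "bounded_linear (\<lambda>y. cinner x (bop_apply T y))"
      by (rule bounded_linear_compose[OF _ bounded_linear_bop_apply])
  qed (simp add: bop_apply_scaleC cinner_scaleC_right)
  then obtain f where f: "\<And>x y. cinner x (bop_apply T y) = cinner (f x) y"
    by metis
  have eqI: "u = v" if "\<And>z. cinner u z = cinner v z" for u v :: 'h
    by (rule cinner_eqI) (metis that cinner_commute)
  have add: "f (x + y) = f x + f y" for x y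
    by (rule eqI) (simp add: cinner_add_left flip: f)
  have scale: "f (c *\<^sub>C x) = c *\<^sub>C f x" for c x
    by (rule eqI) (simp add: cinner_scaleC_left flip: f)
  have bound: "norm (f x) \<le> norm x * norm T" for x
  proof (cases "f x = 0")
    case False
    have "complex_of_real ((norm (f x))\<^sup>2) = cinner x (bop_apply T (f x))"
      by (simp only: f cinner_self)
    then have "(norm (f x))\<^sup>2 = cmod (cinner x (bop_apply T (f x)))"
      by (metis abs_of_nonneg norm_of_real zero_le_power2)
    also have "\<dots> \<le> norm x * (norm T * norm (f x))"
      by (rule order_trans[OF Cauchy_Schwarz mult_left_mono[OF norm_bop_apply]]) simp
    finally show ?thesis using False by (simp add: power2_eq_square mult.assoc[symmetric])
  qed simp
  have "bounded_linear f"
    by (rule bounded_linear_intro[OF add _ bound]) (simp only: scale flip: scaleC_of_real)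
  then obtain S where "\<forall>x. bop_apply S x = f x"
    using bop_exists[OF _ scale] by blast
  then show ?thesis using f by (intro exI[of _ S]) simp
qed

instantiation bop :: (chilbert_space) cstar_algebra
begin

lift_definition one_bop :: "'a bop" is id_blinfun by simp
lift_definition times_bop :: "'a bop \<Rightarrow> 'a bop \<Rightarrow> 'a bop" is "(o\<^sub>L)" by simp

definition star_bop :: "'a bop \<Rightarrow> 'a bop"
  where "star_bop T = (THE S. \<forall>x y. cinner (bop_apply S x) y = cinner x (bop_apply T y))"

lemma cinner_star_bop: "cinner (bop_apply (star T) x) y = cinner x (bop_apply T y)"
  for T :: "'a bop"
proof -
  have "\<exists>!S. \<forall>x y. cinner (bop_apply S x) y = cinner x (bop_apply T y)"
  proof (rule ex_ex1I[OF bop_adjoint_exists])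
    fix S S' assume *: "\<forall>x y. cinner (bop_apply S x) y = cinner x (bop_apply T y)"
      "\<forall>x y. cinner (bop_apply S' x) y = cinner x (bop_apply T y)"
    show "S = S'"
      by (rule bop_eqI, rule cinner_eqI) (metis * cinner_commute)
  qed
  from theI'[OF this] have "\<forall>x y. cinner (bop_apply (star T) x) y = cinner x (bop_apply T y)"
    unfolding star_bop_def .
  then show ?thesis by blast
qed

lemma cinner_star_bop': "cinner x (bop_apply (star T) y) = cinner (bop_apply T x) y"
  for T :: "'a bop"
  by (metis cinner_star_bop cinner_commute)

lemma bop_star_eqI: "(\<And>x y. cinner (bop_apply S x) y = cinner x (bop_apply T y)) \<Longrightarrow> star T = S"
  for S T :: "'a bop"
  by (rule bop_eqI, rule cinner_eqI) (metis cinner_star_bop cinner_commute)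

lemma bop_apply_mult: "bop_apply (S * T) x = bop_apply S (bop_apply T x)" for S T :: "'a bop"
  by transfer simp

lemma bop_apply_one: "bop_apply 1 x = (x::'a)"
  by transfer simp

instance
proof
  fix x y z :: "'a bop" and r :: real and c :: complex
  show "x * y * z = x * (y * z)" by (rule bop_eqI) (simp add: bop_apply_mult)
  show "(x + y) * z = x * z + y * z"
    by (rule bop_eqI) (simp add: bop_apply_mult bop_apply_add_left)
  show "x * (y + z) = x * y + x * z"
    by (rule bop_eqI) (simp add: bop_apply_mult bop_apply_add_left bop_apply_add)
  show cl: "(c *\<^sub>C x) * y = c *\<^sub>C (x * y)" for c and x y :: "'a bop"
    by (rule bop_eqI) (simp add: bop_apply_mult bop_apply_scaleC_left)
  show cr: "x * (c *\<^sub>C y) = c *\<^sub>C (x * y)" for c and x y :: "'a bop"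
    by (rule bop_eqI) (simp add: bop_apply_mult bop_apply_scaleC_left bop_apply_scaleC)
  show "(r *\<^sub>R x) * y = r *\<^sub>R (x * y)" "x * (r *\<^sub>R y) = r *\<^sub>R (x * y)"
    by (simp_all only: cl cr flip: scaleC_of_real)
  show "1 * x = x" "x * 1 = x" by (rule bop_eqI, simp add: bop_apply_mult bop_apply_one)+
  obtain h :: 'a where h: "h \<noteq> 0" using chilbert_nontrivial by blast
  have "bop_apply 1 h \<noteq> bop_apply 0 h" using h by (simp add: bop_apply_one, transfer, simp)
  then show "0 \<noteq> (1::'a bop)" by metis
  show sub: "norm (x * y) \<le> norm x * norm y" for x y :: "'a bop"
    by transfer (rule norm_blinfun_compose)
  have "norm h \<le> norm (1::'a bop) * norm h"
    using norm_bop_apply[of 1 h] by (simp add: bop_apply_one)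
  then have "1 \<le> norm (1::'a bop)" using h by simp
  moreover have "norm (1::'a bop) \<le> 1" by (rule norm_bop_bound) (simp_all add: bop_apply_one)
  ultimately show "norm (1::'a bop) = 1" by linarith
  show ss: "star (star x) = x" for x :: "'a bop"
    by (rule bop_star_eqI) (simp add: cinner_star_bop')
  show "star (x + y) = star x + star y"
    by (rule bop_star_eqI) (simp add: bop_apply_add_left cinner_add_left cinner_add_right cinner_star_bop)
  show "star (c *\<^sub>C x) = cnj c *\<^sub>C star x"
    by (rule bop_star_eqI) (simp add: bop_apply_scaleC_left cinner_scaleC_left cinner_scaleC_right cinner_star_bop)
  show "star (x * y) = star y * star x"
    by (rule bop_star_eqI) (simp add: bop_apply_mult cinner_star_bop)
  have le: "(norm x)\<^sup>2 \<le> norm (star x * x)" for x :: "'a bop"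
  proof -
    have "norm x \<le> sqrt (norm (star x * x))"
    proof (rule norm_bop_bound)
      fix u
      have "complex_of_real ((norm (bop_apply x u))\<^sup>2) = cinner (bop_apply (star x * x) u) u"
        by (simp only: bop_apply_mult cinner_star_bop cinner_self)
      then have "(norm (bop_apply x u))\<^sup>2 = cmod (cinner (bop_apply (star x * x) u) u)"
        by (metis abs_of_nonneg norm_of_real zero_le_power2)
      also have "\<dots> \<le> norm (bop_apply (star x * x) u) * norm u" by (rule Cauchy_Schwarz)
      also have "\<dots> \<le> (norm (star x * x) * norm u) * norm u"
        by (intro mult_right_mono norm_bop_apply) simp
      also have "\<dots> = (sqrt (norm (star x * x)) * norm u)\<^sup>2"
        by (simp add: power_mult_distrib power2_eq_square[of "norm u"])
      finally show "norm (bop_apply x u) \<le> sqrt (norm (star x * x)) * norm u"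
        by (rule power2_le_imp_le) simp
    qed simp
    then have "(norm x)\<^sup>2 \<le> (sqrt (norm (star x * x)))\<^sup>2" by (intro power_mono) auto
    then show ?thesis by simp
  qed
  have star_le: "norm x \<le> norm (star x)" for x :: "'a bop"
  proof (cases "x = 0")
    case False
    have "norm x * norm x \<le> norm (star x) * norm x"
      using le[of x] sub[of "star x" x] by (simp add: power2_eq_square)
    then show ?thesis using False by simp
  qed simp
  have "norm (star x) = norm x" using star_le[of x] star_le[of "star x"] by (simp add: ss)
  then show "norm (star x * x) = (norm x)\<^sup>2"
    using le[of x] sub[of "star x" x] by (simp add: power2_eq_square)
next
  fix X :: "nat \<Rightarrow> 'a bop"
  assume X: "Cauchy X"
  have "Cauchy (\<lambda>n. blinfun_of_bop (X n))"
    using X unfolding Cauchy_def dist_bop.rep_eq .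
  then have "convergent (\<lambda>n. blinfun_of_bop (X n))" by (rule Cauchy_convergent)
  then obtain L where L: "(\<lambda>n. blinfun_of_bop (X n)) \<longlonglongrightarrow> L"
    unfolding convergent_def by blast
  have lim: "(\<lambda>n. blinfun_apply (blinfun_of_bop (X n)) x) \<longlonglongrightarrow> blinfun_apply L x" for x
    by (intro tendsto_intros L)
  have "blinfun_apply L (c *\<^sub>C x) = c *\<^sub>C blinfun_apply L x" for c x
  proof (rule LIMSEQ_unique[OF lim])
    have "(\<lambda>n. c *\<^sub>C blinfun_apply (blinfun_of_bop (X n)) x) \<longlonglongrightarrow> c *\<^sub>C blinfun_apply L x"
      by (rule bounded_linear.tendsto[OF bounded_linear_scaleC lim])
    then show "(\<lambda>n. blinfun_apply (blinfun_of_bop (X n)) (c *\<^sub>C x)) \<longlonglongrightarrow> c *\<^sub>C blinfun_apply L x"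
      by (simp add: bop_apply_scaleC flip: bop_apply.rep_eq)
  qed
  then have "blinfun_of_bop (Abs_bop L) = L" by (simp add: Abs_bop_inverse)
  then have "X \<longlonglongrightarrow> Abs_bop L"
    using L unfolding lim_sequentially dist_bop.rep_eq by simp
  then show "convergent X" unfolding convergent_def by blast
qed

end


section \<open>Tensor products of operators\<close>

text \<open>
  The Hilbert space tensor product of \<open>'i ell2\<close> and \<open>'j ell2\<close> is realised as \<open>('i \<times> 'j) ell2\<close>.
\<close>

lift_definition ell2_tensor :: "'i ell2 \<Rightarrow> 'j ell2 \<Rightarrow> ('i \<times> 'j) ell2"
  is "\<lambda>f g (i, j). f i * g j"
proof -
  fix f :: "'i \<Rightarrow> complex" and g :: "'j \<Rightarrow> complex"
  assume f: "(\<lambda>i. (cmod (f i))\<^sup>2) summable_on UNIV" and g: "(\<lambda>j. (cmod (g j))\<^sup>2) summable_on UNIV"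
  have "L2_set (\<lambda>p. cmod (case p of (i, j) \<Rightarrow> f i * g j)) F \<le>
      sqrt (\<Sum>\<^sub>\<infinity>i. (cmod (f i))\<^sup>2) * sqrt (\<Sum>\<^sub>\<infinity>j. (cmod (g j))\<^sup>2)" if "finite F" for F
  proof -
    let ?I = "fst ` F" and ?J = "snd ` F"
    have fin: "finite ?I" "finite ?J" using that by auto
    have "(\<Sum>p\<in>F. (cmod (case p of (i, j) \<Rightarrow> f i * g j))\<^sup>2) \<le>
        (\<Sum>p\<in>?I \<times> ?J. (cmod (case p of (i, j) \<Rightarrow> f i * g j))\<^sup>2)"
      by (rule sum_mono2) (use fin in \<open>force+\<close>)
    also have "\<dots> = (\<Sum>i\<in>?I. (cmod (f i))\<^sup>2) * (\<Sum>j\<in>?J. (cmod (g j))\<^sup>2)"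
      by (simp add: sum_product sum.cartesian_product norm_mult power_mult_distrib case_prod_beta)
    also have "\<dots> \<le> (\<Sum>\<^sub>\<infinity>i. (cmod (f i))\<^sup>2) * (\<Sum>\<^sub>\<infinity>j. (cmod (g j))\<^sup>2)"
      using fin by (intro mult_mono finite_sum_le_infsum f g) (auto intro: sum_nonneg infsum_nonneg)
    finally show ?thesis
      unfolding L2_set_def by (simp flip: real_sqrt_mult)
  qed
  then show "(\<lambda>p. (cmod (case p of (i, j) \<Rightarrow> f i * g j))\<^sup>2) summable_on UNIV"
    by (rule ell2_boundI(1))
qed

definition bop_tensor :: "'i ell2 bop \<Rightarrow> 'j ell2 bop \<Rightarrow> ('i \<times> 'j) ell2 bop"
  where "bop_tensor S T = (THE R. \<forall>x y.
    bop_apply R (ell2_tensor x y) = ell2_tensor (bop_apply S x) (bop_apply T y))"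

lemma ell2_eqI: "(\<And>i. ell2_nth x i = ell2_nth y i) \<Longrightarrow> x = y"
  by transfer auto

lemma ell2_nth_scaleC: "ell2_nth (c *\<^sub>C x) i = c * ell2_nth x i"
  by transfer simp

lemma ell2_nth_tensor: "ell2_nth (ell2_tensor x y) (i, j) = ell2_nth x i * ell2_nth y j"
  by transfer simp

lift_definition ell2_basis :: "'i \<Rightarrow> 'i ell2" is "\<lambda>k i. of_bool (i = k)"
  by (rule summable_on_cong_neutral[THEN iffD1, OF _ _ _ summable_on_finite[of "{k}" for k]]) auto

lemma ell2_basis_tensor: "ell2_tensor (ell2_basis i) (ell2_basis j) = ell2_basis (i, j)"
  by transfer (auto simp: fun_eq_iff)

lemma cinner_ell2_basis: "cinner x (ell2_basis k) = cnj (ell2_nth x k)"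
proof transfer
  fix f :: "'a \<Rightarrow> complex" and k
  have "(\<Sum>\<^sub>\<infinity>i. cnj (f i) * of_bool (i = k)) = (\<Sum>\<^sub>\<infinity>i\<in>{k}. cnj (f i))"
    by (rule infsum_cong_neutral) auto
  then show "(\<Sum>\<^sub>\<infinity>i. cnj (f i) * of_bool (i = k)) = cnj (f k)" by simp
qed

lemma bop_eq_basisI:
  assumes "\<And>k. bop_apply S (ell2_basis k) = bop_apply T (ell2_basis k)"
  shows "S = T"
proof -
  have "ell2_nth (bop_apply (star S) x) k = ell2_nth (bop_apply (star T) x) k" for x k
  proof -
    have "cinner (bop_apply (star S) x) (ell2_basis k) = cinner (bop_apply (star T) x) (ell2_basis k)"
      by (simp add: cinner_star_bop assms)
    then show ?thesis by (simp add: cinner_ell2_basis)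
  qed
  then have "star S = star T" by (intro bop_eqI ell2_eqI)
  then show ?thesis by (metis star_star)
qed

lemma infsum_finite_sum:
  fixes g :: "'i \<Rightarrow> 'j \<Rightarrow> real"
  assumes "finite I" "\<And>i. g i summable_on A"
  shows "(\<lambda>j. \<Sum>i\<in>I. g i j) summable_on A \<and> (\<Sum>\<^sub>\<infinity>j\<in>A. \<Sum>i\<in>I. g i j) = (\<Sum>i\<in>I. infsum (g i) A)"
  using assms(1)
proof induction
  case (insert i I)
  then show ?case
    using summable_on_add[OF assms(2)[of i], of "\<lambda>j. \<Sum>i\<in>I. g i j"]
      infsum_add[OF assms(2)[of i], of "\<lambda>j. \<Sum>i\<in>I. g i j"] by simp
qed simp

lemma ell2_sum_slices:
  fixes f :: "'i \<times> 'j \<Rightarrow> complex"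
  assumes f: "(\<lambda>p. (cmod (f p))\<^sup>2) summable_on UNIV" and I: "finite I"
  shows "(\<lambda>j. (cmod (f (i, j)))\<^sup>2) summable_on UNIV"
    and "(\<Sum>i\<in>I. \<Sum>\<^sub>\<infinity>j. (cmod (f (i, j)))\<^sup>2) \<le> (\<Sum>\<^sub>\<infinity>p. (cmod (f p))\<^sup>2)"
proof -
  have le: "(\<Sum>j\<in>J. \<Sum>i\<in>I. (cmod (f (i, j)))\<^sup>2) \<le> (\<Sum>\<^sub>\<infinity>p. (cmod (f p))\<^sup>2)"
    if "finite I" "finite J" for I J
  proof -
    have "(\<Sum>j\<in>J. \<Sum>i\<in>I. (cmod (f (i, j)))\<^sup>2) = (\<Sum>p\<in>I \<times> J. (cmod (f p))\<^sup>2)"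
      by (subst sum.swap) (simp add: sum.cartesian_product case_prod_beta)
    also have "\<dots> \<le> (\<Sum>\<^sub>\<infinity>p. (cmod (f p))\<^sup>2)"
      using that by (intro finite_sum_le_infsum f) auto
    finally show ?thesis .
  qed
  have s: "(\<lambda>j. (cmod (f (i, j)))\<^sup>2) summable_on UNIV" for i
    by (rule nonneg_bdd_above_summable_on)
      (use le[of "{i}"] in \<open>auto intro!: bdd_aboveI[of _ "\<Sum>\<^sub>\<infinity>p. (cmod (f p))\<^sup>2"]\<close>)
  then show "(\<lambda>j. (cmod (f (i, j)))\<^sup>2) summable_on UNIV" .
  have "(\<Sum>i\<in>I. \<Sum>\<^sub>\<infinity>j. (cmod (f (i, j)))\<^sup>2) = (\<Sum>\<^sub>\<infinity>j. \<Sum>i\<in>I. (cmod (f (i, j)))\<^sup>2)"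
    using infsum_finite_sum[OF I, of "\<lambda>i j. (cmod (f (i, j)))\<^sup>2"] s by simp
  also have "\<dots> \<le> (\<Sum>\<^sub>\<infinity>p. (cmod (f p))\<^sup>2)"
    by (rule infsum_le_finite_sums[OF _ le[OF I]]) (use infsum_finite_sum[OF I, of "\<lambda>i j. (cmod (f (i, j)))\<^sup>2"] s in simp)
  finally show "(\<Sum>i\<in>I. \<Sum>\<^sub>\<infinity>j. (cmod (f (i, j)))\<^sup>2) \<le> (\<Sum>\<^sub>\<infinity>p. (cmod (f p))\<^sup>2)" .
qed

lift_definition ell2_slice :: "('i \<times> 'j) ell2 \<Rightarrow> 'i \<Rightarrow> 'j ell2" is "\<lambda>f i j. f (i, j)"
  by (rule ell2_sum_slices(1)[where I = "{}"]) simp_all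

lemma ell2_slice_norm_sum:
  assumes "finite I"
  shows "(\<Sum>i\<in>I. (norm (ell2_slice x i))\<^sup>2) \<le> (norm x)\<^sup>2"
  using assms by transfer (simp add: infsum_nonneg ell2_sum_slices(2))

lemma ell2_slice_amplification_bound:
  assumes "finite F"
  shows "L2_set (\<lambda>p. cmod (ell2_nth (bop_apply T (ell2_slice x (fst p))) (snd p))) F \<le> norm T * norm x"
proof -
  let ?I = "fst ` F" and ?J = "snd ` F"
  let ?y = "\<lambda>i. bop_apply T (ell2_slice x i)"
  have fin: "finite ?I" "finite ?J" using assms by auto
  have "(\<Sum>p\<in>F. (cmod (ell2_nth (?y (fst p)) (snd p)))\<^sup>2) \<le>
      (\<Sum>p\<in>?I \<times> ?J. (cmod (ell2_nth (?y (fst p)) (snd p)))\<^sup>2)"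
    by (rule sum_mono2) (use fin in \<open>force+\<close>)
  also have "\<dots> = (\<Sum>i\<in>?I. \<Sum>j\<in>?J. (cmod (ell2_nth (?y i) j))\<^sup>2)"
    by (simp add: sum.cartesian_product case_prod_beta)
  also have "\<dots> = (\<Sum>i\<in>?I. (L2_set (\<lambda>j. cmod (ell2_nth (?y i) j)) ?J)\<^sup>2)"
    by (simp add: L2_set_def sum_nonneg)
  also have "\<dots> \<le> (\<Sum>i\<in>?I. (norm T * norm (ell2_slice x i))\<^sup>2)"
    by (intro sum_mono power_mono order_trans[OF ell2_L2_set_le_norm[OF fin(2)] norm_bop_apply])
      simp
  also have "\<dots> = (norm T)\<^sup>2 * (\<Sum>i\<in>?I. (norm (ell2_slice x i))\<^sup>2)"
    by (simp add: power_mult_distrib sum_distrib_left)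
  also have "\<dots> \<le> (norm T)\<^sup>2 * (norm x)\<^sup>2"
    by (intro mult_left_mono ell2_slice_norm_sum fin) simp
  finally show ?thesis
    unfolding L2_set_def by (intro real_le_lsqrt) (auto simp: power_mult_distrib)
qed

lemma ell2_nth_add: "ell2_nth (x + y) i = ell2_nth x i + ell2_nth y i"
  by transfer simp

lemma bop_amplification_exists:
  fixes T :: "'j ell2 bop"
  shows "\<exists>R :: ('i \<times> 'j) ell2 bop. \<forall>x y. bop_apply R (ell2_tensor x y) = ell2_tensor x (bop_apply T y)"
proof -
  define f :: "('i \<times> 'j) ell2 \<Rightarrow> ('i \<times> 'j) ell2"
    where "f x = Abs_ell2 (\<lambda>p. ell2_nth (bop_apply T (ell2_slice x (fst p))) (snd p))" for x
  have nth: "ell2_nth (f x) p = ell2_nth (bop_apply T (ell2_slice x (fst p))) (snd p)" for x p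
    unfolding f_def
    by (subst Abs_ell2_inverse) (auto intro!: ell2_boundI(1) ell2_slice_amplification_bound)
  have slice_add: "ell2_slice (x + y) i = ell2_slice x i + ell2_slice y i"
    for x y :: "('i \<times> 'j) ell2" and i
    by transfer simp
  have slice_scale: "ell2_slice (c *\<^sub>C x) i = c *\<^sub>C ell2_slice x i"
    for c and x :: "('i \<times> 'j) ell2" and i
    by transfer simp
  have slice_tensor: "ell2_slice (ell2_tensor x y) i = ell2_nth x i *\<^sub>C y"
    for x :: "'i ell2" and y :: "'j ell2" and i
    by transfer simp
  have scale: "f (c *\<^sub>C x) = c *\<^sub>C f x" for c x
    by (rule ell2_eqI) (simp add: nth slice_scale bop_apply_scaleC ell2_nth_scaleC)
  have "bounded_linear f"
  proof (rule bounded_linear_intro[where K = "norm T"])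
    show "f (x + y) = f x + f y" for x y
      by (rule ell2_eqI) (simp add: nth slice_add bop_apply_add ell2_nth_add)
    show "f (r *\<^sub>R x) = r *\<^sub>R f x" for r x
      by (simp only: scale flip: scaleC_of_real)
    show "norm (f x) \<le> norm x * norm T" for x
      using ell2_slice_amplification_bound[of _ T x]
      by (intro ell2_norm_le) (simp add: nth mult.commute)
  qed
  then obtain R where R: "\<forall>x. bop_apply R x = f x"
    using bop_exists[OF _ scale] by blast
  have "bop_apply R (ell2_tensor x y) = ell2_tensor x (bop_apply T y)" for x y
  proof (rule ell2_eqI)
    fix p :: "'i \<times> 'j"
    show "ell2_nth (bop_apply R (ell2_tensor x y)) p = ell2_nth (ell2_tensor x (bop_apply T y)) p"
      by (cases p) (simp add: R nth slice_tensor bop_apply_scaleC ell2_nth_scaleC ell2_nth_tensor)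
  qed
  then show ?thesis by blast
qed

lift_definition ell2_swap :: "('i \<times> 'j) ell2 \<Rightarrow> ('j \<times> 'i) ell2" is "\<lambda>f p. f (prod.swap p)"
  by (subst summable_on_reindex_bij_betw[OF bij_swap, unfolded o_def]) simp

lemma norm_ell2_swap: "norm (ell2_swap x) = norm x"
  by transfer (subst infsum_reindex_bij_betw[OF bij_swap], simp)

lemma ell2_swap_tensor: "ell2_swap (ell2_tensor x y) = ell2_tensor y x"
  by transfer (auto simp: fun_eq_iff)

lemma bop_swap_exists:
  "\<exists>R :: ('i \<times> 'j) ell2 bop. \<forall>x. bop_apply R x = ell2_swap (bop_apply S (ell2_swap x))"
proof (rule bop_exists)
  have add: "ell2_swap (x + y) = ell2_swap x + ell2_swap y" for x y :: "('k \<times> 'l) ell2"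
    by transfer simp
  have scale: "ell2_swap (c *\<^sub>C x) = c *\<^sub>C ell2_swap x" for c and x :: "('k \<times> 'l) ell2"
    by transfer simp
  have bl: "bounded_linear (ell2_swap :: ('k \<times> 'l) ell2 \<Rightarrow> _)"
    by (rule bounded_linear_intro[where K = 1]) (simp_all add: add scale norm_ell2_swap flip: scaleC_of_real)
  show "bounded_linear (\<lambda>x::('i \<times> 'j) ell2. ell2_swap (bop_apply S (ell2_swap x)))"
    by (intro bounded_linear_compose[OF bl] bounded_linear_compose[OF bounded_linear_bop_apply] bl)
  show "ell2_swap (bop_apply S (ell2_swap (c *\<^sub>C x))) = c *\<^sub>C ell2_swap (bop_apply S (ell2_swap x))"
    for c and x :: "('i \<times> 'j) ell2"
    by (simp add: scale bop_apply_scaleC)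
qed

lemma bop_tensor_apply:
  fixes S :: "'i ell2 bop" and T :: "'j ell2 bop"
  shows "bop_apply (bop_tensor S T) (ell2_tensor x y) = ell2_tensor (bop_apply S x) (bop_apply T y)"
proof -
  have "\<exists>!R. \<forall>x y. bop_apply R (ell2_tensor x y) = ell2_tensor (bop_apply S x) (bop_apply T y)"
  proof (rule ex_ex1I)
    obtain R1 :: "('i \<times> 'j) ell2 bop" where R1: "\<And>x y. bop_apply R1 (ell2_tensor x y) = ell2_tensor x (bop_apply T y)"
      using bop_amplification_exists[of T] by blast
    obtain R2 :: "('j \<times> 'i) ell2 bop" where R2: "\<And>y x. bop_apply R2 (ell2_tensor y x) = ell2_tensor y (bop_apply S x)"
      using bop_amplification_exists[of S] by blast
    obtain R3 :: "('i \<times> 'j) ell2 bop" where R3: "\<And>x. bop_apply R3 x = ell2_swap (bop_apply R2 (ell2_swap x))"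
      using bop_swap_exists[of R2] by blast
    show "\<exists>R. \<forall>x y. bop_apply R (ell2_tensor x y) = ell2_tensor (bop_apply S x) (bop_apply T y)"
      by (rule exI[of _ "R3 * R1"]) (simp add: bop_apply_mult R1 R2 R3 ell2_swap_tensor)
  next
    fix R R' assume "\<forall>x y. bop_apply R (ell2_tensor x y) = ell2_tensor (bop_apply S x) (bop_apply T y)"
      "\<forall>x y. bop_apply R' (ell2_tensor x y) = ell2_tensor (bop_apply S x) (bop_apply T y)"
    then show "R = R'"
      by (intro bop_eq_basisI) (metis ell2_basis_tensor surj_pair)
  qed
  from theI'[OF this] show ?thesis unfolding bop_tensor_def by blast
qed


section \<open>C*-subalgebras and positive elements\<close>

definition unital_cstar_subalgebra :: "'a::cstar_algebra set \<Rightarrow> bool" where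
  "unital_cstar_subalgebra A \<longleftrightarrow> complex_vector.subspace A \<and> closed A \<and> 1 \<in> A \<and>
    (\<forall>x\<in>A. \<forall>y\<in>A. x * y \<in> A) \<and> (\<forall>x\<in>A. star x \<in> A)"

definition cstar_generated :: "'a::cstar_algebra set \<Rightarrow> 'a set" where
  "cstar_generated X = \<Inter>{B. unital_cstar_subalgebra B \<and> X \<subseteq> B}"

definition pos_cone :: "'a::cstar_algebra set \<Rightarrow> 'a set" where
  "pos_cone A = {star y * y | y. y \<in> A}"

definition strict_pos_cone :: "'a::cstar_algebra set \<Rightarrow> 'a set" where
  "strict_pos_cone A = {p \<in> A. \<exists>\<epsilon>::real. \<epsilon> > 0 \<and> p - \<epsilon> *\<^sub>R 1 \<in> pos_cone A}"

definition mat_star :: "'a::cstar_algebra mat \<Rightarrow> 'a mat" where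
  "mat_star Y = map_mat star (transpose_mat Y)"

definition mat_algebra :: "nat \<Rightarrow> 'a::cstar_algebra set \<Rightarrow> 'a mat set" where
  "mat_algebra k A = {Y \<in> carrier_mat k k. elements_mat Y \<subseteq> A}"

definition mat_pos_cone :: "nat \<Rightarrow> 'a::cstar_algebra set \<Rightarrow> 'a mat set" where
  "mat_pos_cone k A = {mat_star Y * Y | Y. Y \<in> mat_algebra k A}"

definition mat_strict_pos_cone :: "nat \<Rightarrow> 'a::cstar_algebra set \<Rightarrow> 'a mat set" where
  "mat_strict_pos_cone k A = {P \<in> mat_algebra k A.
    \<exists>\<epsilon>::real. \<epsilon> > 0 \<and> P - of_real \<epsilon> \<cdot>\<^sub>m 1\<^sub>m k \<in> mat_pos_cone k A}"

text \<open>Row and column \<open>0\<close> form the border; rows and columns \<open>1, \<dots>, n\<close> form the diagonal block.\<close>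

definition arrow_mat :: "nat \<Rightarrow> 'a::cstar_algebra \<Rightarrow> 'a \<Rightarrow> (nat \<Rightarrow> 'a) \<Rightarrow> 'a mat" where
  "arrow_mat n a b x = mat (n + 1) (n + 1) (\<lambda>(i, j).
    if i = 0 \<and> j = 0 then a
    else if i = 0 then x j
    else if j = 0 then star (x i)
    else if i = j then b
    else 0)"


section \<open>Von Neumann algebras\<close>

definition commutant :: "'h::chilbert_space bop set \<Rightarrow> 'h bop set" where
  "commutant M = {T. \<forall>S\<in>M. S * T = T * S}"

definition von_neumann_algebra :: "'h::chilbert_space bop set \<Rightarrow> bool" where
  "von_neumann_algebra M \<longleftrightarrow> (\<forall>T\<in>M. star T \<in> M) \<and> commutant (commutant M) = M"


section \<open>The Cuntz algebra\<close>

text \<open>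
  A C*-algebra generated by such a family is determined up to a *-isomorphism matching the
  generators (Cuntz), so \<open>cuntz_algebra n S\<close> is the Cuntz algebra for any \<open>S\<close> with \<open>cuntz_family n S\<close>.
\<close>

definition cuntz_family :: "nat \<Rightarrow> (nat \<Rightarrow> 'o::cstar_algebra) \<Rightarrow> bool" where
  "cuntz_family n S \<longleftrightarrow>
    (\<forall>i\<in>{1..n}. star (S i) * S i = 1) \<and> (\<Sum>i=1..n. S i * star (S i)) = 1"

definition cuntz_algebra :: "nat \<Rightarrow> (nat \<Rightarrow> 'o::cstar_algebra) \<Rightarrow> 'o set" where
  "cuntz_algebra n S = cstar_generated (S ` {1..n})"


section \<open>The minimal tensor product and dual row contractions\<close>

definition faithful_rep :: "'a::cstar_algebra set \<Rightarrow> ('a \<Rightarrow> 'h::chilbert_space bop) \<Rightarrow> bool" where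
  "faithful_rep A \<pi> \<longleftrightarrow>
    (\<forall>x\<in>A. \<forall>y\<in>A. \<pi> (x + y) = \<pi> x + \<pi> y) \<and>
    (\<forall>c. \<forall>x\<in>A. \<pi> (c *\<^sub>C x) = c *\<^sub>C \<pi> x) \<and>
    (\<forall>x\<in>A. \<forall>y\<in>A. \<pi> (x * y) = \<pi> x * \<pi> y) \<and>
    (\<forall>x\<in>A. \<pi> (star x) = star (\<pi> x)) \<and>
    \<pi> 1 = 1 \<and> inj_on \<pi> A"

definition min_tensor ::
    "('o::cstar_algebra \<Rightarrow> 'i ell2 bop) \<Rightarrow> 'o set \<Rightarrow> ('a::cstar_algebra \<Rightarrow> 'j ell2 bop) \<Rightarrow> 'a set
      \<Rightarrow> ('i \<times> 'j) ell2 bop set" where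
  "min_tensor \<pi> B \<rho> A =
    closure (complex_vector.span {bop_tensor (\<pi> x) (\<rho> y) | x y. x \<in> B \<and> y \<in> A})"

definition dual_row_element ::
    "nat \<Rightarrow> (nat \<Rightarrow> 'o::cstar_algebra) \<Rightarrow> (nat \<Rightarrow> 'a::cstar_algebra)
      \<Rightarrow> ('o \<Rightarrow> 'i ell2 bop) \<Rightarrow> ('a \<Rightarrow> 'j ell2 bop) \<Rightarrow> ('i \<times> 'j) ell2 bop" where
  "dual_row_element n S x \<pi> \<rho> =
    bop_tensor (\<pi> 1) (\<rho> 1)
    + (\<Sum>j=1..n. bop_tensor (\<pi> (S j)) (\<rho> (star (x j))))
    + (\<Sum>j=1..n. bop_tensor (\<pi> (star (S j))) (\<rho> (x j)))"

text \<open>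
  The minimal tensor product is the norm closure of the algebraic tensor product in the bounded
  operators on the tensor product of two Hilbert spaces on which the factors are faithfully
  represented; up to canonical isomorphism it does not depend on the faithful representations
  (Takesaki), so it does not matter which pair witnesses the existential quantifiers below. HOL
  cannot quantify over the types of the Hilbert spaces; the elements of the ambient types serve as
  orthonormal bases. This is no restriction: a C*-subalgebra of \<open>'a\<close> has a faithful representation
  on a Hilbert space of dimension at most the cardinality of \<open>'a\<close> (sum one cyclic GNS
  representation for each nonzero element), and after passing to a multiple, on \<open>'a ell2\<close>.
\<close>

definition dual_row_contraction ::
    "nat \<Rightarrow> (nat \<Rightarrow> 'o::cstar_algebra) \<Rightarrow> 'a::cstar_algebra set \<Rightarrow> (nat \<Rightarrow> 'a) \<Rightarrow> bool" where
  "dual_row_contraction n S A x \<longleftrightarrow>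
    (\<exists>(\<pi> :: 'o \<Rightarrow> 'o ell2 bop) (\<rho> :: 'a \<Rightarrow> 'a ell2 bop).
      faithful_rep (cuntz_algebra n S) \<pi> \<and> faithful_rep A \<rho> \<and>
      dual_row_element n S x \<pi> \<rho> \<in> pos_cone (min_tensor \<pi> (cuntz_algebra n S) \<rho> A))"

definition strict_dual_row_contraction ::
    "nat \<Rightarrow> (nat \<Rightarrow> 'o::cstar_algebra) \<Rightarrow> 'a::cstar_algebra set \<Rightarrow> (nat \<Rightarrow> 'a) \<Rightarrow> bool" where
  "strict_dual_row_contraction n S A x \<longleftrightarrow>
    (\<exists>(\<pi> :: 'o \<Rightarrow> 'o ell2 bop) (\<rho> :: 'a \<Rightarrow> 'a ell2 bop).
      faithful_rep (cuntz_algebra n S) \<pi> \<and> faithful_rep A \<rho> \<and>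
      dual_row_element n S x \<pi> \<rho> \<in> strict_pos_cone (min_tensor \<pi> (cuntz_algebra n S) \<rho> A))"

end

theory Submission
  imports Defs
begin

text \<open>
  In any representation of the Cuntz algebra a vector of the form \<open>S\<^sub>1\<^sup>L S\<^sub>2 \<eta>\<close> is wandering up to level
  \<open>L\<close>, so positivity of \<open>1 + \<Sum> S\<^sub>j \<otimes> a\<^sub>j\<^sup>* + \<Sum> S\<^sub>j\<^sup>* \<otimes> a\<^sub>j\<close> gives positivity of the quadratic form
  \<open>\<Sum> \<parallel>f v\<parallel>\<^sup>2 + 2 Re \<Sum> \<langle>a\<^sub>j\<^sup>* f v, f (j v)\<rangle>\<close> for functions \<open>f\<close> on the words of length at most \<open>L\<close>. This form is
  indexed by a tree, and its Schur complements onto the root are \<open>b\<^sub>0 = \<tau>\<close>,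
  \<open>b\<^sub>m\<^sub>+\<^sub>1 = \<tau> - \<Sum> a\<^sub>j b\<^sub>m\<inverse> a\<^sub>j\<^sup>*\<close>, where \<open>\<tau>\<close> replaces the constant term 1 so as to keep the form strictly
  positive; hence all \<open>b\<^sub>m\<close> are bounded below, and the arrow matrix with corner \<open>\<tau> - b\<^sub>m\<^sub>+\<^sub>1\<close> and diagonal
  \<open>b\<^sub>m\<close> is positive. In the strict case \<open>\<tau> < 1\<close>, and averaging over \<open>m < N\<close> makes corner plus diagonal
  equal to \<open>\<tau>\<close> up to \<open>O(1/N)\<close>; the remaining slack is distributed evenly. In a von Neumann algebra the
  \<open>b\<^sub>m\<close> for \<open>\<tau> = 1 + 1/(m+1)\<close> decrease strongly to some \<open>b\<close>, and \<open>a = 1 - b\<close> works.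

  Positivity is detected in a faithful representation, which is isometric; square roots are the
  binomial series of \<open>\<surd>(1 - z)\<close>, absolutely convergent for \<open>\<parallel>z\<parallel> \<le> 1\<close>.
\<close>

section \<open>Square roots in C*-algebras\<close>

text \<open>The coefficient of \<open>z ^ k\<close> in the binomial series of the square root of
  \<open>1 - z\<close>.\<close>

definition sqrt_coeff :: "nat \<Rightarrow> real" where
  "sqrt_coeff k = (- 1) ^ k * ((1/2) gchoose k)"

lemma sqrt_coeff_0 [simp]: "sqrt_coeff 0 = 1"
  by (simp add: sqrt_coeff_def)

text \<open>The coefficient at 1 is -1/2, and each later one is its predecessor times a positive
  factor.\<close>

lemma sqrt_coeff_nonpos: "sqrt_coeff (Suc k) \<le> 0"
proof (induction k)
  case 0
  then show ?case by (simp add: sqrt_coeff_def)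
next
  case (Suc k)
  have "sqrt_coeff (Suc (Suc k)) = sqrt_coeff (Suc k) * ((real k + 1/2) / (real k + 2))"
    by (simp add: sqrt_coeff_def gbinomial_Suc_rec field_simps)
  with Suc show ?case by (simp only:) (rule mult_nonpos_nonneg, auto)
qed

text \<open>The partial sums of all coefficients have a closed form, a generalized binomial
  coefficient that is visibly nonnegative. As the constant coefficient is 1 and the others are
  nonpositive, the absolute values of the latter add up to at most 1. Hence the series converges on
  the whole closed unit ball.\<close>

lemma sqrt_coeff_sum: "(\<Sum>k\<le>m. \<bar>sqrt_coeff (Suc k)\<bar>) \<le> 1"
proof -
  have "(\<Sum>k\<le>Suc m. sqrt_coeff k) = (-1) ^ Suc m * ((- (1/2)) gchoose Suc m)"
    using gbinomial_sum_lower_neg[of "1/2::real" "Suc m"] by (simp add: sqrt_coeff_def mult.commute)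
  also have "\<dots> = (1/2 + real m) gchoose Suc m"
    by (simp add: gbinomial_negated_upper[of "- (1/2)"])
  also have "\<dots> \<ge> 0"
    unfolding gbinomial_prod_rev by (intro divide_nonneg_nonneg prod_nonneg) (auto simp: not_less)
  finally have "(\<Sum>k\<le>Suc m. sqrt_coeff k) \<ge> 0" .
  moreover have "(\<Sum>k\<le>Suc m. sqrt_coeff k) = 1 - (\<Sum>k\<le>m. \<bar>sqrt_coeff (Suc k)\<bar>)"
    by (subst sum.atMost_Suc_shift) (simp add: abs_of_nonpos[OF sqrt_coeff_nonpos] sum_negf)
  ultimately show ?thesis by linarith
qed

text \<open>Vandermonde's identity with 1/2 + 1/2 = 1: squaring the series leaves the coefficients
  of \<open>1 - z\<close>.\<close>

lemma sqrt_coeff_convolution: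
  "(\<Sum>i\<le>k. sqrt_coeff i * sqrt_coeff (k - i)) = (if k = 0 then 1 else if k = 1 then -1 else 0)"
proof -
  have "(\<Sum>i\<le>k. sqrt_coeff i * sqrt_coeff (k - i)) =
      (-1) ^ k * (\<Sum>i\<le>k. ((1/2) gchoose i) * ((1/2) gchoose (k - i)))"
    unfolding sum_distrib_left
    by (intro sum.cong) (auto simp: sqrt_coeff_def power_add[symmetric] simp flip: mult.assoc)
  also have "(\<Sum>i\<le>k. ((1/2) gchoose i) * ((1/2::real) gchoose (k - i))) = (1 gchoose k)"
    using gbinomial_Vandermonde[of "1/2::real" "1/2" k] by (simp add: atMost_atLeast0)
  also have "(1::real) gchoose k = of_nat (1 choose k)"
    by (metis binomial_gbinomial of_nat_1)
  finally show ?thesis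
    by (auto simp: not_less less_Suc_eq numeral_eq_Suc intro!: binomial_eq_0)
qed

lemma summable_sqrt_coeff: "summable (\<lambda>k. \<bar>sqrt_coeff (Suc k)\<bar>)"
  by (rule bounded_imp_summable[OF _ sqrt_coeff_sum]) simp

lemma suminf_sqrt_coeff: "(\<Sum>k. \<bar>sqrt_coeff (Suc k)\<bar>) \<le> 1"
proof (rule suminf_le_const[OF summable_sqrt_coeff])
  show "(\<Sum>k<m. \<bar>sqrt_coeff (Suc k)\<bar>) \<le> 1" for m
    by (rule order_trans[OF sum_mono2 sqrt_coeff_sum[of m]]) auto
qed

section \<open>The square root series on the closed unit ball\<close>

definition sqrt_one_minus :: "'a::{real_normed_algebra_1,banach} \<Rightarrow> 'a" where
  "sqrt_one_minus z = (\<Sum>k. sqrt_coeff k *\<^sub>R z ^ k)"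

context
  fixes z :: "'a::{real_normed_algebra_1,banach}"
  assumes z: "norm z \<le> 1"
begin

lemma sqrt_term_le: "norm (sqrt_coeff k *\<^sub>R z ^ k) \<le> \<bar>sqrt_coeff k\<bar>"
proof -
  have "norm (z ^ k) \<le> norm z ^ k" by (rule norm_power_ineq)
  also have "\<dots> \<le> 1" using z by (simp add: power_le_one)
  finally show ?thesis by (simp add: mult_left_le)
qed

lemma summable_norm_sqrt_term: "summable (\<lambda>k. norm (sqrt_coeff k *\<^sub>R z ^ k))"
proof (rule summable_comparison_test')
  show "summable (\<lambda>k. \<bar>sqrt_coeff k\<bar>)"
    by (rule summable_Suc_iff[THEN iffD1, OF summable_sqrt_coeff])
  show "norm (norm (sqrt_coeff k *\<^sub>R z ^ k)) \<le> \<bar>sqrt_coeff k\<bar>" if "0 \<le> k" for k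
    unfolding real_norm_def abs_norm_cancel by (rule sqrt_term_le)
qed

lemma sqrt_one_minus_sums: "(\<lambda>k. sqrt_coeff k *\<^sub>R z ^ k) sums sqrt_one_minus z"
  unfolding sqrt_one_minus_def by (rule summable_sums[OF summable_norm_cancel[OF summable_norm_sqrt_term]])

lemma sqrt_one_minus_square: "sqrt_one_minus z * sqrt_one_minus z = 1 - z"
proof -
  have "sqrt_one_minus z * sqrt_one_minus z =
      (\<Sum>k. \<Sum>i\<le>k. (sqrt_coeff i *\<^sub>R z ^ i) * (sqrt_coeff (k - i) *\<^sub>R z ^ (k - i)))"
    unfolding sqrt_one_minus_def
    by (rule Cauchy_product[OF summable_norm_sqrt_term summable_norm_sqrt_term])
  also have "\<dots> = (\<Sum>k. (\<Sum>i\<le>k. sqrt_coeff i * sqrt_coeff (k - i)) *\<^sub>R z ^ k)"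
    by (intro arg_cong[of _ _ suminf] ext)
      (auto simp: scaleR_sum_left simp flip: power_add intro!: sum.cong)
  also have "\<dots> = (\<Sum>k. (if k = 0 then 1 else if k = 1 then -1 else 0) *\<^sub>R z ^ k)"
    by (simp only: sqrt_coeff_convolution)
  also have "\<dots> = (\<Sum>k\<in>{0,1}. (if k = 0 then 1 else if k = 1 then -1 else 0) *\<^sub>R z ^ k)"
    by (rule suminf_finite) auto
  finally show ?thesis by simp
qed

text \<open>Ensures that the same series can be applied once more, to extract a root of the
  root.\<close>

lemma norm_one_minus_sqrt_le: "norm (1 - sqrt_one_minus z) \<le> 1"
proof -
  have "(\<lambda>k. sqrt_coeff (Suc k) *\<^sub>R z ^ Suc k) sums (sqrt_one_minus z - 1)"
    using sqrt_one_minus_sums by (subst sums_Suc_iff) simp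
  then have *: "sqrt_one_minus z - 1 = (\<Sum>k. sqrt_coeff (Suc k) *\<^sub>R z ^ Suc k)"
    by (simp add: sums_iff)
  have s: "summable (\<lambda>k. norm (sqrt_coeff (Suc k) *\<^sub>R z ^ Suc k))"
    using summable_norm_sqrt_term by (subst summable_Suc_iff)
  have "norm (sqrt_one_minus z - 1) \<le> (\<Sum>k. norm (sqrt_coeff (Suc k) *\<^sub>R z ^ Suc k))"
    unfolding * by (rule summable_norm[OF s])
  also have "\<dots> \<le> (\<Sum>k. \<bar>sqrt_coeff (Suc k)\<bar>)"
    by (rule suminf_le[OF sqrt_term_le s summable_sqrt_coeff])
  also note suminf_sqrt_coeff
  finally show ?thesis by (simp add: norm_minus_commute)
qed

lemma sqrt_one_minus_commute:
  assumes "x * z = z * x"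
  shows "x * sqrt_one_minus z = sqrt_one_minus z * x"
proof -
  have "x * z ^ k = z ^ k * x" for k
    using power_commuting_commutes[OF assms[symmetric], of k] by simp
  then have "(\<lambda>k. x * (sqrt_coeff k *\<^sub>R z ^ k)) = (\<lambda>k. (sqrt_coeff k *\<^sub>R z ^ k) * x)"
    by simp
  then show ?thesis
    using sums_mult[OF sqrt_one_minus_sums, of x] sums_mult2[OF sqrt_one_minus_sums, of x]
    by (metis sums_unique2)
qed

end

section \<open>The involution and closed subalgebras\<close>

lemma sums_in_closed_subspace:
  assumes "complex_vector.subspace A" "closed A" "f sums s" "\<And>k. f k \<in> A"
  shows "s \<in> (A :: 'a::complex_normed_vector set)"
  using assms(3) unfolding sums_def
  by (rule closed_sequentially[OF assms(2), rotated])
    (auto intro!: complex_vector.subspace_sum[OF assms(1)] assms(4))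

lemma norm_star: "norm (star x) = norm (x::'a::cstar_algebra)"
proof -
  have le: "norm x \<le> norm (star x)" for x :: 'a
  proof (cases "x = 0")
    case False
    have "norm x * norm x \<le> norm (star x) * norm x"
      using cstar_identity[of x] norm_mult_ineq[of "star x" x] by (simp add: power2_eq_square)
    then show ?thesis using False by simp
  qed simp
  show ?thesis using le[of x] le[of "star x"] by (simp add: star_star)
qed

lemma star_scaleR: "star (r *\<^sub>R x) = r *\<^sub>R star (x::'a::cstar_algebra)"
  by (simp add: star_scaleC flip: scaleC_of_real)

lemma bounded_linear_star: "bounded_linear (star :: 'a::cstar_algebra \<Rightarrow> 'a)"
  by (rule bounded_linear_intro[where K = 1]) (simp_all add: star_add star_scaleR norm_star)

lemmas star_diff = linear_diff[OF bounded_linear.linear[OF bounded_linear_star]]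
lemmas star_sum = linear_sum[OF bounded_linear.linear[OF bounded_linear_star]]
lemmas star_0 [simp] = linear_0[OF bounded_linear.linear[OF bounded_linear_star]]

lemma star_1 [simp]: "star 1 = (1::'a::cstar_algebra)"
  by (metis mult_1 mult.right_neutral star_mult star_star)

lemma star_power: "star (x ^ k) = star (x::'a::cstar_algebra) ^ k"
  by (induction k) (simp_all add: star_mult power_commutes)

lemma star_sqrt_one_minus:
  fixes z :: "'a::cstar_algebra"
  assumes "norm z \<le> 1" "star z = z"
  shows "star (sqrt_one_minus z) = sqrt_one_minus z"
proof -
  have "(\<lambda>k. star (sqrt_coeff k *\<^sub>R z ^ k)) sums star (sqrt_one_minus z)"
    by (rule bounded_linear.sums[OF bounded_linear_star sqrt_one_minus_sums[OF assms(1)]])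
  then show ?thesis
    using sqrt_one_minus_sums[OF assms(1)] by (simp add: star_scaleR star_power assms(2) sums_unique2)
qed

locale cstar_subalgebra =
  fixes A :: "'a::cstar_algebra set"
  assumes A: "unital_cstar_subalgebra A"
begin

lemma subspace: "complex_vector.subspace A" and closed: "closed A" and one_in [simp]: "1 \<in> A"
  and mult_in: "x \<in> A \<Longrightarrow> y \<in> A \<Longrightarrow> x * y \<in> A" and star_in: "x \<in> A \<Longrightarrow> star x \<in> A"
  using A unfolding unital_cstar_subalgebra_def by auto

lemma scaleR_in: "x \<in> A \<Longrightarrow> r *\<^sub>R x \<in> A"
  unfolding scaleC_of_real[symmetric] by (rule complex_vector.subspace_scale[OF subspace])

lemmas zero_in [simp] = complex_vector.subspace_0[OF subspace]
lemmas add_in = complex_vector.subspace_add[OF subspace]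
lemmas diff_in = complex_vector.subspace_diff[OF subspace]
lemmas neg_in = complex_vector.subspace_neg[OF subspace]
lemmas sum_in = complex_vector.subspace_sum[OF subspace]

lemma power_in: "x \<in> A \<Longrightarrow> x ^ k \<in> A"
  by (induction k) (simp_all add: mult_in)

lemmas closed_intros = mult_in star_in scaleR_in add_in diff_in neg_in sum_in power_in

lemma sqrt_one_minus_in:
  assumes "z \<in> A" "norm z \<le> 1"
  shows "sqrt_one_minus z \<in> A"
  using sqrt_one_minus_sums[OF assms(2)]
  by (rule sums_in_closed_subspace[OF subspace closed]) (intro closed_intros assms)

end

text \<open>With \<open>c = a + \<i> b\<close> normal, \<open>star c * c = a\<^sup>2 + b\<^sup>2\<close> and \<open>a\<close> is the real part of \<open>c\<close>.\<close>

lemma norm_square_le_sum_squares: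
  fixes a b :: "'a::cstar_algebra"
  assumes sa: "star a = a" "star b = b" and comm: "a * b = b * a"
  shows "(norm a)\<^sup>2 \<le> norm (a * a + b * b)"
proof -
  define c where "c = a + \<i> *\<^sub>C b"
  have sc: "star c = a - \<i> *\<^sub>C b"
    by (simp add: c_def star_add star_scaleC sa complex_vector.scale_minus_left)
  have "star c * c = a * a + b * b"
    unfolding sc unfolding c_def
    by (simp add: algebra_simps mult_scaleC_left mult_scaleC_right comm scaleC_scaleC scaleC_minus_one)
  then have n: "norm (a * a + b * b) = (norm c)\<^sup>2"
    by (metis cstar_identity)
  have "2 *\<^sub>R a = c + star c" by (simp add: sc) (simp add: c_def scaleR_2)
  then have "2 * norm a \<le> norm c + norm (star c)"
    by (metis norm_scaleR norm_triangle_ineq abs_numeral)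
  then have "norm a \<le> norm c" by (simp add: norm_star)
  then show ?thesis unfolding n by (simp add: power_mono)
qed

section \<open>Faithful representations\<close>

definition qform :: "'h::chilbert_space bop \<Rightarrow> 'h \<Rightarrow> real" where
  "qform T v = Re (cinner v (bop_apply T v))"

lemma bop_apply_scaleR_left: "bop_apply (r *\<^sub>R T) x = r *\<^sub>R bop_apply T x"
  by (simp add: bop_apply_scaleC_left flip: scaleC_of_real)

lemma bop_apply_scaleR: "bop_apply T (r *\<^sub>R x) = r *\<^sub>R bop_apply T x"
  by (simp add: bop_apply_scaleC flip: scaleC_of_real)

lemma bop_apply_zero_left [simp]: "bop_apply 0 x = 0"
  using bop_apply_scaleR_left[of 0 0 x] by simp

lemma bop_apply_sum_left: "bop_apply (\<Sum>i\<in>I. T i) x = (\<Sum>i\<in>I. bop_apply (T i) x)"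
  by (induction I rule: infinite_finite_induct) (simp_all add: bop_apply_add_left)

lemma cinner_scaleR_right: "cinner x (r *\<^sub>R y) = of_real r * cinner (x::'a::chilbert_space) y"
  by (simp add: cinner_scaleC_right flip: scaleC_of_real)

lemma cinner_scaleR_left: "cinner (r *\<^sub>R x) y = of_real r * cinner (x::'a::chilbert_space) y"
  by (simp add: cinner_scaleC_left flip: scaleC_of_real)

lemma cinner_sum_right: "cinner x (\<Sum>i\<in>I. f i) = (\<Sum>i\<in>I. cinner (x::'a::chilbert_space) (f i))"
  by (induction I rule: infinite_finite_induct) (simp_all add: cinner_add_right)

lemma cinner_sum_left: "cinner (\<Sum>i\<in>I. f i) x = (\<Sum>i\<in>I. cinner (f i) (x::'a::chilbert_space))"
  by (induction I rule: infinite_finite_induct) (simp_all add: cinner_add_left)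

lemma Re_cinner_commute: "Re (cinner x y) = Re (cinner y (x::'a::chilbert_space))"
  using cinner_commute[of x y] by (metis complex_cnj_cnj cnj.sel(1))

lemma Re_cinner_self: "Re (cinner x x) = (norm (x::'a::chilbert_space))\<^sup>2"
  by (simp add: cinner_self)

lemma qform_add: "qform (S + T) v = qform S v + qform T v"
  by (simp add: qform_def bop_apply_add_left cinner_add_right)

lemma qform_diff: "qform (S - T) v = qform S v - qform T v"
  by (simp add: qform_def bop_apply_diff_left cinner_diff_right)

lemma qform_scaleR: "qform (r *\<^sub>R T) v = r * qform T v"
  by (simp add: qform_def bop_apply_scaleR_left cinner_scaleR_right)

lemma qform_zero [simp]: "qform 0 v = 0"
  by (simp add: qform_def)

lemma qform_one [simp]: "qform 1 v = (norm v)\<^sup>2"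
  by (simp add: qform_def bop_apply_one Re_cinner_self)

lemma qform_sum: "qform (\<Sum>i\<in>I. T i) v = (\<Sum>i\<in>I. qform (T i) v)"
  by (simp add: qform_def bop_apply_sum_left cinner_sum_right)

lemma qform_star_mult: "qform (star S * T) v = Re (cinner (bop_apply S v) (bop_apply T v))"
  by (simp add: qform_def bop_apply_mult cinner_star_bop')

lemma qform_square: "qform (star T * T) v = (norm (bop_apply T v))\<^sup>2"
  by (simp add: qform_star_mult Re_cinner_self)

lemma qform_conj: "qform (star S * T * S) v = qform T (bop_apply S v)"
  by (simp add: qform_def bop_apply_mult cinner_star_bop')

lemma abs_qform_le: "\<bar>qform T v\<bar> \<le> norm T * (norm v)\<^sup>2"
proof -
  have "\<bar>qform T v\<bar> \<le> norm v * norm (bop_apply T v)"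
    unfolding qform_def by (rule order_trans[OF abs_Re_le_cmod Cauchy_Schwarz])
  also have "\<dots> \<le> norm v * (norm T * norm v)"
    by (rule mult_left_mono[OF norm_bop_apply norm_ge_zero])
  also have "\<dots> = norm T * (norm v)\<^sup>2"
    unfolding power2_eq_square by (rule mult.left_commute)
  finally show ?thesis .
qed

text \<open>For a self-adjoint operator the numerical radius is the norm: polarization recovers the
  matrix entries from the form, and the parallelogram law keeps the constant sharp.\<close>

lemma norm_le_if_qform_le:
  assumes sa: "star T = T" and K: "0 \<le> K" and bound: "\<And>v. \<bar>qform T v\<bar> \<le> K * (norm v)\<^sup>2"
  shows "norm T \<le> K"
proof (rule norm_bop_bound[OF K])
  fix u
  show "norm (bop_apply T u) \<le> K * norm u"
  proof (cases "u = 0 \<or> bop_apply T u = 0")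
    case False
    define w where "w = bop_apply T u"
    \<comment> \<open>The direction of \<open>T u\<close>, rescaled to the length of
      \<open>u\<close>, so that the two squares in the parallelogram law are equal.\<close>
    define v where "v = (norm u / norm w) *\<^sub>R w"
    have w: "norm w > 0" and u: "norm u > 0" using False by (auto simp: w_def)
    have nv: "norm v = norm u" using w by (simp add: v_def)
    have vw: "Re (cinner v w) = norm u * norm w"
      using w by (simp add: v_def cinner_scaleR_left cinner_self power2_eq_square)
    have "cinner (bop_apply T v) u = cinner v w"
      using cinner_star_bop[of T v u] by (simp only: sa w_def)
    then have "Re (cinner u (bop_apply T v)) = Re (cinner v w)"
      using Re_cinner_commute[of u "bop_apply T v"] by simp
    then have "4 * (norm u * norm w) = qform T (u + v) - qform T (u - v)"
      by (simp add: qform_def bop_apply_add bop_apply_diff cinner_add_right cinner_add_left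
          cinner_diff_right cinner_diff_left vw flip: w_def)
    also have "\<dots> \<le> K * (norm (u + v))\<^sup>2 + K * (norm (u - v))\<^sup>2"
      using bound[of "u + v"] bound[of "u - v"] by linarith
    also have "\<dots> = K * ((norm (u + v))\<^sup>2 + (norm (u - v))\<^sup>2)" by (rule distrib_left[symmetric])
    also have "(norm (u + v))\<^sup>2 + (norm (u - v))\<^sup>2 = 2 * (norm u)\<^sup>2 + 2 * (norm v)\<^sup>2"
      using norm_add_square[of u v] norm_add_square[of u "- v"] by (simp add: cinner_minus_right)
    finally have "norm u * norm w \<le> norm u * (K * norm u)"
      by (simp add: nv power2_eq_square algebra_simps)
    then show ?thesis using u by (simp add: w_def)
  qed (use K in auto)
qed

section \<open>Isometry, square roots and inverses through a faithful representation\<close>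

locale cstar_rep = cstar_subalgebra A for A :: "'a::cstar_algebra set" +
  fixes \<rho> :: "'a \<Rightarrow> 'h::chilbert_space bop"
  assumes rep: "faithful_rep A \<rho>"
begin

lemma rep_add: "x \<in> A \<Longrightarrow> y \<in> A \<Longrightarrow> \<rho> (x + y) = \<rho> x + \<rho> y"
  and rep_scaleC: "x \<in> A \<Longrightarrow> \<rho> (c *\<^sub>C x) = c *\<^sub>C \<rho> x"
  and rep_mult: "x \<in> A \<Longrightarrow> y \<in> A \<Longrightarrow> \<rho> (x * y) = \<rho> x * \<rho> y"
  and rep_star: "x \<in> A \<Longrightarrow> \<rho> (star x) = star (\<rho> x)"
  and rep_one: "\<rho> 1 = 1"
  and rep_inj: "x \<in> A \<Longrightarrow> y \<in> A \<Longrightarrow> \<rho> x = \<rho> y \<Longrightarrow> x = y"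
  using rep unfolding faithful_rep_def inj_on_def by blast+

lemma rep_scaleR: "x \<in> A \<Longrightarrow> \<rho> (r *\<^sub>R x) = r *\<^sub>R \<rho> x"
  by (simp add: rep_scaleC flip: scaleC_of_real)

lemma rep_zero: "\<rho> 0 = 0"
  using rep_scaleR[of 0 0] by simp

lemma rep_diff: "x \<in> A \<Longrightarrow> y \<in> A \<Longrightarrow> \<rho> (x - y) = \<rho> x - \<rho> y"
  using rep_add[of "x - y" y] by (simp add: diff_in)

lemma rep_sum: "(\<And>i. i \<in> I \<Longrightarrow> f i \<in> A) \<Longrightarrow> \<rho> (\<Sum>i\<in>I. f i) = (\<Sum>i\<in>I. \<rho> (f i))"
  by (induction I rule: infinite_finite_induct) (simp_all add: rep_add rep_zero sum_in)

lemmas rep_simps = rep_one rep_zero rep_add rep_scaleR rep_mult rep_star rep_diff rep_sum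

lemma qform_rep_square: "x \<in> A \<Longrightarrow> qform (\<rho> (star x * x)) v = (norm (bop_apply (\<rho> x) v))\<^sup>2"
  by (simp add: rep_mult rep_star star_in qform_square)

text \<open>After scaling to norm 1, \<open>1 - t * t\<close> is the square of a self-adjoint
  \<open>h\<close> in \<open>A\<close>, so the squared lengths of \<rho>(t) v and \<rho>(h) v add up
  to that of \<open>v\<close>.\<close>

lemma norm_rep_le_selfadjoint:
  assumes s: "s \<in> A" "star s = s"
  shows "norm (\<rho> s) \<le> norm s"
proof (cases "s = 0")
  case False
  then have ns: "norm s > 0" by simp
  define t where "t = (1 / norm s) *\<^sub>R s"
  have t: "t \<in> A" "star t = t" "norm t = 1" and s_t: "s = norm s *\<^sub>R t"
    using s ns by (auto simp: t_def scaleR_in star_scaleR)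
  have tt: "norm (t * t) \<le> 1" using norm_mult_ineq[of t t] t by simp
  define h where "h = sqrt_one_minus (t * t)"
  have h: "h \<in> A" "star h = h" "h * h = 1 - t * t"
    using tt t by (auto simp: h_def sqrt_one_minus_in sqrt_one_minus_square star_sqrt_one_minus star_mult mult_in)
  have "norm (\<rho> t) \<le> 1"
  proof (rule norm_bop_bound)
    fix v
    have "(norm (bop_apply (\<rho> t) v))\<^sup>2 + (norm (bop_apply (\<rho> h) v))\<^sup>2 =
        qform (\<rho> (t * t)) v + qform (\<rho> (h * h)) v"
      using qform_rep_square[of t v] qform_rep_square[of h v] t h by simp
    also have "\<dots> = qform (\<rho> (t * t + h * h)) v"
      using t h(1) by (simp add: rep_add mult_in qform_add)
    finally have "(norm (bop_apply (\<rho> t) v))\<^sup>2 + (norm (bop_apply (\<rho> h) v))\<^sup>2 = (norm v)\<^sup>2"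
      by (simp add: h rep_one)
    then have "(norm (bop_apply (\<rho> t) v))\<^sup>2 \<le> (norm v)\<^sup>2"
      by (metis le_add_same_cancel1 zero_le_power2)
    then show "norm (bop_apply (\<rho> t) v) \<le> 1 * norm v"
      unfolding mult_1_left by (rule power2_le_imp_le) simp
  qed simp
  then show ?thesis
    by (subst s_t) (use t ns in \<open>simp add: rep_scaleR mult_left_le\<close>)
qed (simp add: rep_zero)

text \<open>
  If \<open>\<parallel>\<rho> s\<parallel>\<^sup>2 < r < 1\<close>, then \<open>y = (s\<^sup>2 - r) / 2\<close> has \<open>\<rho> y < 0\<close>, so \<open>\<rho>\<close> kills its positive part \<open>\<bar>y\<bar> + y\<close>;
  injectivity gives \<open>\<bar>y\<bar> = - y\<close>, that is \<open>s\<^sup>2 \<le> r\<close>, contradicting \<open>\<parallel>s\<parallel> = 1\<close>. Below, \<open>k = \<bar>y\<bar>\<close>.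
\<close>

lemma norm_rep_not_less_selfadjoint:
  assumes s: "s \<in> A" "star s = s" and n: "norm s = 1"
  shows "1 \<le> norm (\<rho> s)"
proof (rule ccontr)
  assume "\<not> 1 \<le> norm (\<rho> s)"
  then have "(norm (\<rho> s))\<^sup>2 < 1" by (simp add: abs_square_less_1)
  then obtain r where r: "(norm (\<rho> s))\<^sup>2 < r" "r < 1" using dense by blast
  have r0: "0 < r" by (rule le_less_trans[OF zero_le_power2 r(1)])
  \<comment> \<open>The factor 1/2 keeps \<open>y\<close> in the unit ball.\<close>
  define y where "y = (1/2) *\<^sub>R (s * s - r *\<^sub>R 1)"
  have yA: "y \<in> A" and ysa: "star y = y"
    by (auto simp: y_def star_scaleR star_diff star_mult s intro!: closed_intros)
  have "norm (s * s - r *\<^sub>R 1) \<le> norm (s * s) + norm (r *\<^sub>R (1::'a))" by (rule norm_triangle_ineq4)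
  also have "\<dots> \<le> 2" using norm_mult_ineq[of s s] n r r0 by simp
  finally have ny: "norm y \<le> 1" by (simp add: y_def)
  have nyy: "norm (y * y) \<le> 1"
    using norm_mult_ineq[of y y] mult_mono[OF ny ny] by simp
  define z where "z = 1 - y * y"
  \<comment> \<open>The auxiliary root serves to bound \<open>z\<close>: since
    \<open>g * g + y * y = 1\<close> with commuting self-adjoint terms, \<open>g\<close> and hence
    \<open>z = g * g\<close> have norm at most 1.\<close>
  define g where "g = sqrt_one_minus (y * y)"
  have g: "star g = g" "g * g = z" "g * y = y * g"
    using nyy ysa sqrt_one_minus_commute[OF nyy, of y]
    by (auto simp: g_def z_def sqrt_one_minus_square star_sqrt_one_minus star_mult mult.assoc)
  have "(norm g)\<^sup>2 \<le> norm (g * g + y * y)"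
    by (rule norm_square_le_sum_squares) (use g ysa in auto)
  also have "\<dots> = 1" by (simp add: g z_def)
  finally have "norm g * norm g \<le> 1" by (simp add: power2_eq_square)
  then have nz: "norm z \<le> 1" using norm_mult_ineq[of g g] by (simp add: g(2))
  define k where "k = sqrt_one_minus z"
  have zA: "z \<in> A" by (simp add: z_def closed_intros yA)
  have k: "k \<in> A" "k * k = y * y" "norm (1 - k) \<le> 1" "y * k = k * y"
    using nz zA norm_one_minus_sqrt_le[OF nz] sqrt_one_minus_commute[OF nz, of y]
    by (auto simp: k_def sqrt_one_minus_in sqrt_one_minus_square z_def algebra_simps)
  have ksa: "star k = k"
    unfolding k_def by (rule star_sqrt_one_minus[OF nz]) (simp add: z_def star_diff star_mult ysa)
  \<comment> \<open>The margin by which the form of \<rho>(y) stays below zero.\<close>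
  define \<delta> where "\<delta> = (r - (norm (\<rho> s))\<^sup>2) / 2"
  have \<delta>: "\<delta> > 0" using r by (simp add: \<delta>_def)
  have lower: "\<delta> * (norm u)\<^sup>2 \<le> qform (\<rho> (k - y)) u" for u
  proof -
    have "norm (\<rho> (1 - k)) \<le> norm (1 - k)"
      by (rule norm_rep_le_selfadjoint) (auto simp: star_diff ksa intro!: closed_intros k)
    then have "norm (\<rho> (1 - k)) \<le> 1" using k by linarith
    then have "\<bar>qform (\<rho> (1 - k)) u\<bar> \<le> 1 * (norm u)\<^sup>2"
      by (intro order_trans[OF abs_qform_le] mult_right_mono) auto
    then have 1: "0 \<le> qform (\<rho> k) u" using k by (simp add: rep_diff rep_one qform_diff)
    have "qform (\<rho> (star s * s)) u = (norm (bop_apply (\<rho> s) u))\<^sup>2"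
      by (rule qform_rep_square[OF s(1)])
    also have "\<dots> \<le> (norm (\<rho> s) * norm u)\<^sup>2"
      by (intro power_mono norm_bop_apply) simp
    finally have "qform (\<rho> (s * s)) u \<le> (norm (\<rho> s))\<^sup>2 * (norm u)\<^sup>2"
      by (simp add: s power_mult_distrib)
    moreover have "qform (\<rho> y) u = (qform (\<rho> (s * s)) u - r * (norm u)\<^sup>2) / 2"
      using s(1) by (simp add: y_def rep_scaleR rep_one rep_diff closed_intros qform_scaleR qform_diff)
    ultimately have "\<delta> * (norm u)\<^sup>2 \<le> - qform (\<rho> y) u"
      by (simp add: \<delta>_def left_diff_distrib)
    with 1 show ?thesis using k yA by (simp add: rep_diff qform_diff)
  qed
  have "\<rho> (k + y) = 0"
  proof (rule bop_eqI)
    fix v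
    define u where "u = bop_apply (\<rho> (k + y)) v"
    \<comment> \<open>Thus \<rho>(k - y) vanishes on the range of \<rho>(k + y); being bounded below
      by \<delta>, it forces that range to be zero.\<close>
    have "(k - y) * (k + y) = 0" by (simp add: algebra_simps k(2,4))
    moreover have "\<rho> ((k - y) * (k + y)) = \<rho> (k - y) * \<rho> (k + y)"
      by (intro rep_mult diff_in add_in k(1) yA)
    ultimately have "\<rho> (k - y) * \<rho> (k + y) = 0" by (simp add: rep_zero)
    then have "bop_apply (\<rho> (k - y)) u = 0"
      unfolding u_def by (metis bop_apply_mult bop_apply_zero_left)
    then have "\<delta> * (norm u)\<^sup>2 \<le> 0" using lower[of u] by (simp add: qform_def)
    then have "u = 0" using \<delta> by (simp add: mult_le_0_iff)
    then show "bop_apply (\<rho> (k + y)) v = bop_apply 0 v" by (simp add: u_def)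
  qed
  then have "k + y = 0" using rep_inj[of "k + y" 0] k(1) yA by (simp add: add_in rep_zero)
  then have k_eq: "k = - y" by (simp add: add_eq_0_iff2)
  \<comment> \<open>A root of \<open>k = - y\<close>, which is half of \<open>r - s * s\<close>. So
    \<open>s * s\<close> plus twice \<open>q * q\<close> is the scalar \<open>r\<close>, and the
    norm of \<open>s\<close> is at most the root of \<open>r\<close>.\<close>
  define q where "q = sqrt_one_minus (1 - k)"
  have "s * (1 - k) = (1 - k) * s" by (simp add: k_eq y_def algebra_simps)
  then have "s * q = q * s" unfolding q_def by (rule sqrt_one_minus_commute[OF k(3)])
  moreover have "star q = q" "q * q = k"
    unfolding q_def using k(3) ksa
    by (simp_all add: sqrt_one_minus_square star_sqrt_one_minus star_diff)
  ultimately have q: "star q = q" "q * q = k" "s * q = q * s" by simp_all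
  have "(norm s)\<^sup>2 \<le> norm (s * s + (sqrt 2 *\<^sub>R q) * (sqrt 2 *\<^sub>R q))"
    by (rule norm_square_le_sum_squares) (use s q in \<open>auto simp: star_scaleR\<close>)
  also have "s * s + (sqrt 2 *\<^sub>R q) * (sqrt 2 *\<^sub>R q) = r *\<^sub>R 1"
    by (simp add: q(2) k_eq y_def)
  finally show False using n r r0 by simp
qed

lemma norm_rep_selfadjoint:
  assumes s: "s \<in> A" "star s = s"
  shows "norm (\<rho> s) = norm s"
proof (cases "s = 0")
  case False
  then have ns: "norm s > 0" by simp
  have "1 \<le> norm (\<rho> ((1 / norm s) *\<^sub>R s))"
    using s ns by (intro norm_rep_not_less_selfadjoint) (auto simp: scaleR_in star_scaleR)
  then have "norm s \<le> norm (\<rho> s)"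
    using s ns by (simp add: rep_scaleR field_simps)
  with norm_rep_le_selfadjoint[OF s] show ?thesis by simp
qed (simp add: rep_zero)

text \<open>Dividing by the norm turns the root into one of the form
  \<open>sqrt_one_minus z\<close>. That \<open>z\<close> lies in the unit ball is checked on
  quadratic forms in the representation and carried back by isometry; the series then stays inside
  \<open>A\<close>.\<close>

lemma sqrt_exists:
  assumes p: "p \<in> A" "star p = p" and pos: "\<And>v. 0 \<le> qform (\<rho> p) v"
  shows "\<exists>h\<in>A. star h = h \<and> h * h = p"
proof (cases "p = 0")
  case False
  define c where "c = norm p"
  have c: "c > 0" using False by (simp add: c_def)
  define z where "z = 1 - (1 / c) *\<^sub>R p"
  have z: "z \<in> A" "star z = z" using p by (auto simp: z_def star_diff star_scaleR intro!: closed_intros)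
  have "norm (\<rho> z) \<le> 1"
  proof (rule norm_le_if_qform_le)
    show "star (\<rho> z) = \<rho> z" using z by (metis rep_star)
    fix v
    have "qform (\<rho> p) v \<le> c * (norm v)\<^sup>2"
      using abs_qform_le[of "\<rho> p" v] norm_rep_selfadjoint[OF p] by (simp add: c_def)
    then have "(1 / c) * qform (\<rho> p) v \<le> (norm v)\<^sup>2" using c by (simp add: field_simps)
    moreover have "0 \<le> (1 / c) * qform (\<rho> p) v" using c pos by simp
    ultimately show "\<bar>qform (\<rho> z) v\<bar> \<le> 1 * (norm v)\<^sup>2"
      using p by (simp add: z_def rep_simps closed_intros qform_diff qform_scaleR)
  qed simp
  then have nz: "norm z \<le> 1" using norm_rep_selfadjoint[OF z] by simp
  show ?thesis
  proof (intro bexI conjI)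
    show "sqrt c *\<^sub>R sqrt_one_minus z \<in> A" using z nz by (simp add: scaleR_in sqrt_one_minus_in)
    show "star (sqrt c *\<^sub>R sqrt_one_minus z) = sqrt c *\<^sub>R sqrt_one_minus z"
      using z nz by (simp add: star_scaleR star_sqrt_one_minus)
    show "(sqrt c *\<^sub>R sqrt_one_minus z) * (sqrt c *\<^sub>R sqrt_one_minus z) = p"
      using nz c by (simp add: sqrt_one_minus_square) (simp add: z_def)
  qed
qed (auto intro!: bexI[of _ 0])

text \<open>A positive lower bound makes \<open>p\<close>, up to scaling, a perturbation of 1 by an
  element of norm less than 1, so the Neumann series converges in \<open>A\<close>.\<close>

lemma inverse_exists:
  assumes p: "p \<in> A" "star p = p" and \<delta>: "0 < \<delta>" and pos: "\<And>v. \<delta> * (norm v)\<^sup>2 \<le> qform (\<rho> p) v"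
  shows "\<exists>q\<in>A. p * q = 1 \<and> q * p = 1 \<and> star q = q"
proof -
  \<comment> \<open>Adding \<delta> guarantees at once \<open>c > 0\<close>, that \<open>c\<close>
    dominates the form of \<open>p\<close>, and that \<open>\<delta> / c\<close> is at most
    1.\<close>
  define c where "c = norm p + \<delta>"
  have c: "c > 0" "norm p \<le> c" "\<delta> \<le> c" using \<delta> by (auto simp: c_def add_nonneg_pos)
  define t where "t = 1 - (1 / c) *\<^sub>R p"
  have t: "t \<in> A" "star t = t" using p by (auto simp: t_def star_diff star_scaleR intro!: closed_intros)
  have "norm (\<rho> t) \<le> 1 - \<delta> / c"
  proof (rule norm_le_if_qform_le)
    show "star (\<rho> t) = \<rho> t" using t by (metis rep_star)
    show "0 \<le> 1 - \<delta> / c" using c by simp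
    fix v
    have "qform (\<rho> p) v \<le> norm p * (norm v)\<^sup>2"
      using abs_qform_le[of "\<rho> p" v] norm_rep_selfadjoint[OF p] by simp
    also have "\<dots> \<le> c * (norm v)\<^sup>2" using c by (intro mult_right_mono) auto
    finally have "(1 / c) * qform (\<rho> p) v \<le> (norm v)\<^sup>2" using c by (simp add: field_simps)
    moreover have "(\<delta> / c) * (norm v)\<^sup>2 \<le> (1 / c) * qform (\<rho> p) v"
      using pos[of v] c by (simp add: field_simps)
    moreover have "0 \<le> (1 - \<delta> / c) * (norm v)\<^sup>2" using c by (intro mult_nonneg_nonneg) auto
    moreover have "qform (\<rho> t) v = (norm v)\<^sup>2 - (1 / c) * qform (\<rho> p) v"
      using p by (simp add: t_def rep_simps closed_intros qform_diff qform_scaleR)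
    ultimately show "\<bar>qform (\<rho> t) v\<bar> \<le> (1 - \<delta> / c) * (norm v)\<^sup>2"
      by (simp add: left_diff_distrib)
  qed
  then have nt: "norm t < 1"
    using norm_rep_selfadjoint[OF t] c \<delta> by (auto intro: le_less_trans[of _ "1 - \<delta> / c"])
  have sm: "summable (\<lambda>k. t ^ k)" by (rule complete_algebra_summable_geometric[OF nt])
  define g where "g = (\<Sum>k. t ^ k)"
  have gs: "(\<lambda>k. t ^ k) sums g" unfolding g_def by (rule summable_sums[OF sm])
  have gA: "g \<in> A" by (rule sums_in_closed_subspace[OF subspace closed gs]) (intro closed_intros t)
  have "(\<lambda>k. star (t ^ k)) sums star g" by (rule bounded_linear.sums[OF bounded_linear_star gs])
  then have gsa: "star g = g" using gs by (simp add: star_power t sums_unique2)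
  have Suc: "(\<lambda>k. t ^ Suc k) sums (g - 1)" using gs by (subst sums_Suc_iff) simp
  have "t * g = g - 1"
    using sums_mult[OF gs, of t] Suc by (simp add: sums_unique2)
  moreover have "g * t = g - 1"
    using sums_mult2[OF gs, of t] Suc by (simp add: sums_unique2 power_commutes)
  moreover have p_t: "p = c *\<^sub>R (1 - t)" using c by (simp add: t_def)
  moreover have "(1 - t) * g = 1" "g * (1 - t) = 1"
    using calculation(1,2) by (simp_all add: left_diff_distrib right_diff_distrib)
  ultimately have "p * ((1 / c) *\<^sub>R g) = 1" "((1 / c) *\<^sub>R g) * p = 1"
    using c by simp_all
  then show ?thesis
    using gA gsa by (intro bexI[of _ "(1 / c) *\<^sub>R g"]) (auto simp: scaleR_in star_scaleR)
qed

end

section \<open>Wandering words in a Cuntz family\<close>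

text \<open>Fubini for the double series, whose joint summability follows from the square
  summability of both tensors.\<close>

lemma cinner_ell2_tensor:
  "cinner (ell2_tensor x y) (ell2_tensor x' y') = cinner x x' * cinner y y'"
proof transfer
  fix f f' :: "'a \<Rightarrow> complex" and g g' :: "'b \<Rightarrow> complex"
  assume f: "(\<lambda>i. (cmod (f i))\<^sup>2) summable_on UNIV" "(\<lambda>i. (cmod (f' i))\<^sup>2) summable_on UNIV"
    and g: "(\<lambda>i. (cmod (g i))\<^sup>2) summable_on UNIV" "(\<lambda>i. (cmod (g' i))\<^sup>2) summable_on UNIV"
  let ?F = "\<lambda>p. cnj (case p of (i, j) \<Rightarrow> f i * g j) * (case p of (i, j) \<Rightarrow> f' i * g' j)"
  have tensor: "(\<lambda>p. (cmod (case p of (i, j) \<Rightarrow> u i * v j))\<^sup>2) summable_on UNIV"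
    if "(\<lambda>i. (cmod (u i))\<^sup>2) summable_on UNIV" "(\<lambda>i. (cmod (v i))\<^sup>2) summable_on UNIV"
    for u :: "'a \<Rightarrow> complex" and v :: "'b \<Rightarrow> complex"
    using ell2_nth[of "ell2_tensor (Abs_ell2 u) (Abs_ell2 v)"] that
    by (simp add: ell2_tensor.rep_eq Abs_ell2_inverse)
  have "?F summable_on UNIV \<times> UNIV"
    unfolding UNIV_Times_UNIV by (intro ell2_cinner_summable tensor f g)
  from infsum_Sigma_banach[OF this]
  have "infsum ?F UNIV = (\<Sum>\<^sub>\<infinity>i. \<Sum>\<^sub>\<infinity>j. ?F (i, j))"
    unfolding UNIV_Times_UNIV by (rule sym)
  also have "\<dots> = (\<Sum>\<^sub>\<infinity>i. \<Sum>\<^sub>\<infinity>j. (cnj (f i) * f' i) * (cnj (g j) * g' j))"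
    by (intro infsum_cong) (simp add: mult_ac)
  also have "\<dots> = (\<Sum>\<^sub>\<infinity>i. (cnj (f i) * f' i) * (\<Sum>\<^sub>\<infinity>j. cnj (g j) * g' j))"
    by (simp only: infsum_cmult_right')
  also have "\<dots> = (\<Sum>\<^sub>\<infinity>i. cnj (f i) * f' i) * (\<Sum>\<^sub>\<infinity>j. cnj (g j) * g' j)"
    by (simp only: infsum_cmult_left')
  finally show "infsum ?F UNIV = (\<Sum>\<^sub>\<infinity>i. cnj (f i) * f' i) * (\<Sum>\<^sub>\<infinity>j. cnj (g j) * g' j)" .
qed

lemma cinner_isometry:
  assumes "star S * S = 1"
  shows "cinner (bop_apply S x) (bop_apply S y) = cinner x y"
  using assms by (metis bop_apply_mult bop_apply_one cinner_star_bop')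

text \<open>Evaluate the sum of the range projections, which is 1, at the vector
  \<open>U j y\<close>: the summand of index \<open>j\<close> alone already gives the full squared
  length, so all others vanish.\<close>

lemma cuntz_family_ranges_orthogonal:
  fixes U :: "nat \<Rightarrow> 'h::chilbert_space bop"
  assumes U: "cuntz_family n U" and ij: "i \<in> {1..n}" "j \<in> {1..n}" "i \<noteq> j"
  shows "cinner (bop_apply (U i) x) (bop_apply (U j) y) = 0"
proof -
  have iso: "star (U k) * U k = 1" if "k \<in> {1..n}" for k
    using U that by (simp add: cuntz_family_def)
  let ?t = "\<lambda>k. (norm (bop_apply (star (U k)) (bop_apply (U j) y)))\<^sup>2"
  have "(norm y)\<^sup>2 = qform 1 (bop_apply (U j) y)"
    using qform_square[of "U j" y] iso[OF ij(2)] by simp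
  also have "\<dots> = (\<Sum>k=1..n. qform (U k * star (U k)) (bop_apply (U j) y))"
    using U by (simp only: cuntz_family_def qform_sum[symmetric])
  also have "\<dots> = (\<Sum>k=1..n. ?t k)"
    by (intro sum.cong refl) (metis qform_square star_star)
  also have "\<dots> = ?t j + ?t i + (\<Sum>k\<in>{1..n} - {j} - {i}. ?t k)"
    using ij sum.remove[of "{1..n}" j ?t] sum.remove[of "{1..n} - {j}" i ?t] by simp
  also have "?t j = (norm y)\<^sup>2"
    using iso[OF ij(2)] by (simp add: bop_apply_one flip: bop_apply_mult)
  finally have "?t i + (\<Sum>k\<in>{1..n} - {j} - {i}. ?t k) = 0" by simp
  moreover have "0 \<le> (\<Sum>k\<in>{1..n} - {j} - {i}. ?t k)" by (intro sum_nonneg) simp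
  ultimately have "?t i \<le> 0" by linarith
  then have "bop_apply (star (U i)) (bop_apply (U j) y) = 0" by simp
  then show ?thesis by (metis cinner_star_bop' cinner_zero_right)
qed

definition word_apply :: "(nat \<Rightarrow> 'h::chilbert_space bop) \<Rightarrow> nat list \<Rightarrow> 'h \<Rightarrow> 'h" where
  "word_apply U w x = foldr (\<lambda>i. bop_apply (U i)) w x"

lemma word_apply_simps [simp]:
  "word_apply U [] x = x"
  "word_apply U (i # w) x = bop_apply (U i) (word_apply U w x)"
  "word_apply U (v @ w) x = word_apply U v (word_apply U w x)"
  by (simp_all add: word_apply_def)

lemma cinner_word_apply_self:
  assumes "cuntz_family n U" "set v \<subseteq> {1..n}"
  shows "cinner (word_apply U v x) (word_apply U v y) = cinner x y"
  using assms(2)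
  by (induction v) (use assms(1) in \<open>simp_all add: cuntz_family_def cinner_isometry\<close>)

text \<open>Isometries strip the common prefix; at the first differing letter the ranges are
  orthogonal.\<close>

lemma cinner_word_apply_incomparable:
  assumes U: "cuntz_family n U" and "set v \<subseteq> {1..n}" "set w \<subseteq> {1..n}"
    and "\<And>r. w \<noteq> v @ r" "\<And>r. v \<noteq> w @ r"
  shows "cinner (word_apply U v x) (word_apply U w y) = 0"
  using assms(2-)
proof (induction v arbitrary: w)
  case (Cons i v)
  obtain j w' where w: "w = j # w'" using Cons.prems(4)[of "i # v"] by (cases w) auto
  show ?case
  proof (cases "i = j")
    case True
    have "star (U j) * U j = 1" using U Cons.prems(2) by (simp add: cuntz_family_def w)
    then show ?thesis
      using Cons.IH[of w'] Cons.prems by (simp add: w True cinner_isometry)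
  next
    case False
    then show ?thesis
      using cuntz_family_ranges_orthogonal[OF U _ _ False] Cons.prems by (simp add: w)
  qed
qed auto

definition words :: "nat \<Rightarrow> nat \<Rightarrow> nat list set" where
  "words n L = {v. set v \<subseteq> {1..n} \<and> length v \<le> L}"

lemma finite_words [simp]: "finite (words n L)"
  unfolding words_def by (rule finite_lists_length_le) simp

lemma Nil_in_words [simp]: "[] \<in> words n L"
  by (simp add: words_def)

text \<open>
  The word \<open>1\<dots>12\<close> with \<open>L\<close> ones has no period of length at most \<open>L\<close>, hence its range is wandering
  up to level \<open>L\<close>: the truncated Fock representation embeds into every Cuntz family.
\<close>

lemma cuntz_family_orthonormal_words:
  fixes U :: "nat \<Rightarrow> 'h::chilbert_space bop"
  assumes U: "cuntz_family n U" and n: "2 \<le> n"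
  shows "\<exists>x. \<forall>v\<in>words n L. \<forall>w\<in>words n L.
    cinner (word_apply U v x) (word_apply U w x) = of_bool (v = w)"
proof -
  obtain h :: 'h where "h \<noteq> 0" using chilbert_nontrivial by blast
  define e where "e = (1 / norm h) *\<^sub>R h"
  have "norm e = 1" using \<open>h \<noteq> 0\<close> by (simp add: e_def)
  then have e: "cinner e e = 1" by (simp add: cinner_self)
  define z :: "nat list" where "z = replicate L 1 @ [2]"
  have z: "set z \<subseteq> {1..n}" using n by (auto simp: z_def)
  have no: "w @ z \<noteq> (v @ z) @ r" if "v \<noteq> w" "length w \<le> L" for v w r
  proof
    assume eq: "w @ z = (v @ z) @ r"
    from arg_cong[OF this, of length] have "length w = length v + length r" by simp
    moreover have "length w \<noteq> length v" using eq that(1) by auto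
    ultimately have len: "length v < length w" by simp
    \<comment> \<open>At this position the left word is still inside the block of ones, because
      \<open>v\<close> is shorter than \<open>w\<close> and \<open>w\<close> has length at most
      \<open>L\<close>, while the right word has reached the final 2 of \<open>z\<close>.\<close>
    have "(w @ z) ! (length v + L) = 1"
      using len that(2) by (simp add: nth_append z_def)
    moreover have "((v @ z) @ r) ! (length v + L) = 2"
      by (simp add: nth_append z_def)
    ultimately show False using eq by simp
  qed
  show ?thesis
  proof (intro exI ballI)
    fix v w assume vw: "v \<in> words n L" "w \<in> words n L"
    show "cinner (word_apply U v (word_apply U z e)) (word_apply U w (word_apply U z e)) = of_bool (v = w)"
    proof (cases "v = w")
      case True
      then show ?thesis
        using vw z e by (simp add: cinner_word_apply_self[OF U] words_def)
    next
      case False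
      have "cinner (word_apply U (v @ z) e) (word_apply U (w @ z) e) = 0"
        using vw z no[of v w] no[of w v] False
        by (intro cinner_word_apply_incomparable[OF U]) (auto simp: words_def)
      then show ?thesis using False by simp
    qed
  qed
qed

lemma cinner_tensor_sum:
  "cinner (\<Sum>v\<in>W. ell2_tensor (\<xi> v) (f v)) (bop_apply (bop_tensor S T) (\<Sum>w\<in>W. ell2_tensor (\<xi> w) (f w))) =
    (\<Sum>v\<in>W. \<Sum>w\<in>W. cinner (\<xi> v) (bop_apply S (\<xi> w)) * cinner (f v) (bop_apply T (f w)))"
proof -
  have sum: "bop_apply R (\<Sum>w\<in>W. g w) = (\<Sum>w\<in>W. bop_apply R (g w))"
    for R :: "('a \<times> 'b) ell2 bop" and g
    by (rule linear_sum[OF bounded_linear.linear[OF bounded_linear_bop_apply]])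
  show ?thesis
    by (simp add: sum bop_tensor_apply cinner_sum_left cinner_sum_right cinner_ell2_tensor)
      (rule sum.swap)
qed

text \<open>Test the operator on the sum of the tensors \<xi>(v) with f(v), where the \<xi>(v) are
  orthonormal and \<open>U j\<close> sends \<xi>(w) to the vector of the word \<open>j # w\<close>.
  Only pairs of a word and its tail then contribute off the diagonal.\<close>

lemma fock_form_lower_bound:
  fixes U :: "nat \<Rightarrow> 'i ell2 bop" and a :: "nat \<Rightarrow> 'j ell2 bop"
  assumes U: "cuntz_family n U" and n: "2 \<le> n"
    and lower: "\<And>g. s * (norm g)\<^sup>2 \<le> qform (bop_tensor 1 1 + (\<Sum>j=1..n. bop_tensor (U j) (star (a j)))
      + (\<Sum>j=1..n. bop_tensor (star (U j)) (a j))) g"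
  shows "s * (\<Sum>v\<in>words n L. (norm (f v))\<^sup>2) \<le> (\<Sum>v\<in>words n L. (norm (f v))\<^sup>2) +
    2 * (\<Sum>w\<in>words n L - {[]}. Re (cinner (bop_apply (star (a (hd w))) (f (tl w))) (f w)))"
proof -
  let ?W = "words n L"
  \<comment> \<open>One level more than \<open>L\<close>, since \<open>U j\<close> lengthens a word
    by one letter.\<close>
  obtain x where x: "\<And>v w. v \<in> words n (Suc L) \<Longrightarrow> w \<in> words n (Suc L) \<Longrightarrow>
      cinner (word_apply U v x) (word_apply U w x) = of_bool (v = w)"
    using cuntz_family_orthonormal_words[OF U n, of "Suc L"] by blast
  define \<xi> where "\<xi> v = word_apply U v x" for v
  have W_Suc: "v \<in> words n (Suc L)" if "v \<in> ?W" for v using that by (simp add: words_def)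
  have \<xi>: "cinner (\<xi> v) (\<xi> w) = of_bool (v = w)" if "v \<in> ?W" "w \<in> ?W" for v w
    using x[OF W_Suc W_Suc] that by (simp add: \<xi>_def)
  have U\<xi>: "cinner (\<xi> v) (bop_apply (U j) (\<xi> w)) = of_bool (v = j # w)"
    if "v \<in> ?W" "w \<in> ?W" "j \<in> {1..n}" for v w j
    using x[OF W_Suc[OF that(1)], of "j # w"] that by (auto simp: \<xi>_def words_def)
  define g where "g = (\<Sum>v\<in>?W. ell2_tensor (\<xi> v) (f v))"
  have "cinner g g = (\<Sum>v\<in>?W. \<Sum>w\<in>?W. of_bool (v = w) * cinner (f v) (f w))"
    unfolding g_def by (simp add: cinner_sum_left cinner_sum_right cinner_ell2_tensor \<xi>)
  also have "\<dots> = (\<Sum>v\<in>?W. cinner (f v) (f v))"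
    by (intro sum.cong refl) (simp add: of_bool_def if_distrib[of "\<lambda>c. c * _"] sum.delta' cong: if_cong)
  finally have "cinner g g = of_real (\<Sum>v\<in>?W. (norm (f v))\<^sup>2)"
    by (simp add: cinner_self)
  then have gg: "(norm g)\<^sup>2 = (\<Sum>v\<in>?W. (norm (f v))\<^sup>2)"
    unfolding cinner_self of_real_eq_iff .
  have one: "bop_tensor 1 1 = (1 :: ('i \<times> 'j) ell2 bop)"
    by (rule bop_eq_basisI)
      (metis bop_apply_one bop_tensor_apply ell2_basis_tensor surj_pair)
  let ?c = "\<lambda>w. Re (cinner (bop_apply (star (a (hd w))) (f (tl w))) (f w))"
  have "(\<Sum>j=1..n. cinner g (bop_apply (bop_tensor (U j) (star (a j))) g)) =
      (\<Sum>j=1..n. \<Sum>v\<in>?W. \<Sum>w\<in>?W. of_bool (v = j # w) * cinner (f v) (bop_apply (star (a j)) (f w)))"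
    unfolding g_def cinner_tensor_sum by (intro sum.cong refl) (simp add: U\<xi>)
  also have "\<dots> = (\<Sum>v\<in>?W. \<Sum>j=1..n. \<Sum>w\<in>?W. of_bool (v = j # w) * cinner (f v) (bop_apply (star (a j)) (f w)))"
    by (rule sum.swap)
  also have "\<dots> = (\<Sum>v\<in>?W. if v = [] then 0 else cinner (f v) (bop_apply (star (a (hd v))) (f (tl v))))"
  proof (intro sum.cong refl)
    fix v assume v: "v \<in> ?W"
    show "(\<Sum>j=1..n. \<Sum>w\<in>?W. of_bool (v = j # w) * cinner (f v) (bop_apply (star (a j)) (f w))) =
      (if v = [] then 0 else cinner (f v) (bop_apply (star (a (hd v))) (f (tl v))))"
    proof (cases v)
      case (Cons k u)
      then have ku: "k \<in> {1..n}" "u \<in> ?W" using v by (auto simp: words_def)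
      have "(\<Sum>j=1..n. \<Sum>w\<in>?W. of_bool (v = j # w) * cinner (f v) (bop_apply (star (a j)) (f w))) =
          (\<Sum>j=1..n. if j = k then (\<Sum>w\<in>?W. if w = u then cinner (f v) (bop_apply (star (a j)) (f w)) else 0) else 0)"
        by (intro sum.cong refl) (auto simp: Cons intro!: sum.cong sum.neutral)
      also have "\<dots> = cinner (f v) (bop_apply (star (a k)) (f u))"
        using ku by simp
      finally show ?thesis by (simp add: Cons)
    qed simp
  qed
  also have "\<dots> = (\<Sum>v\<in>?W - {[]}. cinner (f v) (bop_apply (star (a (hd v))) (f (tl v))))"
    by (rule sum.mono_neutral_cong_right) auto
  finally have U_sum: "(\<Sum>j=1..n. cinner g (bop_apply (bop_tensor (U j) (star (a j))) g)) =
    (\<Sum>v\<in>?W - {[]}. cinner (f v) (bop_apply (star (a (hd v))) (f (tl v))))" .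
  \<comment> \<open>The terms with adjoints are the conjugates of those already computed, whence the
    factor 2 and the real part.\<close>
  have star: "cinner g (bop_apply (bop_tensor (star (U j)) (a j)) g) =
      cnj (cinner g (bop_apply (bop_tensor (U j) (star (a j))) g))" for j
    unfolding g_def cinner_tensor_sum
    by (subst sum.swap) (simp add: cinner_star_bop' flip: cinner_commute)
  have "qform (bop_tensor 1 1 + (\<Sum>j=1..n. bop_tensor (U j) (star (a j)))
      + (\<Sum>j=1..n. bop_tensor (star (U j)) (a j))) g =
      (norm g)\<^sup>2 + 2 * Re (\<Sum>j=1..n. cinner g (bop_apply (bop_tensor (U j) (star (a j))) g))"
    unfolding qform_add one qform_one qform_sum unfolding qform_def star by simp
  also have "\<dots> = (norm g)\<^sup>2 + 2 * (\<Sum>w\<in>?W - {[]}. ?c w)"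
    unfolding U_sum by (simp add: Re_cinner_commute)
  finally show ?thesis using lower[of g] by (simp add: gg)
qed

section \<open>Iterated Schur complements\<close>

lemma sum_words_nonempty:
  "(\<Sum>w\<in>words n L - {[]}. F w) = (\<Sum>v\<in>{v\<in>words n L. length v < L}. \<Sum>k=1..n. F (k # v))"
proof -
  have "(\<Sum>v\<in>{v\<in>words n L. length v < L}. \<Sum>k=1..n. F (k # v)) =
      (\<Sum>(v, k)\<in>{v\<in>words n L. length v < L} \<times> {1..n}. F (k # v))"
    by (rule sum.cartesian_product)
  also have "\<dots> = (\<Sum>w\<in>words n L - {[]}. F w)"
    by (rule sum.reindex_bij_witness[where j = "\<lambda>(v, k). k # v" and i = "\<lambda>w. (tl w, hd w)"])
      (auto simp: words_def neq_Nil_conv)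
  finally show ?thesis ..
qed

text \<open>
  Eliminating the leaves of the tree of words one level at a time turns the quadratic form on words
  of length at most \<open>L\<close> into iterated Schur complements; \<open>f\<close> is the minimiser with value \<open>h\<close> at the
  root.
\<close>

lemma schur_chain_lower_bound:
  fixes B V a :: "nat \<Rightarrow> 'h::chilbert_space bop"
  assumes B0: "B 0 = \<tau> *\<^sub>R 1"
    and BS: "\<And>m. m < L \<Longrightarrow> B (Suc m) = \<tau> *\<^sub>R 1 - (\<Sum>j=1..n. a j * V m * star (a j))"
    and inv: "\<And>m. m < L \<Longrightarrow> B m * V m = 1"
    and lower: "\<And>f. \<delta> * (\<Sum>v\<in>words n L. (norm (f v))\<^sup>2) \<le> \<tau> * (\<Sum>v\<in>words n L. (norm (f v))\<^sup>2) +
      2 * (\<Sum>w\<in>words n L - {[]}. Re (cinner (bop_apply (star (a (hd w))) (f (tl w))) (f w)))"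
    and \<delta>: "0 \<le> \<delta>"
  shows "\<delta> * (norm h)\<^sup>2 \<le> qform (B L) h"
proof -
  let ?W = "words n L"
  \<comment> \<open>Given the value at the parent, the child takes the value that completes the
    square; \<open>L - Suc (length v)\<close> is the height of the tree below the child.\<close>
  define f where "f = rec_list h (\<lambda>k v fv. - bop_apply (V (L - Suc (length v))) (bop_apply (star (a k)) fv))"
  have f_Nil: "f [] = h" and f_Cons: "f (k # v) = - bop_apply (V (L - Suc (length v))) (bop_apply (star (a k)) (f v))" for k v
    by (simp_all add: f_def)
  \<comment> \<open>The minimal energy of the subtree rooted at \<open>w\<close>, with everything
    below \<open>w\<close> eliminated.\<close>
  define E where "E w = qform (B (L - length w)) (f w)" for w
  have child: "E (k # v) = qform (a k * V (L - Suc (length v)) * star (a k)) (f v)"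
    and edge: "Re (cinner (bop_apply (star (a k)) (f v)) (f (k # v))) = - E (k # v)"
    if "length v < L" for k v
  proof -
    let ?m = "L - Suc (length v)" and ?u = "bop_apply (star (a k)) (f v)"
    have "bop_apply (B ?m) (bop_apply (V ?m) ?u) = ?u"
      unfolding bop_apply_mult[symmetric, of _ _ ?u] using inv[of ?m] that by (simp add: bop_apply_one)
    then have E: "E (k # v) = Re (cinner (bop_apply (V ?m) ?u) ?u)"
      using bop_apply_diff[of "B ?m" 0 "bop_apply (V ?m) ?u"]
      by (simp add: E_def qform_def f_Cons cinner_minus_left cinner_minus_right)
    then show "E (k # v) = qform (a k * V ?m * star (a k)) (f v)"
      using qform_conj[of "star (a k)" "V ?m" "f v"]
      by (simp add: star_star qform_def Re_cinner_commute[of ?u])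
    show "Re (cinner ?u (f (k # v))) = - E (k # v)"
      unfolding E by (simp add: f_Cons cinner_minus_right Re_cinner_commute[of ?u])
  qed
  define X where "X = (\<Sum>w\<in>?W - {[]}. E w)"
  have "X = (\<Sum>v\<in>{v\<in>?W. length v < L}. \<Sum>k=1..n. E (k # v))"
    unfolding X_def by (rule sum_words_nonempty)
  also have "\<dots> = (\<Sum>v\<in>{v\<in>?W. length v < L}. \<tau> * (norm (f v))\<^sup>2 - E v)"
  proof (intro sum.cong refl)
    fix v assume v: "v \<in> {v\<in>?W. length v < L}"
    then have "L - length v = Suc (L - Suc (length v))" "L - Suc (length v) < L" by auto
    then have "E v = \<tau> * (norm (f v))\<^sup>2 - (\<Sum>k=1..n. qform (a k * V (L - Suc (length v)) * star (a k)) (f v))"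
      by (simp add: E_def BS qform_diff qform_scaleR qform_sum)
    then show "(\<Sum>k=1..n. E (k # v)) = \<tau> * (norm (f v))\<^sup>2 - E v"
      using v by (simp add: child)
  qed
  \<comment> \<open>Words of full length \<open>L\<close> may be added: there \<open>B 0\<close> is
    the scalar \<tau>, so their terms are zero.\<close>
  also have "\<dots> = (\<Sum>v\<in>?W. \<tau> * (norm (f v))\<^sup>2 - E v)"
  proof (rule sum.mono_neutral_left)
    show "\<forall>v\<in>?W - {v \<in> ?W. length v < L}. \<tau> * (norm (f v))\<^sup>2 - E v = 0"
    proof
      fix v assume "v \<in> ?W - {v \<in> ?W. length v < L}"
      then have "L - length v = 0" by auto
      then show "\<tau> * (norm (f v))\<^sup>2 - E v = 0" by (simp add: E_def B0 qform_scaleR)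
    qed
  qed auto
  finally have X_sum: "X = \<tau> * (\<Sum>v\<in>?W. (norm (f v))\<^sup>2) - (\<Sum>v\<in>?W. E v)"
    by (simp add: sum_subtractf sum_distrib_left)
  have E_sum: "(\<Sum>v\<in>?W. E v) = E [] + X"
    unfolding X_def by (rule sum.remove) simp_all
  have edges: "(\<Sum>w\<in>?W - {[]}. Re (cinner (bop_apply (star (a (hd w))) (f (tl w))) (f w))) = - X"
    unfolding X_def sum_words_nonempty by (simp add: edge sum_negf)
  have "\<delta> * (norm h)\<^sup>2 \<le> \<delta> * (\<Sum>v\<in>?W. (norm (f v))\<^sup>2)"
    using member_le_sum[of "[]" ?W "\<lambda>v. (norm (f v))\<^sup>2"] \<delta> by (intro mult_left_mono) (auto simp: f_Nil)
  \<comment> \<open>The form at \<open>f\<close> equals \<tau> times the squared length minus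
    \<open>2 * X\<close>; the two relations between \<open>X\<close> and the sum of all
    \<open>E\<close> reduce this to the energy at the root.\<close>
  also have "\<dots> \<le> E []"
    using lower[of f] X_sum E_sum edges by linarith
  finally show ?thesis by (simp add: E_def f_Nil)
qed

text \<open>A choice operator makes the recursion below total; it yields a true inverse once
  \<open>p\<close> is known to be self-adjoint and bounded below.\<close>

definition cstar_inverse :: "'a::cstar_algebra set \<Rightarrow> 'a \<Rightarrow> 'a" where
  "cstar_inverse A p = (SOME q. q \<in> A \<and> p * q = 1 \<and> q * p = 1 \<and> star q = q)"

primrec schur_seq :: "'a::cstar_algebra set \<Rightarrow> nat \<Rightarrow> (nat \<Rightarrow> 'a) \<Rightarrow> real \<Rightarrow> nat \<Rightarrow> 'a" where
  "schur_seq A n x \<tau> 0 = \<tau> *\<^sub>R 1"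
| "schur_seq A n x \<tau> (Suc m) =
    \<tau> *\<^sub>R 1 - (\<Sum>j=1..n. x j * cstar_inverse A (schur_seq A n x \<tau> m) * star (x j))"

context cstar_rep
begin

lemma cstar_inverse:
  assumes "p \<in> A" "star p = p" "0 < \<delta>" "\<And>v. \<delta> * (norm v)\<^sup>2 \<le> qform (\<rho> p) v"
  shows "cstar_inverse A p \<in> A" "p * cstar_inverse A p = 1" "cstar_inverse A p * p = 1"
    "star (cstar_inverse A p) = cstar_inverse A p"
  using someI_ex[OF inverse_exists[OF assms, unfolded Bex_def]]
  unfolding cstar_inverse_def by auto

end

text \<open>Replacing the constant term 1 by \<tau> changes the lower bound \<open>s\<close> into
  \<open>s + \<tau> - 1\<close>. The strict case uses \<open>s > 0\<close> with \<tau> below 1, the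
  von Neumann case \<open>s = 0\<close> with \<tau> above 1.\<close>

locale cstar_ell2_rep = cstar_rep A \<rho>
  for A :: "'a::cstar_algebra set" and \<rho> :: "'a \<Rightarrow> 'j ell2 bop" +
  fixes n :: nat and x :: "nat \<Rightarrow> 'a" and U :: "nat \<Rightarrow> 'i ell2 bop" and s \<tau> :: real
  assumes x: "\<And>j. j \<in> {1..n} \<Longrightarrow> x j \<in> A"
    and U: "cuntz_family n U" and n: "2 \<le> n"
    and lower: "\<And>g. s * (norm g)\<^sup>2 \<le> qform (bop_tensor 1 1 + (\<Sum>j=1..n. bop_tensor (U j) (\<rho> (star (x j))))
      + (\<Sum>j=1..n. bop_tensor (star (U j)) (\<rho> (x j)))) g"
    and slack: "0 < s + \<tau> - 1"
begin

abbreviation "b \<equiv> schur_seq A n x \<tau>"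
abbreviation "binv m \<equiv> cstar_inverse A (b m)"

text \<open>Strong induction: the lower bound at level \<open>m\<close> eliminates a tree of height
  \<open>m\<close>, which uses the inverses at all smaller levels; the bound itself comes from the
  Cuntz form and does not deteriorate with \<open>m\<close>.\<close>

lemma schur_seq_props:
  "b m \<in> A \<and> star (b m) = b m \<and> (\<forall>h. (s + \<tau> - 1) * (norm h)\<^sup>2 \<le> qform (\<rho> (b m)) h)"
proof (induction m rule: less_induct)
  case (less m)
  have inv: "binv k \<in> A" "b k * binv k = 1" "star (binv k) = binv k" if "k < m" for k
    using cstar_inverse[OF _ _ slack] less[OF that] by blast+
  have bk: "b k \<in> A \<and> star (b k) = b k" if "k \<le> m" for k
    using that
  proof (cases k)
    case (Suc l)
    then show ?thesis
      using inv[of l] that x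
      by (auto simp: star_diff star_scaleR star_sum star_mult star_star mult.assoc intro!: closed_intros)
  qed (auto simp: star_scaleR intro!: closed_intros)
  have "(s + \<tau> - 1) * (norm h)\<^sup>2 \<le> qform (\<rho> (b m)) h" for h
  proof (rule schur_chain_lower_bound[where B = "\<lambda>k. \<rho> (b k)" and V = "\<lambda>k. \<rho> (binv k)" and a = "\<lambda>j. \<rho> (x j)"])
    show "\<rho> (b 0) = \<tau> *\<^sub>R 1" by (simp add: rep_scaleR rep_one)
    fix k assume k: "k < m"
    show "\<rho> (b (Suc k)) = \<tau> *\<^sub>R 1 - (\<Sum>j = 1..n. \<rho> (x j) * \<rho> (binv k) * star (\<rho> (x j)))"
    proof -
      have "x j * binv k * star (x j) \<in> A" "\<rho> (x j * binv k * star (x j)) = \<rho> (x j) * \<rho> (binv k) * star (\<rho> (x j))"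
        if "j \<in> {1..n}" for j
        using inv[OF k] x[OF that] by (simp_all add: rep_mult rep_star closed_intros)
      note summand = this
      have "(\<Sum>j=1..n. x j * binv k * star (x j)) \<in> A"
        by (rule sum_in[OF summand(1)])
      moreover have "\<rho> (\<Sum>j=1..n. x j * binv k * star (x j)) =
          (\<Sum>j=1..n. \<rho> (x j) * \<rho> (binv k) * star (\<rho> (x j)))"
        by (rule trans[OF rep_sum sum.cong[OF refl]]) (fact summand)+
      ultimately show ?thesis
        unfolding schur_seq.simps by (subst rep_diff) (simp_all add: scaleR_in rep_scaleR rep_one)
    qed
    show "\<rho> (b k) * \<rho> (binv k) = 1"
      using inv[OF k] bk[of k] k by (simp add: rep_one flip: rep_mult)
  next
    fix f :: "nat list \<Rightarrow> 'j ell2"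
    let ?W = "words n m"
    have "s * (\<Sum>v\<in>?W. (norm (f v))\<^sup>2) \<le> (\<Sum>v\<in>?W. (norm (f v))\<^sup>2) +
        2 * (\<Sum>w\<in>?W - {[]}. Re (cinner (bop_apply (star (\<rho> (x (hd w)))) (f (tl w))) (f w)))"
    proof (rule fock_form_lower_bound[OF U n])
      fix g
      have "(\<Sum>j=1..n. bop_tensor (U j) (\<rho> (star (x j)))) = (\<Sum>j=1..n. bop_tensor (U j) (star (\<rho> (x j))))"
        by (intro sum.cong refl) (simp add: rep_star x)
      with lower[of g] show "s * (norm g)\<^sup>2 \<le> qform (bop_tensor 1 1
        + (\<Sum>j=1..n. bop_tensor (U j) (star (\<rho> (x j)))) + (\<Sum>j=1..n. bop_tensor (star (U j)) (\<rho> (x j)))) g"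
        by simp
    qed
    then show "(s + \<tau> - 1) * (\<Sum>v\<in>?W. (norm (f v))\<^sup>2) \<le> \<tau> * (\<Sum>v\<in>?W. (norm (f v))\<^sup>2) +
        2 * (\<Sum>w\<in>?W - {[]}. Re (cinner (bop_apply (star (\<rho> (x (hd w)))) (f (tl w))) (f w)))"
      by (simp add: algebra_simps)
  qed (use slack in simp)
  with bk show ?case by blast
qed

lemma schur_seq_in: "b m \<in> A" and star_schur_seq: "star (b m) = b m"
  and schur_seq_lower: "(s + \<tau> - 1) * (norm h)\<^sup>2 \<le> qform (\<rho> (b m)) h"
  using schur_seq_props by blast+

lemmas binv = cstar_inverse[OF schur_seq_in star_schur_seq slack schur_seq_lower]

end

section \<open>Positive arrow matrices\<close>

text \<open>A block Cholesky factor: first column \<open>e, w 1, ..., w n\<close>, then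
  \<open>d\<close> along the diagonal and zeros elsewhere.\<close>

lemma arrow_mat_factorization:
  fixes A :: "'a::cstar_algebra set"
  assumes A: "0 \<in> A" "d \<in> A" "e \<in> A" "\<And>j. j \<in> {1..n} \<Longrightarrow> w j \<in> A"
    and d: "star d = d" "d * d = b" and e: "star e = e" "e * e = a - (\<Sum>j=1..n. star (w j) * w j)"
    and w: "\<And>j. j \<in> {1..n} \<Longrightarrow> d * w j = star (x j)"
  shows "arrow_mat n a b x \<in> mat_pos_cone (n + 1) A"
proof -
  define Y where "Y = mat (n + 1) (n + 1) (\<lambda>(i, j).
    if i = 0 then (if j = 0 then e else 0) else if j = 0 then w i else if i = j then d else 0)"
  have Y: "Y \<in> mat_algebra (n + 1) A"
    using A by (auto simp: mat_algebra_def Y_def elements_mat_def less_Suc_eq_le Suc_le_eq split: if_splits)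
  have split: "(\<Sum>k = 0..<n + 1. F k) = F 0 + (\<Sum>k=1..n. F k)" for F :: "nat \<Rightarrow> 'a"
    using sum.atLeast_Suc_atMost[of 0 n F] by (simp add: atLeastLessThanSuc_atLeastAtMost)
  have "mat_star Y * Y = arrow_mat n a b x"
  proof (rule eq_matI)
    fix i j assume "i < dim_row (arrow_mat n a b x)" "j < dim_col (arrow_mat n a b x)"
    then have ij: "i < n + 1" "j < n + 1" by (simp_all add: arrow_mat_def)
    have "(mat_star Y * Y) $$ (i, j) = (\<Sum>k = 0..<n + 1. star (Y $$ (k, i)) * Y $$ (k, j))"
      using ij by (simp add: mat_star_def scalar_prod_def Y_def)
    also have "\<dots> = star (Y $$ (0, i)) * Y $$ (0, j) + (\<Sum>k=1..n. star (Y $$ (k, i)) * Y $$ (k, j))"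
      by (rule split)
    also have "\<dots> = arrow_mat n a b x $$ (i, j)"
    proof (cases "i = 0")
      case True
      show ?thesis
      proof (cases "j = 0")
        case True
        then show ?thesis
          using \<open>i = 0\<close> e by (simp add: Y_def arrow_mat_def)
      next
        case False
        then have "(\<Sum>k=1..n. star (Y $$ (k, i)) * Y $$ (k, j)) = (\<Sum>k=1..n. if k = j then star (w j) * d else 0)"
          using \<open>i = 0\<close> ij by (intro sum.cong) (auto simp: Y_def)
        also have "\<dots> = star (d * w j)" using False ij by (simp add: star_mult d)
        also have "\<dots> = x j" using False ij w[of j] by (simp add: star_star)
        finally show ?thesis using False \<open>i = 0\<close> ij by (simp add: Y_def arrow_mat_def)
      qed
    next
      case False
      then have "(\<Sum>k=1..n. star (Y $$ (k, i)) * Y $$ (k, j)) = (\<Sum>k=1..n. if k = i then d * Y $$ (i, j) else 0)"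
        using ij d by (intro sum.cong) (auto simp: Y_def)
      also have "\<dots> = d * Y $$ (i, j)" using False ij by simp
      finally show ?thesis using False ij w[of i] d by (simp add: Y_def arrow_mat_def)
    qed
    finally show "(mat_star Y * Y) $$ (i, j) = arrow_mat n a b x $$ (i, j)" .
  qed (simp_all add: mat_star_def Y_def arrow_mat_def)
  with Y show ?thesis
    unfolding mat_pos_cone_def mem_Collect_eq by (intro exI[of _ Y]) simp
qed

text \<open>Subtracting a multiple of the identity matrix preserves the arrow shape.\<close>

lemma arrow_mat_strict_posI:
  fixes A :: "'a::cstar_algebra set"
  assumes A: "unital_cstar_subalgebra A" "a \<in> A" "b \<in> A" "\<And>j. j \<in> {1..n} \<Longrightarrow> x j \<in> A"
    and \<epsilon>: "0 < \<epsilon>" "arrow_mat n (a - \<epsilon> *\<^sub>R 1) (b - \<epsilon> *\<^sub>R 1) x \<in> mat_pos_cone (n + 1) A"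
  shows "arrow_mat n a b x \<in> mat_strict_pos_cone (n + 1) A"
proof -
  interpret cstar_subalgebra A by standard (rule A(1))
  have "arrow_mat n a b x - of_real \<epsilon> \<cdot>\<^sub>m 1\<^sub>m (n + 1) = arrow_mat n (a - \<epsilon> *\<^sub>R 1) (b - \<epsilon> *\<^sub>R 1) x"
    by (rule eq_matI) (auto simp: arrow_mat_def of_real_def)
  moreover have "arrow_mat n a b x \<in> mat_algebra (n + 1) A"
    using assms(2-4) by (auto simp: mat_algebra_def arrow_mat_def elements_mat_def less_Suc_eq_le Suc_le_eq star_in)
  ultimately show ?thesis
    unfolding mat_strict_pos_cone_def using \<epsilon> by auto
qed

text \<open>The quadratic form of the arrow matrix at the column with entries
  \<open>h, f 1, ..., f n\<close>.\<close>

definition arrow_form ::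
    "nat \<Rightarrow> 'h::chilbert_space bop \<Rightarrow> 'h bop \<Rightarrow> (nat \<Rightarrow> 'h bop) \<Rightarrow> 'h \<Rightarrow> (nat \<Rightarrow> 'h) \<Rightarrow> real" where
  "arrow_form n a b x h f =
    qform a h + 2 * (\<Sum>j=1..n. Re (cinner h (bop_apply (x j) (f j)))) + (\<Sum>j=1..n. qform b (f j))"

text \<open>Completing the square in each \<open>f j\<close> separately.\<close>

lemma arrow_form_schur_complement:
  assumes q: "p * q = 1" "star p = p" "star q = q"
  shows "arrow_form n a p x h f = qform (a - (\<Sum>j=1..n. x j * q * star (x j))) h
    + (\<Sum>j=1..n. qform p (f j + bop_apply q (bop_apply (star (x j)) h)))"
proof -
  have "qform p (f j + bop_apply q (bop_apply (star (x j)) h)) =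
      qform p (f j) + 2 * Re (cinner h (bop_apply (x j) (f j))) + qform (x j * q * star (x j)) h" for j
  proof -
    let ?u = "bop_apply (star (x j)) h"
    have pq: "bop_apply p (bop_apply q ?u) = ?u"
      by (metis bop_apply_mult bop_apply_one q(1))
    have "Re (cinner (bop_apply q ?u) (bop_apply p (f j))) = Re (cinner ?u (f j))"
      by (metis cinner_star_bop pq q(2))
    moreover have "cinner ?u (f j) = cinner h (bop_apply (x j) (f j))"
      by (rule cinner_star_bop)
    moreover have "qform (x j * q * star (x j)) h = Re (cinner (bop_apply q ?u) ?u)"
      using qform_conj[of "star (x j)" q h] by (simp add: star_star qform_def Re_cinner_commute[of ?u])
    ultimately show ?thesis
      using Re_cinner_commute[of "f j" ?u]
      by (simp add: qform_def bop_apply_add pq cinner_add_left cinner_add_right)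
  qed
  then show ?thesis
    by (simp add: arrow_form_def qform_diff qform_sum sum.distrib sum_distrib_left)
qed

section \<open>Positivity tests through quadratic forms\<close>

context cstar_rep
begin

lemma pos_coneI:
  assumes "p \<in> A" "star p = p" "\<And>v. 0 \<le> qform (\<rho> p) v"
  shows "p \<in> pos_cone A"
  using sqrt_exists[OF assms] unfolding pos_cone_def by force

lemma strict_pos_coneI:
  assumes "p \<in> A" "star p = p" "0 < \<epsilon>" "\<And>v. \<epsilon> * (norm v)\<^sup>2 \<le> qform (\<rho> p) v"
  shows "p \<in> strict_pos_cone A"
proof -
  have "p - \<epsilon> *\<^sub>R 1 \<in> pos_cone A"
    using assms by (intro pos_coneI)
      (auto simp: star_diff star_scaleR rep_diff rep_scaleR rep_one scaleR_in qform_diff qform_scaleR intro!: diff_in)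
  with assms show ?thesis unfolding strict_pos_cone_def by blast
qed

lemma qform_rep_pos_cone: "p \<in> pos_cone A \<Longrightarrow> 0 \<le> qform (\<rho> p) v"
  unfolding pos_cone_def using qform_rep_square by auto

text \<open>With \<open>b\<close> invertible the Cholesky factor is explicit: \<open>d\<close> is
  the root of \<open>b\<close>, and \<open>w j\<close> is \<open>d\<close> times the inverse of
  \<open>b\<close> times \<open>star (x j)\<close>. The remaining corner entry is a root of the
  Schur complement.\<close>

lemma arrow_mat_posI:
  assumes A: "a \<in> A" "b \<in> A" "\<And>j. j \<in> {1..n} \<Longrightarrow> x j \<in> A" and sa: "star a = a" "star b = b"
    and \<delta>: "0 < \<delta>" "\<And>v. \<delta> * (norm v)\<^sup>2 \<le> qform (\<rho> b) v"
    and pos: "\<And>h f. 0 \<le> arrow_form n (\<rho> a) (\<rho> b) (\<lambda>j. \<rho> (x j)) h f"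
  shows "arrow_mat n a b x \<in> mat_pos_cone (n + 1) A"
proof -
  define q where "q = cstar_inverse A b"
  note q = cstar_inverse[OF A(2) sa(2) \<delta>, folded q_def]
  have "0 \<le> qform (\<rho> b) v" for v
    using \<delta>(2)[of v] \<delta>(1) by (meson dual_order.trans less_imp_le mult_nonneg_nonneg zero_le_power2)
  then obtain d where d: "d \<in> A" "star d = d" "d * d = b"
    using sqrt_exists[OF A(2) sa(2)] by blast
  define w where "w j = d * q * star (x j)" for j
  have wA: "w j \<in> A" if "j \<in> {1..n}" for j
    using d q A that by (auto simp: w_def intro!: closed_intros)
  have ww: "star (w j) * w j = x j * q * star (x j)" for j
  proof -
    have "star (w j) * w j = x j * (q * (d * d)) * q * star (x j)"
      by (simp only: w_def star_mult star_star d(2) q(4) mult.assoc)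
    then show ?thesis by (simp add: d q)
  qed
  define r where "r = a - (\<Sum>j=1..n. star (w j) * w j)"
  have sum: "(\<Sum>j=1..n. star (w j) * w j) \<in> A"
    using wA by (auto intro!: closed_intros)
  have rho_sum: "\<rho> (\<Sum>j=1..n. star (w j) * w j) = (\<Sum>j=1..n. \<rho> (x j) * \<rho> q * star (\<rho> (x j)))"
    using A q unfolding ww
    by (intro trans[OF rep_sum sum.cong[OF refl]]) (auto simp: rep_mult rep_star closed_intros)
  have rA: "r \<in> A" "star r = r"
    using A sum sa by (auto simp: r_def star_diff star_sum star_mult star_star intro!: diff_in)
  have "0 \<le> qform (\<rho> r) h" for h
  proof -
    \<comment> \<open>This choice of \<open>f\<close> makes every completed square vanish, so the
      form equals that of the Schur complement.\<close>
    have "0 \<le> arrow_form n (\<rho> a) (\<rho> b) (\<lambda>j. \<rho> (x j)) h (\<lambda>j. - bop_apply (\<rho> q) (bop_apply (star (\<rho> (x j))) h))"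
      by (rule pos)
    also have "\<dots> = qform (\<rho> a - (\<Sum>j=1..n. \<rho> (x j) * \<rho> q * star (\<rho> (x j)))) h"
      using A q sa
      by (subst arrow_form_schur_complement[where q = "\<rho> q"])
        (simp_all add: qform_def rep_one flip: rep_mult rep_star)
    also have "\<dots> = qform (\<rho> r) h"
      unfolding r_def rep_diff[OF A(1) sum] rho_sum ..
    finally show ?thesis .
  qed
  then obtain e where e: "e \<in> A" "star e = e" "e * e = r"
    using sqrt_exists[OF rA] by blast
  show ?thesis
  proof (rule arrow_mat_factorization)
    show "d * w j = star (x j)" for j
    proof -
      have "d * w j = (d * d) * q * star (x j)" by (simp only: w_def mult.assoc)
      then show ?thesis by (simp add: d q)
    qed
  qed (use d e wA in \<open>auto simp: r_def\<close>)
qed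

end

section \<open>Averaged Schur complements: the strict case\<close>

context cstar_ell2_rep
begin

text \<open>By the recursion the corner cancels exactly against its Schur correction, so only the
  completed squares remain.\<close>

lemma schur_seq_arrow_form:
  "0 \<le> arrow_form n (\<rho> (\<tau> *\<^sub>R 1 - b (Suc m))) (\<rho> (b m)) (\<lambda>j. \<rho> (x j)) h f"
proof -
  have "\<rho> (\<Sum>j=1..n. x j * binv m * star (x j)) = (\<Sum>j=1..n. \<rho> (x j) * \<rho> (binv m) * star (\<rho> (x j)))"
    using x binv by (intro trans[OF rep_sum sum.cong[OF refl]]) (auto simp: rep_mult rep_star closed_intros)
  then have "arrow_form n (\<rho> (\<tau> *\<^sub>R 1 - b (Suc m))) (\<rho> (b m)) (\<lambda>j. \<rho> (x j)) h f =
    (\<Sum>j=1..n. qform (\<rho> (b m)) (f j + bop_apply (\<rho> (binv m)) (bop_apply (star (\<rho> (x j))) h)))"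
    using binv[of m] schur_seq_in[of m] star_schur_seq[of m]
    by (subst arrow_form_schur_complement[where q = "\<rho> (binv m)"]) (simp_all add: rep_one flip: rep_mult rep_star)
  also have "\<dots> \<ge> 0"
    using slack by (intro sum_nonneg order_trans[OF _ schur_seq_lower]) simp
  finally show ?thesis .
qed

lemma strict_arrow_exists:
  assumes s: "0 < s" "s \<le> 1" and \<tau>: "\<tau> = 1 - s / 2"
  shows "\<exists>a\<in>strict_pos_cone A. \<exists>b\<in>strict_pos_cone A.
    a + b = 1 \<and> arrow_mat n a b x \<in> mat_strict_pos_cone (n + 1) A"
proof -
  \<comment> \<open>The slack \<open>1 - \<tau>\<close> is \<open>s / 2\<close>; the telescoping
    error, at most \<open>1 / N\<close>, may use up half of it.\<close>
  obtain N where N: "4 / s < real N" using reals_Archimedean2 by blast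
  have "0 < 4 / s" using s by simp
  then have N0: "0 < real N" using N by linarith
  have N_le: "1 / real N \<le> s / 4" using N N0 s by (simp add: field_simps)
  define a' where "a' = (1 / real N) *\<^sub>R (\<Sum>m<N. \<tau> *\<^sub>R 1 - b (Suc m))"
  define b' where "b' = (1 / real N) *\<^sub>R (\<Sum>m<N. b m)"
  define r where "r = 1 - (a' + b')"
  have a'A: "a' \<in> A" and b'A: "b' \<in> A"
    unfolding a'_def b'_def by (intro scaleR_in sum_in diff_in one_in schur_seq_in)+
  then have rA: "r \<in> A" unfolding r_def by (intro closed_intros one_in)
  have sa: "star a' = a'" "star b' = b'"
    by (simp_all only: a'_def b'_def star_scaleR star_sum star_diff star_schur_seq star_1)
  then have rsa: "star r = r" by (simp add: r_def star_diff star_add)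
  have qa: "qform (\<rho> a') v = (1 / real N) * (\<Sum>m<N. qform (\<rho> (\<tau> *\<^sub>R 1 - b (Suc m))) v)"
    and qb: "qform (\<rho> b') v = (1 / real N) * (\<Sum>m<N. qform (\<rho> (b m)) v)" for v
    unfolding a'_def b'_def
    by (simp_all only: rep_scaleR rep_sum sum_in diff_in scaleR_in one_in schur_seq_in qform_scaleR qform_sum)
  have qb0: "0 \<le> qform (\<rho> b') v" for v
    unfolding qb using slack by (intro mult_nonneg_nonneg sum_nonneg order_trans[OF _ schur_seq_lower]) auto
  have form: "0 \<le> arrow_form n (\<rho> a') (\<rho> b') (\<lambda>j. \<rho> (x j)) h f" for h f
  proof -
    let ?c = "2 * (\<Sum>j=1..n. Re (cinner h (bop_apply (\<rho> (x j)) (f j))))"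
    have "(\<Sum>j=1..n. qform (\<rho> b') (f j)) = (1 / real N) * (\<Sum>m<N. \<Sum>j=1..n. qform (\<rho> (b m)) (f j))"
      unfolding qb by (subst sum.swap) (simp add: sum_distrib_left)
    moreover have "?c = (1 / real N) * (\<Sum>m<N. ?c)" using N0 by simp
    ultimately have "arrow_form n (\<rho> a') (\<rho> b') (\<lambda>j. \<rho> (x j)) h f =
        (1 / real N) * (\<Sum>m<N. arrow_form n (\<rho> (\<tau> *\<^sub>R 1 - b (Suc m))) (\<rho> (b m)) (\<lambda>j. \<rho> (x j)) h f)"
      unfolding arrow_form_def qa sum.distrib distrib_left by linarith
    also have "\<dots> \<ge> 0" by (intro mult_nonneg_nonneg sum_nonneg schur_seq_arrow_form) simp
    finally show ?thesis .
  qed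
  have qa0: "0 \<le> qform (\<rho> a') v" for v
    using form[of v "\<lambda>_. 0"] by (simp add: arrow_form_def qform_def)
  \<comment> \<open>Corner and diagonal are offset by one index, so the sum telescopes to its end
    terms.\<close>
  have "(\<Sum>m<N. \<tau> *\<^sub>R 1 - b (Suc m)) + (\<Sum>m<N. b m) = (\<Sum>m<N. \<tau> *\<^sub>R 1 + (b m - b (Suc m)))"
    unfolding sum.distrib[symmetric] by (intro sum.cong refl) simp
  also have "\<dots> = real N *\<^sub>R \<tau> *\<^sub>R 1 + (b 0 - b N)"
    unfolding sum.distrib sum_lessThan_telescope' by (simp only: sum_constant_scaleR card_lessThan)
  finally have "a' + b' = (1 / real N) *\<^sub>R (real N *\<^sub>R \<tau> *\<^sub>R 1 + (b 0 - b N))"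
    unfolding a'_def b'_def scaleR_add_right[symmetric] by (rule arg_cong)
  then have r_eq: "r = (1 - \<tau> - \<tau> / real N) *\<^sub>R 1 + (1 / real N) *\<^sub>R b N"
    using N0 by (simp add: r_def algebra_simps)
  have r_lower: "(s / 4) * (norm v)\<^sup>2 \<le> qform (\<rho> r) v" for v
  proof -
    have "\<tau> / real N \<le> 1 / real N" using N0 s by (simp add: \<tau> divide_right_mono)
    then have "s / 4 \<le> 1 - \<tau> - \<tau> / real N"
      using N_le \<tau> by linarith
    then have "(s / 4) * (norm v)\<^sup>2 \<le> (1 - \<tau> - \<tau> / real N) * (norm v)\<^sup>2"
      by (rule mult_right_mono) simp
    moreover have "0 \<le> (1 / real N) * qform (\<rho> (b N)) v"
      using slack N0 by (intro mult_nonneg_nonneg order_trans[OF _ schur_seq_lower]) auto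
    moreover have "qform (\<rho> r) v = (1 - \<tau> - \<tau> / real N) * (norm v)\<^sup>2 + (1 / real N) * qform (\<rho> (b N)) v"
      unfolding r_eq by (simp only: rep_add rep_scaleR rep_one scaleR_in one_in schur_seq_in qform_add qform_scaleR qform_one)
    ultimately show ?thesis by linarith
  qed
  \<comment> \<open>Half of the remainder on each side makes the sum 1 and puts both forms above
    \<open>s / 8\<close>.\<close>
  define a where "a = a' + (1/2) *\<^sub>R r"
  define c where "c = b' + (1/2) *\<^sub>R r"
  have A_in: "a \<in> A" "c \<in> A" unfolding a_def c_def by (intro closed_intros a'A b'A rA)+
  have a_sa: "star a = a" "star c = c" by (simp_all add: a_def c_def star_add star_scaleR sa rsa)
  have q_a: "qform (\<rho> a) v = qform (\<rho> a') v + (1/2) * qform (\<rho> r) v"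
    and q_c: "qform (\<rho> c) v = qform (\<rho> b') v + (1/2) * qform (\<rho> r) v" for v
    using a'A b'A rA by (simp_all add: a_def c_def rep_add rep_scaleR scaleR_in qform_add qform_scaleR)
  have a_lower: "(s / 8) * (norm v)\<^sup>2 \<le> qform (\<rho> a) v"
    and c_lower: "(s / 8) * (norm v)\<^sup>2 \<le> qform (\<rho> c) v" for v
    using qa0[of v] qb0[of v] r_lower[of v] by (simp_all add: q_a q_c)
  have shift: "qform (\<rho> (p - (s / 16) *\<^sub>R 1)) v = qform (\<rho> p) v - (s / 16) * (norm v)\<^sup>2" if "p \<in> A" for p v
    using that by (simp add: rep_diff rep_scaleR rep_one scaleR_in qform_diff qform_scaleR)
  have half: "(s / 16) * (norm v)\<^sup>2 \<le> (1/2) * qform (\<rho> r) v" for v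
  proof -
    have "0 \<le> s * (norm v)\<^sup>2" using s by simp
    with r_lower[of v] show ?thesis by (simp add: field_simps)
  qed
  \<comment> \<open>Half of the remainder exceeds \<open>s / 16\<close>, so the shifted form still
    dominates the averaged one, and the shifted diagonal stays bounded below by
    \<open>s / 16\<close>.\<close>
  have "arrow_mat n (a - (s / 16) *\<^sub>R 1) (c - (s / 16) *\<^sub>R 1) x \<in> mat_pos_cone (n + 1) A"
  proof (rule arrow_mat_posI)
    show "(s / 16) * (norm v)\<^sup>2 \<le> qform (\<rho> (c - (s / 16) *\<^sub>R 1)) v" for v
      using c_lower[of v] A_in by (simp add: shift)
    show "0 \<le> arrow_form n (\<rho> (a - (s / 16) *\<^sub>R 1)) (\<rho> (c - (s / 16) *\<^sub>R 1)) (\<lambda>j. \<rho> (x j)) h f" for h f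
    proof -
      have le: "qform (\<rho> a') h \<le> qform (\<rho> (a - (s / 16) *\<^sub>R 1)) h"
        "qform (\<rho> b') v \<le> qform (\<rho> (c - (s / 16) *\<^sub>R 1)) v" for v
        using half[of h] half[of v] A_in by (simp_all add: shift q_a q_c)
      show ?thesis
        using form[of h f] le(1) sum_mono[of "{1..n}", OF le(2), of f]
        unfolding arrow_form_def by linarith
    qed
  qed (use A_in a_sa s x in \<open>auto simp: star_diff star_scaleR intro!: closed_intros\<close>)
  then have "arrow_mat n a c x \<in> mat_strict_pos_cone (n + 1) A"
    using s A_in x by (intro arrow_mat_strict_posI[OF A, where \<epsilon> = "s / 16"]) auto
  moreover have "a \<in> strict_pos_cone A" "c \<in> strict_pos_cone A"
    using strict_pos_coneI[OF A_in(1) a_sa(1) _ a_lower] strict_pos_coneI[OF A_in(2) a_sa(2) _ c_lower] s by auto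
  moreover have "a + c = 1"
  proof -
    have "a + c = (a' + b') + ((1/2) *\<^sub>R r + (1/2) *\<^sub>R r)" by (simp only: a_def c_def add_ac)
    also have "(1/2) *\<^sub>R r + (1/2) *\<^sub>R r = r" by (simp flip: scaleR_add_left)
    finally show ?thesis by (simp add: r_def)
  qed
  ultimately show ?thesis by blast
qed

end

section \<open>Von Neumann algebras\<close>

text \<open>Every commutant is a norm-closed unital subalgebra, and \<open>M\<close> is one; closure
  under \<open>star\<close> is part of the hypothesis.\<close>

lemma unital_cstar_subalgebra_von_neumann:
  assumes "von_neumann_algebra M"
  shows "unital_cstar_subalgebra M"
proof -
  have M: "M = commutant (commutant M)" using assms by (simp add: von_neumann_algebra_def)
  have "complex_vector.subspace (commutant X)" for X :: "'a bop set"
    by (rule complex_vector.subspaceI)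
      (auto simp: commutant_def algebra_simps mult_scaleC_left mult_scaleC_right)
  moreover have "closed (commutant X)" for X :: "'a bop set"
  proof -
    have "commutant X = (\<Inter>S\<in>X. {T. S * T = T * S})" by (auto simp: commutant_def)
    moreover have "closed {T. S * T = T * S}" for S :: "'a bop"
      by (intro closed_Collect_eq continuous_intros)
    ultimately show ?thesis by (simp add: closed_INT)
  qed
  moreover have "1 \<in> commutant X" for X :: "'a bop set" by (simp add: commutant_def)
  moreover have "S * T \<in> commutant X" if "S \<in> commutant X" "T \<in> commutant X" for S T :: "'a bop" and X
    using that unfolding commutant_def by (auto simp: mult.assoc) (metis mult.assoc)
  ultimately show ?thesis
    using assms M unfolding unital_cstar_subalgebra_def von_neumann_algebra_def by metis
qed

section \<open>Strong limits of operators\<close>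

lemma Cauchy_if_square_le_diff:
  fixes X :: "nat \<Rightarrow> 'a::real_normed_vector" and \<phi> :: "nat \<Rightarrow> real"
  assumes "Cauchy \<phi>" "\<And>l m. l \<le> m \<Longrightarrow> (norm (X m - X l))\<^sup>2 \<le> K * \<bar>\<phi> m - \<phi> l\<bar>"
  shows "Cauchy X"
proof (rule CauchyI)
  fix e :: real assume e: "0 < e"
  \<comment> \<open>Strictly positive even if \<open>K\<close> is not, so that it can be divided
    by.\<close>
  define K' where "K' = \<bar>K\<bar> + 1"
  have K': "0 < K'" "K \<le> K'" by (auto simp: K'_def)
  obtain N where N: "\<And>m l. m \<ge> N \<Longrightarrow> l \<ge> N \<Longrightarrow> norm (\<phi> m - \<phi> l) < e\<^sup>2 / K'"
    using CauchyD[OF assms(1), of "e\<^sup>2 / K'"] e K' by auto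
  have less: "norm (X m - X l) < e" if "l \<le> m" "N \<le> l" for m l
  proof -
    have "(norm (X m - X l))\<^sup>2 \<le> K' * \<bar>\<phi> m - \<phi> l\<bar>"
      by (rule order_trans[OF assms(2)[OF that(1)]]) (intro mult_right_mono K'; simp)
    also have "\<dots> < e\<^sup>2" using N[of m l] that K' by (simp add: field_simps)
    finally show ?thesis using e by (rule power2_less_imp_less[OF _ less_imp_le])
  qed
  show "\<exists>M. \<forall>m\<ge>M. \<forall>n\<ge>M. norm (X m - X n) < e"
    by (rule exI[of _ N]) (metis less nat_le_linear norm_minus_commute)
qed

lemma bop_strong_limit:
  fixes T :: "nat \<Rightarrow> 'h::chilbert_space bop"
  assumes conv: "\<And>v. Cauchy (\<lambda>m. bop_apply (T m) v)" and K: "\<And>m. norm (T m) \<le> K"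
  shows "\<exists>L. \<forall>v. (\<lambda>m. bop_apply (T m) v) \<longlonglongrightarrow> bop_apply L v"
proof -
  define L where "L v = lim (\<lambda>m. bop_apply (T m) v)" for v
  have L: "(\<lambda>m. bop_apply (T m) v) \<longlonglongrightarrow> L v" for v
    unfolding L_def by (rule convergent_LIMSEQ_iff[THEN iffD1, OF Cauchy_convergent[OF conv]])
  have scale: "L (c *\<^sub>C v) = c *\<^sub>C L v" for c v
  proof (rule LIMSEQ_unique[OF L])
    show "(\<lambda>m. bop_apply (T m) (c *\<^sub>C v)) \<longlonglongrightarrow> c *\<^sub>C L v"
      unfolding bop_apply_scaleC by (rule bounded_linear.tendsto[OF bounded_linear_scaleC L])
  qed
  have "bounded_linear L"
  proof (rule bounded_linear_intro[where K = K])
    show "L (v + w) = L v + L w" for v w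
    proof (rule LIMSEQ_unique[OF L])
      show "(\<lambda>m. bop_apply (T m) (v + w)) \<longlonglongrightarrow> L v + L w"
        unfolding bop_apply_add by (intro tendsto_add L)
    qed
    show "L (r *\<^sub>R v) = r *\<^sub>R L v" for r v by (simp add: scale flip: scaleC_of_real)
    show "norm (L v) \<le> norm v * K" for v
    proof (rule LIMSEQ_le_const2[OF tendsto_norm[OF L]])
      have "norm (bop_apply (T m) v) \<le> norm v * K" for m
        using order_trans[OF norm_bop_apply mult_right_mono[OF K[of m] norm_ge_zero[of v]]]
        by (simp add: mult.commute)
      then show "\<exists>N. \<forall>m\<ge>N. norm (bop_apply (T m) v) \<le> norm v * K" by blast
    qed
  qed
  then obtain R where "\<forall>v. bop_apply R v = L v" using bop_exists[OF _ scale] by blast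
  with L show ?thesis by (intro exI[of _ R]) simp
qed

lemma tendsto_qform:
  assumes "\<And>v. (\<lambda>m. bop_apply (T m) v) \<longlonglongrightarrow> bop_apply L v"
  shows "(\<lambda>m. qform (T m) v) \<longlonglongrightarrow> qform L v"
proof -
  have "bounded_linear (\<lambda>w. Re (cinner v w))"
  proof (rule bounded_linear_intro[where K = "norm v"])
    show "norm (Re (cinner v w)) \<le> norm w * norm v" for w
      using order_trans[OF abs_Re_le_cmod Cauchy_Schwarz[of v w]] by (simp add: mult.commute)
  qed (simp_all add: cinner_add_right cinner_scaleR_right)
  from bounded_linear.tendsto[OF this assms] show ?thesis unfolding qform_def .
qed

lemma bop_selfadjointI_strong_limit:
  assumes L: "\<And>v. (\<lambda>m. bop_apply (T m) v) \<longlonglongrightarrow> bop_apply L v" and sa: "\<And>m. star (T m) = T m"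
  shows "star L = L"
proof (rule bop_star_eqI)
  fix x y
  have bl: "bounded_linear (\<lambda>w. cinner x w)" for x :: 'a
    by (rule bounded_linear_intro[where K = "norm x"])
      (use Cauchy_Schwarz[of x] in \<open>simp_all add: cinner_add_right cinner_scaleR_right scaleR_conv_of_real mult.commute\<close>)
  have "(\<lambda>m. cinner x (bop_apply (T m) y)) \<longlonglongrightarrow> cinner x (bop_apply L y)"
    by (rule bounded_linear.tendsto[OF bl L])
  moreover have "(\<lambda>m. cnj (cinner y (bop_apply (T m) x))) \<longlonglongrightarrow> cnj (cinner y (bop_apply L x))"
    by (intro tendsto_cnj bounded_linear.tendsto[OF bl L])
  moreover have "cnj (cinner y (bop_apply (T m) x)) = cinner x (bop_apply (T m) y)" for m
    by (metis cinner_commute cinner_star_bop sa)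
  ultimately have "cnj (cinner y (bop_apply L x)) = cinner x (bop_apply L y)"
    using LIMSEQ_unique by fastforce
  then show "cinner (bop_apply L x) y = cinner x (bop_apply L y)"
    by (metis cinner_commute)
qed

text \<open>\<open>\<langle>(q\<inverse> - p\<inverse>) v, v\<rangle>\<close> is controlled by expanding \<open>\<langle>p (p\<inverse> v - q\<inverse> v), p\<inverse> v - q\<inverse> v\<rangle> \<ge> 0\<close>.\<close>

lemma qform_inverse_antimono:
  fixes p q :: "'h::chilbert_space bop"
  assumes pV: "p * V = 1" and qW: "q * W = 1" and sa: "star p = p"
    and pos: "\<And>v. 0 \<le> qform p v" and le: "\<And>v. qform p v \<le> qform q v"
  shows "qform W v \<le> qform V v"
proof -
  define a where "a = bop_apply V v"
  define c where "c = bop_apply W v"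
  have pa: "bop_apply p a = v" and qc: "bop_apply q c = v"
    unfolding a_def c_def by (metis bop_apply_mult bop_apply_one pV, metis bop_apply_mult bop_apply_one qW)
  have ac: "cinner a (bop_apply p c) = cinner v c"
    by (metis cinner_star_bop pa sa)
  have "0 \<le> qform p (a - c)" by (rule pos)
  also have "\<dots> = Re (cinner v a) - 2 * Re (cinner v c) + qform p c"
    using Re_cinner_commute[of c v] Re_cinner_commute[of a v]
    by (simp add: qform_def bop_apply_diff cinner_diff_left cinner_diff_right pa ac)
  also have "qform p c \<le> Re (cinner v c)"
    using le[of c] Re_cinner_commute[of c v] by (simp add: qform_def qc)
  finally show ?thesis by (simp add: qform_def a_def c_def)
qed

section \<open>Strong closedness and monotone limits\<close>

locale von_neumann =
  fixes M :: "'h::chilbert_space bop set"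
  assumes vN: "von_neumann_algebra M"
begin

text \<open>The identity is a faithful representation of \<open>M\<close> on its own Hilbert space,
  so positivity can be tested there.\<close>

sublocale cstar_rep M "\<lambda>T. T"
  by standard (simp_all add: unital_cstar_subalgebra_von_neumann[OF vN] faithful_rep_def)

text \<open>Commuting with a fixed operator survives strong limits, and \<open>M\<close> is its own
  bicommutant.\<close>

lemma strong_limit_in:
  assumes T: "\<And>m. T m \<in> M" and L: "\<And>v. (\<lambda>m. bop_apply (T m) v) \<longlonglongrightarrow> bop_apply L v"
  shows "L \<in> M"
proof -
  have "S * L = L * S" if S: "S \<in> commutant M" for S
  proof (rule bop_eqI)
    fix v
    have "(\<lambda>m. bop_apply S (bop_apply (T m) v)) \<longlonglongrightarrow> bop_apply S (bop_apply L v)"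
      by (rule bounded_linear.tendsto[OF bounded_linear_bop_apply L])
    moreover have "bop_apply S (bop_apply (T m) v) = bop_apply (T m) (bop_apply S v)" for m
      using S T[of m] unfolding commutant_def by (metis (mono_tags, lifting) bop_apply_mult mem_Collect_eq)
    ultimately have "bop_apply S (bop_apply L v) = bop_apply L (bop_apply S v)"
      using L[of "bop_apply S v"] LIMSEQ_unique by fastforce
    then show "bop_apply (S * L) v = bop_apply (L * S) v" by (simp add: bop_apply_mult)
  qed
  then have "L \<in> commutant (commutant M)" by (simp add: commutant_def)
  then show ?thesis using vN by (simp add: von_neumann_algebra_def)
qed

text \<open>The forms converge as bounded monotone reals. A difference of two members is a square
  \<open>h * h\<close> with bounded \<open>h\<close>, so its action on \<open>v\<close> is
  controlled by the difference of the forms at \<open>v\<close>.\<close>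

lemma decreasing_strong_limit:
  assumes T: "\<And>m. T m \<in> M" "\<And>m. star (T m) = T m" and pos: "\<And>m v. 0 \<le> qform (T m) v"
    and dec: "\<And>l m v. l \<le> m \<Longrightarrow> qform (T m) v \<le> qform (T l) v"
  shows "\<exists>L\<in>M. star L = L \<and> (\<forall>v. (\<lambda>m. bop_apply (T m) v) \<longlonglongrightarrow> bop_apply L v)"
proof -
  have upper: "qform (T m) v \<le> norm (T 0) * (norm v)\<^sup>2" for m v
    using dec[of 0 m v] abs_qform_le[of "T 0" v] by simp
  have norm: "norm (T m) \<le> norm (T 0)" for m
  proof (rule norm_le_if_qform_le[OF T(2)])
    show "\<bar>qform (T m) v\<bar> \<le> norm (T 0) * (norm v)\<^sup>2" for v
      using upper[of m v] pos[of m v] by simp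
  qed simp
  have "Cauchy (\<lambda>m. bop_apply (T m) v)" for v
  proof (rule Cauchy_if_square_le_diff)
    have "decseq (\<lambda>m. qform (T m) v)" using dec by (simp add: decseq_def)
    then have "convergent (\<lambda>m. qform (T m) v)"
      using pos by (intro Bseq_monoseq_convergent decseq_imp_monoseq decseq_bounded) auto
    then show "Cauchy (\<lambda>m. qform (T m) v)" by (rule convergent_Cauchy)
    fix l m :: nat assume lm: "l \<le> m"
    define D where "D = T l - T m"
    have D: "D \<in> M" "star D = D" using T by (auto simp: D_def star_diff intro!: diff_in)
    have "0 \<le> qform D u" for u using dec[OF lm] by (simp add: D_def qform_diff)
    then obtain h where h: "star h = h" "h * h = D" using sqrt_exists[OF D] by blast
    have "norm D \<le> 2 * norm (T 0)"
      using norm_triangle_ineq4[of "T l" "T m"] norm[of l] norm[of m] by (simp add: D_def)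
    then have nh: "(norm h)\<^sup>2 \<le> 2 * norm (T 0)" using cstar_identity[of h] by (simp add: h)
    have "bop_apply h (bop_apply h v) = bop_apply (T l) v - bop_apply (T m) v"
      using h(2) by (simp add: D_def flip: bop_apply_diff_left bop_apply_mult)
    then have "(norm (bop_apply (T m) v - bop_apply (T l) v))\<^sup>2 = (norm (bop_apply h (bop_apply h v)))\<^sup>2"
      by (simp add: norm_minus_commute)
    also have "\<dots> \<le> (norm h * norm (bop_apply h v))\<^sup>2" by (intro power_mono norm_bop_apply) simp
    also have "\<dots> = (norm h)\<^sup>2 * qform D v"
      using qform_square[of h v] by (simp add: power_mult_distrib h)
    also have "\<dots> \<le> 2 * norm (T 0) * qform D v"
      using dec[OF lm] by (intro mult_right_mono nh) (simp add: D_def qform_diff)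
    also have "qform D v = \<bar>qform (T m) v - qform (T l) v\<bar>"
      using dec[OF lm, of v] by (simp add: D_def qform_diff)
    finally show "(norm (bop_apply (T m) v - bop_apply (T l) v))\<^sup>2 \<le>
      2 * norm (T 0) * \<bar>qform (T m) v - qform (T l) v\<bar>" .
  qed
  from bop_strong_limit[OF this norm] obtain L where
    L: "\<And>v. (\<lambda>m. bop_apply (T m) v) \<longlonglongrightarrow> bop_apply L v" by blast
  show ?thesis
    using strong_limit_in[OF T(1) L] bop_selfadjointI_strong_limit[OF L T(2)] L by blast
qed

end

text \<open>
  Douglas factorisation through \<open>(c + \<epsilon>)\<inverse>\<close>: as \<open>\<epsilon>\<close> decreases, \<open>d (c + \<epsilon>)\<inverse> u\<close> is Cauchy as soon as
  the increasing quantities \<open>\<langle>(c + \<epsilon>)\<inverse> u, u\<rangle>\<close> are bounded.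
\<close>

lemma resolvent_increment:
  fixes c d V W :: "'h::chilbert_space bop"
  assumes c: "star d = d" "d * d = c" and \<epsilon>: "0 \<le> \<epsilon>" "\<epsilon> \<le> \<epsilon>'"
    and V: "V * (c + \<epsilon> *\<^sub>R 1) = 1" "(c + \<epsilon> *\<^sub>R 1) * V = 1"
    and W: "(c + \<epsilon>' *\<^sub>R 1) * W = 1"
  shows "(norm (bop_apply (d * V) u - bop_apply (d * W) u))\<^sup>2 \<le> qform V u - qform W u"
proof -
  define z where "z = bop_apply V (bop_apply W u)"
  define \<eta> where "\<eta> = \<epsilon>' - \<epsilon>"
  \<comment> \<open>The resolvent identity.\<close>
  have "V - W = V * ((c + \<epsilon>' *\<^sub>R 1) * W) - (V * (c + \<epsilon> *\<^sub>R 1)) * W"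
    by (simp add: V W)
  also have "\<dots> = \<eta> *\<^sub>R (V * W)" by (simp add: \<eta>_def algebra_simps)
  finally have VW: "V - W = \<eta> *\<^sub>R (V * W)" .
  then have z: "bop_apply (V - W) u = \<eta> *\<^sub>R z"
    by (simp add: z_def bop_apply_scaleR_left bop_apply_mult)
  have "bop_apply (c + \<epsilon> *\<^sub>R 1) z = bop_apply W u"
    unfolding z_def by (metis V(2) bop_apply_mult bop_apply_one)
  then have "bop_apply (c + \<epsilon>' *\<^sub>R 1) (bop_apply (c + \<epsilon> *\<^sub>R 1) z) = u"
    by (metis W bop_apply_mult bop_apply_one)
  \<comment> \<open>In terms of \<open>z\<close> the inner product of \<open>u\<close> with
    \<open>z\<close> is a sum of nonnegative terms, one of which is
    \<open>\<epsilon> + \<epsilon>'\<close> times the form of \<open>c\<close> at \<open>z\<close>;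
    this dominates \<eta> times that form.\<close>
  then have u: "u = bop_apply c (bop_apply c z) + (\<epsilon> + \<epsilon>') *\<^sub>R bop_apply c z + (\<epsilon> * \<epsilon>') *\<^sub>R z"
    by (simp add: bop_apply_add_left bop_apply_add bop_apply_scaleR_left bop_apply_scaleR bop_apply_one
        algebra_simps)
  have cz: "0 \<le> qform c z" using qform_square[of d z] c by simp
  have "star c = c" using c by (metis star_mult)
  then have "cinner (bop_apply c (bop_apply c z)) z = cinner (bop_apply c z) (bop_apply c z)"
    by (metis cinner_star_bop)
  then have uz: "Re (cinner u z) = (norm (bop_apply c z))\<^sup>2 + (\<epsilon> + \<epsilon>') * qform c z + \<epsilon> * \<epsilon>' * (norm z)\<^sup>2"
    by (subst u) (simp add: cinner_add_left cinner_scaleR_left qform_def Re_cinner_self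
        Re_cinner_commute[of "bop_apply c z" z])
  have "(norm (bop_apply (d * V) u - bop_apply (d * W) u))\<^sup>2 = (norm (bop_apply d (\<eta> *\<^sub>R z)))\<^sup>2"
    unfolding z[symmetric] by (simp only: bop_apply_mult bop_apply_diff_left bop_apply_diff)
  also have "\<dots> = \<eta>\<^sup>2 * qform c z"
    using qform_square[of d z] c by (simp add: bop_apply_scaleR power_mult_distrib)
  also have "\<dots> \<le> \<eta> * Re (cinner u z)"
  proof -
    have "\<eta> * qform c z \<le> (\<epsilon> + \<epsilon>') * qform c z"
      using \<epsilon> cz by (intro mult_right_mono) (auto simp: \<eta>_def)
    also have "\<dots> \<le> Re (cinner u z)" unfolding uz using \<epsilon> by simp
    finally show ?thesis
      using \<epsilon> unfolding power2_eq_square mult.assoc by (intro mult_left_mono) (auto simp: \<eta>_def)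
  qed
  also have "\<dots> = qform V u - qform W u"
    unfolding qform_diff[symmetric] VW qform_scaleR
    by (simp add: qform_def z_def bop_apply_mult)
  finally show ?thesis .
qed

context von_neumann
begin

text \<open>Here \<open>c\<close> need not be invertible, so the column entries of the Cholesky
  factor are obtained as strong limits of those for \<open>c + \<epsilon>\<close>; strong closedness
  keeps them in \<open>M\<close>.\<close>

lemma arrow_mat_posI_von_neumann:
  assumes M: "a \<in> M" "c \<in> M" "\<And>j. j \<in> {1..n} \<Longrightarrow> y j \<in> M" and sa: "star a = a" "star c = c"
    and c_pos: "\<And>v. 0 \<le> qform c v"
    and pos: "\<And>h f. 0 \<le> arrow_form n a c y h f"
  shows "arrow_mat n a c y \<in> mat_pos_cone (n + 1) M"
proof -
  obtain d where d: "d \<in> M" "star d = d" "d * d = c"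
    using sqrt_exists[OF M(2) sa(2) c_pos] by blast
  define \<epsilon> where "\<epsilon> m = inverse (real (Suc m))" for m
  have \<epsilon>: "0 < \<epsilon> m" "l \<le> m \<Longrightarrow> \<epsilon> m \<le> \<epsilon> l" for l m
    by (simp_all add: \<epsilon>_def field_simps)
  define p where "p m = c + \<epsilon> m *\<^sub>R 1" for m
  define V where "V m = cstar_inverse M (p m)" for m
  have p: "p m \<in> M" "star (p m) = p m" "qform (p m) v = qform c v + \<epsilon> m * (norm v)\<^sup>2" for m v
    using M sa by (auto simp: p_def star_add star_scaleR qform_add qform_scaleR intro!: closed_intros)
  have p_lower: "\<epsilon> m * (norm v)\<^sup>2 \<le> qform (p m) v" for m v
    using c_pos[of v] by (simp add: p)
  note V = cstar_inverse[OF p(1,2) \<epsilon>(1) p_lower, folded V_def]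
  have p_nonneg: "0 \<le> qform (p m) v" for m v
    using p_lower[where m = m and v = v] \<epsilon>(1)[of m] by (simp add: p c_pos)
  have qV: "qform (p m) (bop_apply (V m) u) = qform (V m) u" for m u
  proof -
    have "bop_apply (p m) (bop_apply (V m) u) = u" by (metis V(2) bop_apply_mult bop_apply_one)
    then show ?thesis by (simp add: qform_def Re_cinner_commute[of u])
  qed
  have V_nonneg: "0 \<le> qform (V m) u" for m u
    using p_nonneg[of m "bop_apply (V m) u"] by (simp add: qV)
  have sum_le: "(\<Sum>j=1..n. qform (V m) (bop_apply (star (y j)) h)) \<le> qform a h" for m h
  proof -
    \<comment> \<open>The minimiser for the larger diagonal \<open>p m\<close>: at it only the Schur
      complement of the corner is left.\<close>
    let ?f = "\<lambda>j. - bop_apply (V m) (bop_apply (star (y j)) h)"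
    have "0 \<le> arrow_form n a c y h ?f" by (rule pos)
    also have "\<dots> \<le> arrow_form n a (p m) y h ?f"
      unfolding arrow_form_def using \<epsilon>(1)[of m] by (intro add_mono sum_mono order_refl) (simp add: p)
    also have "\<dots> = qform a h - (\<Sum>j=1..n. qform (V m) (bop_apply (star (y j)) h))"
      unfolding arrow_form_schur_complement[OF V(2) p(2) V(4)] qform_diff qform_sum
      using qform_conj[of "star (y _)" "V m" h] by (simp add: star_star) (simp add: qform_def)
    finally show ?thesis by simp
  qed
  have V_le: "qform (V m) (bop_apply (star (y j)) h) \<le> qform a h" if "j \<in> {1..n}" for m j h
    using member_le_sum[of j "{1..n}" "\<lambda>j. qform (V m) (bop_apply (star (y j)) h)"] that V_nonneg sum_le[of m h]
    by force
  have a_le: "qform a h \<le> norm a * (norm h)\<^sup>2" for h using abs_qform_le[of a h] by linarith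
  define w where "w m j = d * V m * star (y j)" for m j
  have wM: "w m j \<in> M" if "j \<in> {1..n}" for m j
    using d V(1) M(3)[OF that] by (auto simp: w_def intro!: closed_intros)
  have norm_w: "(norm (bop_apply (w m j) h))\<^sup>2 \<le> qform (V m) (bop_apply (star (y j)) h)" for m j h
  proof -
    let ?v = "bop_apply (V m) (bop_apply (star (y j)) h)"
    have "(norm (bop_apply (w m j) h))\<^sup>2 = qform c ?v"
      using qform_square[of d ?v] d by (simp add: w_def bop_apply_mult)
    also have "\<dots> \<le> qform (p m) ?v" using \<epsilon>(1)[of m] by (simp add: p)
    finally show ?thesis by (simp add: qV)
  qed
  have "\<exists>L. \<forall>v. (\<lambda>m. bop_apply (w m j) v) \<longlonglongrightarrow> bop_apply L v" if j: "j \<in> {1..n}" for j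
  proof (rule bop_strong_limit)
    fix h
    let ?u = "bop_apply (star (y j)) h"
    \<comment> \<open>Vector increments are bounded by increments of a real sequence that increases
      and stays below the form of \<open>a\<close>.\<close>
    have inc: "(norm (bop_apply (w m j) h - bop_apply (w l j) h))\<^sup>2 \<le> qform (V m) ?u - qform (V l) ?u" if "l \<le> m" for l m
      using resolvent_increment[OF d(2,3) _ \<epsilon>(2)[OF that], where V = "V m" and W = "V l" and u = ?u]
        V(2,3)[of m] V(2)[of l] \<epsilon>(1)[of m] by (simp add: w_def p_def bop_apply_mult)
    have "incseq (\<lambda>m. qform (V m) ?u)"
      unfolding incseq_def using order_trans[OF zero_le_power2 inc] by simp
    then have "convergent (\<lambda>m. qform (V m) ?u)"
      using V_le[OF j] V_nonneg
      by (intro Bseq_monoseq_convergent incseq_imp_monoseq BseqI'[where K = "qform a h"]) (simp add: abs_of_nonneg)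
    then have "Cauchy (\<lambda>m. qform (V m) ?u)" by (rule convergent_Cauchy)
    then show "Cauchy (\<lambda>m. bop_apply (w m j) h)"
    proof (rule Cauchy_if_square_le_diff[where K = 1])
      show "(norm (bop_apply (w m j) h - bop_apply (w l j) h))\<^sup>2 \<le> 1 * \<bar>qform (V m) ?u - qform (V l) ?u\<bar>"
        if "l \<le> m" for l m
        unfolding mult_1_left by (rule order_trans[OF inc[OF that] abs_ge_self])
    qed
  next
    show "norm (w m j) \<le> sqrt (norm a)" for m
    proof (rule norm_bop_bound)
      fix h
      have "(norm (bop_apply (w m j) h))\<^sup>2 \<le> norm a * (norm h)\<^sup>2"
        using norm_w[of m j h] V_le[OF j, of m h] a_le[of h] by linarith
      also have "\<dots> = (sqrt (norm a) * norm h)\<^sup>2" by (simp add: power_mult_distrib)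
      finally show "norm (bop_apply (w m j) h) \<le> sqrt (norm a) * norm h"
        by (rule power2_le_imp_le) simp
    qed simp
  qed
  then obtain L where L: "\<And>j v. j \<in> {1..n} \<Longrightarrow> (\<lambda>m. bop_apply (w m j) v) \<longlonglongrightarrow> bop_apply (L j) v"
    by metis
  have LM: "L j \<in> M" if "j \<in> {1..n}" for j
    using strong_limit_in[OF wM[OF that] L[OF that]] .
  have dL: "d * L j = star (y j)" if j: "j \<in> {1..n}" for j
  proof (rule bop_eqI)
    fix h
    let ?u = "bop_apply (star (y j)) h"
    have "(\<lambda>m. bop_apply d (bop_apply (w m j) h)) \<longlonglongrightarrow> bop_apply d (bop_apply (L j) h)"
      by (rule bounded_linear.tendsto[OF bounded_linear_bop_apply L[OF j]])
    moreover have "(\<lambda>m. bop_apply d (bop_apply (w m j) h)) \<longlonglongrightarrow> ?u"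
    proof -
      have eq: "bop_apply d (bop_apply (w m j) h) = ?u - \<epsilon> m *\<^sub>R bop_apply (V m) ?u" for m
      proof -
        have "bop_apply (p m) (bop_apply (V m) ?u) = ?u" by (metis V(2) bop_apply_mult bop_apply_one)
        then have "bop_apply c (bop_apply (V m) ?u) = ?u - \<epsilon> m *\<^sub>R bop_apply (V m) ?u"
          by (simp add: p_def bop_apply_add_left bop_apply_scaleR_left bop_apply_one eq_diff_eq)
        then show ?thesis by (simp add: w_def d(3)[symmetric] bop_apply_mult)
      qed
      \<comment> \<open>The error in \<open>d * w m j = star (y j)\<close> has squared length of
        order \<open>\<epsilon> m\<close>, hence vanishes in the strong limit.\<close>
      have small: "(norm (\<epsilon> m *\<^sub>R bop_apply (V m) ?u))\<^sup>2 \<le> \<epsilon> m * qform a h" for m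
      proof -
        have "(norm (\<epsilon> m *\<^sub>R bop_apply (V m) ?u))\<^sup>2 = \<epsilon> m * (\<epsilon> m * (norm (bop_apply (V m) ?u))\<^sup>2)"
          by (simp add: power_mult_distrib power2_eq_square)
        also have "\<dots> \<le> \<epsilon> m * qform (V m) ?u"
          using p_lower[of m "bop_apply (V m) ?u"] \<epsilon>(1)[of m] by (intro mult_left_mono) (auto simp: qV)
        also have "\<dots> \<le> \<epsilon> m * qform a h"
          using \<epsilon>(1)[of m] V_le[OF j] by (intro mult_left_mono) auto
        finally show ?thesis .
      qed
      have "(\<lambda>m. \<epsilon> m * qform a h) \<longlonglongrightarrow> 0"
        unfolding \<epsilon>_def by (rule tendsto_mult_left_zero[OF LIMSEQ_inverse_real_of_nat])
      then have "(\<lambda>m. (norm (\<epsilon> m *\<^sub>R bop_apply (V m) ?u))\<^sup>2) \<longlonglongrightarrow> 0"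
        by (rule Lim_null_comparison[rotated]) (use small in simp)
      from tendsto_real_sqrt[OF this]
      have "(\<lambda>m. norm (\<epsilon> m *\<^sub>R bop_apply (V m) ?u)) \<longlonglongrightarrow> 0"
        by (simp only: real_sqrt_abs abs_norm_cancel real_sqrt_zero)
      then have "(\<lambda>m. \<epsilon> m *\<^sub>R bop_apply (V m) ?u) \<longlonglongrightarrow> 0"
        by (rule tendsto_norm_zero_cancel)
      from tendsto_diff[OF tendsto_const this, of ?u] show ?thesis by (simp add: eq)
    qed
    ultimately show "bop_apply (d * L j) h = ?u"
      unfolding bop_apply_mult by (rule LIMSEQ_unique)
  qed
  define r where "r = a - (\<Sum>j=1..n. star (L j) * L j)"
  have rM: "r \<in> M" "star r = r"
    using M sa LM by (auto simp: r_def star_diff star_sum star_mult star_star intro!: closed_intros)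
  have "0 \<le> qform r h" for h
  proof -
    have "(\<lambda>m. \<Sum>j=1..n. (norm (bop_apply (w m j) h))\<^sup>2) \<longlonglongrightarrow> (\<Sum>j=1..n. (norm (bop_apply (L j) h))\<^sup>2)"
      by (intro tendsto_sum tendsto_power tendsto_norm L)
    moreover have "(\<Sum>j=1..n. (norm (bop_apply (w m j) h))\<^sup>2) \<le> qform a h" for m
      by (rule order_trans[OF sum_mono[OF norm_w] sum_le])
    ultimately have "(\<Sum>j=1..n. (norm (bop_apply (L j) h))\<^sup>2) \<le> qform a h"
      by (intro LIMSEQ_le_const2) auto
    then show ?thesis by (simp add: r_def qform_diff qform_sum qform_square)
  qed
  then obtain e where e: "e \<in> M" "star e = e" "e * e = r"
    using sqrt_exists[OF rM] by blast
  show ?thesis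
    by (rule arrow_mat_factorization[where d = d and e = e and w = L]) (use d e LM dL in \<open>auto simp: r_def\<close>)
qed

lemma dual_row_arrow_exists:
  fixes \<rho> :: "'h bop \<Rightarrow> 'j ell2 bop" and U :: "nat \<Rightarrow> 'i ell2 bop"
  assumes rho: "faithful_rep M \<rho>" and U: "cuntz_family n U" and n: "2 \<le> n"
    and y: "\<And>j. j \<in> {1..n} \<Longrightarrow> y j \<in> M"
    and lower: "\<And>g. 0 \<le> qform (bop_tensor 1 1 + (\<Sum>j=1..n. bop_tensor (U j) (\<rho> (star (y j))))
      + (\<Sum>j=1..n. bop_tensor (star (U j)) (\<rho> (y j)))) g"
  shows "\<exists>a\<in>pos_cone M. \<exists>c\<in>pos_cone M. a + c = 1 \<and> arrow_mat n a c y \<in> mat_pos_cone (n + 1) M"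
proof -
  define B where "B = schur_seq M n y"
  define V where "V \<tau> m = cstar_inverse M (B \<tau> m)" for \<tau> m
  \<comment> \<open>Only \<open>s = 0\<close> is available, so the slack \<open>\<tau> - 1\<close>
    has to come from \<tau>.\<close>
  have rep: "cstar_ell2_rep M \<rho> n y U 0 \<tau>" if "1 < \<tau>" for \<tau>
    by standard (use rho U n y lower that in auto)
  interpret R: cstar_rep M \<rho>
    by standard (rule rho)
  have B: "B \<tau> m \<in> M" "star (B \<tau> m) = B \<tau> m" and V: "B \<tau> m * V \<tau> m = 1" "star (V \<tau> m) = V \<tau> m"
    if "1 < \<tau>" for \<tau> m
    using cstar_ell2_rep.schur_seq_in[OF rep[OF that]] cstar_ell2_rep.star_schur_seq[OF rep[OF that]]
      cstar_ell2_rep.binv(2,4)[OF rep[OF that]] by (simp_all add: B_def V_def)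
  have B_pos: "0 \<le> qform (B \<tau> m) v" if "1 < \<tau>" for \<tau> m v
  \<comment> \<open>The bound on \<open>B\<close> is known in \<rho>, whereas the strong limit is
    taken on \<open>'h\<close>; a square root in \<open>M\<close> carries positivity across.\<close>
  proof (rule qform_rep_pos_cone[OF R.pos_coneI[OF B[OF that]]])
    show "0 \<le> qform (\<rho> (B \<tau> m)) v" for v
      using cstar_ell2_rep.schur_seq_lower[OF rep[OF that], of v m] that
      by (simp add: B_def) (meson less_eq_real_def mult_nonneg_nonneg order_trans zero_le_power2 diff_ge_0_iff_ge)
  qed
  have B_0: "qform (B \<tau> 0) v = \<tau> * (norm v)\<^sup>2" for \<tau> v
    by (simp add: B_def qform_scaleR)
  have B_Suc: "B \<tau> (Suc m) = \<tau> *\<^sub>R 1 - (\<Sum>j=1..n. y j * V \<tau> m * star (y j))" for \<tau> m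
    by (simp add: B_def V_def)
  have q_Suc: "qform (B \<tau> (Suc m)) v = \<tau> * (norm v)\<^sup>2 - (\<Sum>j=1..n. qform (V \<tau> m) (bop_apply (star (y j)) v))" for \<tau> m v
    using qform_conj[of "star (y _)" "V \<tau> m" v] by (simp add: B_Suc qform_diff qform_scaleR qform_sum star_star)
  have V_pos: "0 \<le> qform (V \<tau> m) v" if "1 < \<tau>" for \<tau> m v
  proof -
    have "bop_apply (B \<tau> m) (bop_apply (V \<tau> m) v) = v"
      using V(1)[OF that, of m] by (metis bop_apply_mult bop_apply_one)
    then show ?thesis
      using B_pos[OF that, of m "bop_apply (V \<tau> m) v"] by (simp add: qform_def Re_cinner_commute[of v])
  qed
  \<comment> \<open>Induction through the antitonicity of inversion; at \<open>m = 0\<close> the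
    claim holds because the subtracted Schur terms are positive and \<sigma> is at most \<tau>.
    Varying both parameters at once makes the diagonal sequence decreasing.\<close>
  have mono: "qform (B \<sigma> k) v \<le> qform (B \<tau> m) v" if \<sigma>: "1 < \<sigma>" "\<sigma> \<le> \<tau>" and "m \<le> k" for \<sigma> \<tau> m k v
    using \<open>m \<le> k\<close>
  proof (induction m arbitrary: k v)
    case 0
    have "qform (B \<sigma> k) v \<le> \<sigma> * (norm v)\<^sup>2"
      using V_pos[OF \<sigma>(1)] by (cases k) (simp_all add: B_0 q_Suc sum_nonneg)
    also have "\<dots> \<le> \<tau> * (norm v)\<^sup>2" using \<sigma> by (intro mult_right_mono) auto
    finally show ?case by (simp add: B_0)
  next
    case (Suc m)
    then obtain l where k: "k = Suc l" "m \<le> l" by (cases k) auto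
    have "1 < \<tau>" using \<sigma> by simp
    have "qform (V \<tau> m) u \<le> qform (V \<sigma> l) u" for u
      by (rule qform_inverse_antimono[OF V(1)[OF \<sigma>(1)] V(1)[OF \<open>1 < \<tau>\<close>] B(2)[OF \<sigma>(1)] B_pos[OF \<sigma>(1)] Suc.IH[OF k(2)]])
    then have "(\<Sum>j=1..n. qform (V \<tau> m) (bop_apply (star (y j)) v)) \<le> (\<Sum>j=1..n. qform (V \<sigma> l) (bop_apply (star (y j)) v))"
      by (intro sum_mono)
    moreover have "\<sigma> * (norm v)\<^sup>2 \<le> \<tau> * (norm v)\<^sup>2" using \<sigma> by (intro mult_right_mono) auto
    ultimately show ?case unfolding k q_Suc by linarith
  qed
  define t where "t m = 1 + inverse (real (Suc m))" for m
  have t: "1 < t m" "l \<le> m \<Longrightarrow> t m \<le> t l" for l m by (simp_all add: t_def field_simps)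
  have t_lim: "t \<longlonglongrightarrow> 1"
    unfolding t_def using tendsto_add[OF tendsto_const LIMSEQ_inverse_real_of_nat, of 1] by simp
  have "\<exists>c\<in>M. star c = c \<and> (\<forall>v. (\<lambda>m. bop_apply (B (t m) m) v) \<longlonglongrightarrow> bop_apply c v)"
    by (rule decreasing_strong_limit) (use B B_pos t mono in auto)
  then obtain c where c: "c \<in> M" "star c = c" and c_lim: "\<And>v. (\<lambda>m. bop_apply (B (t m) m) v) \<longlonglongrightarrow> bop_apply c v"
    by blast
  have q_lim: "(\<lambda>m. qform (B (t m) m) v) \<longlonglongrightarrow> qform c v" for v
    by (rule tendsto_qform[OF c_lim])
  have c_pos: "0 \<le> qform c v" for v
    by (rule LIMSEQ_le_const[OF q_lim]) (use B_pos t in auto)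
  have form: "0 \<le> arrow_form n (1 - c) c y h f" for h f
  proof -
    \<comment> \<open>The corner uses the next member of the diagonal sequence instead of
      \<open>B (t m) (Suc m)\<close>: it is smaller by \<open>mono\<close>, which only enlarges the
      corner, and it has the same limit \<open>c\<close> as the diagonal entries.\<close>
    let ?F = "\<lambda>m. t m * (norm h)\<^sup>2 - qform (B (t (Suc m)) (Suc m)) h
      + 2 * (\<Sum>j=1..n. Re (cinner h (bop_apply (y j) (f j)))) + (\<Sum>j=1..n. qform (B (t m) m) (f j))"
    have "?F \<longlonglongrightarrow> 1 * (norm h)\<^sup>2 - qform c h + 2 * (\<Sum>j=1..n. Re (cinner h (bop_apply (y j) (f j)))) + (\<Sum>j=1..n. qform c (f j))"
      by (intro tendsto_intros t_lim q_lim LIMSEQ_Suc[OF q_lim])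
    moreover have "0 \<le> ?F m" for m
    proof -
      have "0 \<le> (\<Sum>j=1..n. qform (B (t m) m) (f j + bop_apply (V (t m) m) (bop_apply (star (y j)) h)))"
        by (intro sum_nonneg B_pos t)
      also have "\<dots> = arrow_form n (t m *\<^sub>R 1 - B (t m) (Suc m)) (B (t m) m) y h f"
        unfolding arrow_form_schur_complement[OF V(1) B(2) V(2), OF t(1) t(1) t(1)] B_Suc by simp
      also have "\<dots> \<le> ?F m"
        using mono[of "t (Suc m)" "t m" "Suc m" "Suc m" h] t(1)[of "Suc m"] t(2)[of m "Suc m"]
        by (simp add: arrow_form_def qform_diff qform_scaleR)
      finally show ?thesis .
    qed
    ultimately show ?thesis
      by (simp add: arrow_form_def qform_diff) (rule LIMSEQ_le_const, auto)
  qed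
  have a: "1 - c \<in> M" "star (1 - c) = 1 - c"
    using c by (auto simp: star_diff intro!: diff_in one_in)
  have a_pos: "0 \<le> qform (1 - c) h" for h
    using form[of h "\<lambda>_. 0"] by (simp add: arrow_form_def qform_def)
  have "arrow_mat n (1 - c) c y \<in> mat_pos_cone (n + 1) M"
    by (rule arrow_mat_posI_von_neumann[OF a(1) c(1) y a(2) c(2) c_pos form])
  then show ?thesis
    using pos_coneI[OF a a_pos] pos_coneI[OF c c_pos] by (intro bexI[of _ "1 - c"] bexI[of _ c]) auto
qed

end

section \<open>Dual row contractions\<close>

lemma unital_cstar_subalgebra_generated: "unital_cstar_subalgebra (cstar_generated X)"
  unfolding unital_cstar_subalgebra_def
proof (intro conjI ballI)
  let ?F = "{B. unital_cstar_subalgebra B \<and> X \<subseteq> B}"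
  show "complex_vector.subspace (cstar_generated X)"
    unfolding cstar_generated_def
    by (rule complex_vector.subspace_Inter) (simp add: unital_cstar_subalgebra_def)
  show "closed (cstar_generated X)"
    unfolding cstar_generated_def by (rule closed_Inter) (simp add: unital_cstar_subalgebra_def)
qed (auto simp: cstar_generated_def unital_cstar_subalgebra_def)

text \<open>The Cuntz relations are algebraic, so the represented generators form a Cuntz family of
  operators, to which the wandering words apply.\<close>

lemma cuntz_algebra_rep:
  assumes S: "cuntz_family n S" and \<pi>: "faithful_rep (cuntz_algebra n S) \<pi>"
  shows "cuntz_family n (\<lambda>j. \<pi> (S j))" "\<And>j. j \<in> {1..n} \<Longrightarrow> \<pi> (star (S j)) = star (\<pi> (S j))"
proof -
  interpret cstar_rep "cuntz_algebra n S" \<pi>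
    using \<pi> by unfold_locales (simp_all add: cuntz_algebra_def unital_cstar_subalgebra_generated)
  have S_in: "S j \<in> cuntz_algebra n S" if "j \<in> {1..n}" for j
    using that by (auto simp: cuntz_algebra_def cstar_generated_def)
  show star: "\<pi> (star (S j)) = star (\<pi> (S j))" if "j \<in> {1..n}" for j
    by (rule rep_star[OF S_in[OF that]])
  have iso: "star (\<pi> (S j)) * \<pi> (S j) = 1" if "j \<in> {1..n}" for j
  proof -
    have "\<pi> (star (S j) * S j) = star (\<pi> (S j)) * \<pi> (S j)"
      using S_in[OF that] by (simp add: rep_mult star_in star[OF that])
    then show ?thesis using S that by (simp add: cuntz_family_def rep_one)
  qed
  have "\<pi> (\<Sum>j=1..n. S j * star (S j)) = (\<Sum>j=1..n. \<pi> (S j) * star (\<pi> (S j)))"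
    by (intro trans[OF rep_sum sum.cong[OF refl]]) (simp_all only: S_in mult_in star_in rep_mult star)
  then have "(\<Sum>j=1..n. \<pi> (S j) * star (\<pi> (S j))) = 1"
    using S by (simp add: cuntz_family_def rep_one)
  with iso show "cuntz_family n (\<lambda>j. \<pi> (S j))" by (simp add: cuntz_family_def)
qed

lemma dual_row_element_eq:
  assumes "cuntz_family n S" "faithful_rep (cuntz_algebra n S) \<pi>" "faithful_rep A \<rho>"
  shows "dual_row_element n S x \<pi> \<rho> = bop_tensor 1 1 +
    (\<Sum>j=1..n. bop_tensor (\<pi> (S j)) (\<rho> (star (x j)))) + (\<Sum>j=1..n. bop_tensor (star (\<pi> (S j))) (\<rho> (x j)))"
proof -
  have "\<pi> 1 = 1" "\<rho> 1 = 1" using assms(2,3) by (simp_all add: faithful_rep_def)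
  moreover have "(\<Sum>j=1..n. bop_tensor (\<pi> (star (S j))) (\<rho> (x j))) = (\<Sum>j=1..n. bop_tensor (star (\<pi> (S j))) (\<rho> (x j)))"
    by (intro sum.cong refl) (simp only: cuntz_algebra_rep(2)[OF assms(1,2)])
  ultimately show ?thesis unfolding dual_row_element_def by (simp only:)
qed

lemma qform_pos_cone: "p \<in> pos_cone X \<Longrightarrow> 0 \<le> qform p v"
  unfolding pos_cone_def by (auto simp: qform_square)

theorem theorem3p10:
  fixes n :: nat
    and S :: "nat \<Rightarrow> 'o::cstar_algebra"
    and A :: "'a::cstar_algebra set" and x :: "nat \<Rightarrow> 'a"
    and M :: "'h::chilbert_space bop set" and y :: "nat \<Rightarrow> 'h bop"
  assumes "2 \<le> n" and "cuntz_family n S"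
  shows "(unital_cstar_subalgebra A \<and> (\<forall>j\<in>{1..n}. x j \<in> A) \<and> strict_dual_row_contraction n S A x
      \<longrightarrow> (\<exists>a\<in>strict_pos_cone A. \<exists>b\<in>strict_pos_cone A.
            a + b = 1 \<and> arrow_mat n a b x \<in> mat_strict_pos_cone (n + 1) A)) \<and>
    (von_neumann_algebra M \<and> (\<forall>j\<in>{1..n}. y j \<in> M) \<and> dual_row_contraction n S M y
      \<longrightarrow> (\<exists>a\<in>pos_cone M. \<exists>b\<in>pos_cone M.
            a + b = 1 \<and> arrow_mat n a b y \<in> mat_pos_cone (n + 1) M))"
proof (intro conjI impI)
  assume *: "unital_cstar_subalgebra A \<and> (\<forall>j\<in>{1..n}. x j \<in> A) \<and> strict_dual_row_contraction n S A x"
  then obtain \<pi> :: "'o \<Rightarrow> 'o ell2 bop" and \<rho> :: "'a \<Rightarrow> 'a ell2 bop" and \<epsilon> :: real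
    where \<pi>: "faithful_rep (cuntz_algebra n S) \<pi>" and \<rho>: "faithful_rep A \<rho>" and \<epsilon>: "0 < \<epsilon>"
      and pos: "dual_row_element n S x \<pi> \<rho> - \<epsilon> *\<^sub>R 1 \<in> pos_cone (min_tensor \<pi> (cuntz_algebra n S) \<rho> A)"
    unfolding strict_dual_row_contraction_def strict_pos_cone_def by blast
  \<comment> \<open>Capped at 1 as \<open>strict_arrow_exists\<close> requires; with \<tau> equal to
    \<open>1 - s / 2\<close> the slack is \<open>s / 2\<close>.\<close>
  define s where "s = min \<epsilon> 1"
  have s: "0 < s" "s \<le> 1" "s \<le> \<epsilon>" using \<epsilon> by (auto simp: s_def)
  have lower: "s * (norm g)\<^sup>2 \<le> qform (dual_row_element n S x \<pi> \<rho>) g" for g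
  proof -
    have "s * (norm g)\<^sup>2 \<le> \<epsilon> * (norm g)\<^sup>2" using s by (intro mult_right_mono) auto
    with qform_pos_cone[OF pos, of g] show ?thesis by (simp add: qform_diff qform_scaleR)
  qed
  interpret cstar_ell2_rep A \<rho> n x "\<lambda>j. \<pi> (S j)" s "1 - s / 2"
  proof
    show "s * (norm g)\<^sup>2 \<le> qform (bop_tensor 1 1 + (\<Sum>j=1..n. bop_tensor (\<pi> (S j)) (\<rho> (star (x j))))
      + (\<Sum>j=1..n. bop_tensor (star (\<pi> (S j))) (\<rho> (x j)))) g" for g
      using lower[of g] unfolding dual_row_element_eq[OF assms(2) \<pi> \<rho>] .
  qed (use * \<rho> cuntz_algebra_rep(1)[OF assms(2) \<pi>] assms(1) s in auto)
  show "\<exists>a\<in>strict_pos_cone A. \<exists>b\<in>strict_pos_cone A.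
      a + b = 1 \<and> arrow_mat n a b x \<in> mat_strict_pos_cone (n + 1) A"
    by (rule strict_arrow_exists[OF s(1,2) refl])
next
  assume *: "von_neumann_algebra M \<and> (\<forall>j\<in>{1..n}. y j \<in> M) \<and> dual_row_contraction n S M y"
  then obtain \<pi> :: "'o \<Rightarrow> 'o ell2 bop" and \<rho> :: "'h bop \<Rightarrow> 'h bop ell2 bop"
    where \<pi>: "faithful_rep (cuntz_algebra n S) \<pi>" and \<rho>: "faithful_rep M \<rho>"
      and pos: "dual_row_element n S y \<pi> \<rho> \<in> pos_cone (min_tensor \<pi> (cuntz_algebra n S) \<rho> M)"
    unfolding dual_row_contraction_def by blast
  interpret von_neumann M by standard (use * in simp)
  show "\<exists>a\<in>pos_cone M. \<exists>b\<in>pos_cone M. a + b = 1 \<and> arrow_mat n a b y \<in> mat_pos_cone (n + 1) M"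
  proof (rule dual_row_arrow_exists[OF \<rho> cuntz_algebra_rep(1)[OF assms(2) \<pi>] assms(1)])
    show "0 \<le> qform (bop_tensor 1 1 + (\<Sum>j=1..n. bop_tensor (\<pi> (S j)) (\<rho> (star (y j))))
      + (\<Sum>j=1..n. bop_tensor (star (\<pi> (S j))) (\<rho> (y j)))) g" for g
      using qform_pos_cone[OF pos, of g] unfolding dual_row_element_eq[OF assms(2) \<pi> \<rho>] .
  qed (use * in blast)
qed

end
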